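(* Fix constants $\alpha,K,M_0,M>0$. For every $q\in[2,\infty]$, along sequences $(n,d,\rho)$ in the asymptotic regime described in the context, $$ \inf_{\hat\Sigma\in\mathcal M_\rho}\ \sup_{P\in\mathcal P_\alpha^{\mathcal F}} d^{-\frac2q}\,\mathbb E_P\|\hat\Sigma-\Sigma(P)\|_{\mathcal S_q}^2 \;\gtrsim\; \Bigl(n^{-\frac{2\alpha}{2\alpha+1}}\wedge\frac dn\Bigr)+\Bigl(\bigl(\tfrac{d}{\rho n^2}\bigr)^{\frac{\alpha}{\alpha+1}}\wedge\frac{d^3}{\rho n^2}\Bigr), $$ with the convention $2/\infty=0$.
   Context: Norms: $\|\cdot\|$ is the spectral norm; $\|A\|_{\mathcal S_q}=(\sum_i\sigma_i(A)^q)^{1/q}$ is the Schatten-$q$ norm, $\sigma_i(A)$ being the singular values, with $\|A\|_{\mathcal S_\infty}=\|A\|$; $a\wedge b=\min(a,b)$. For a random variable $\xi$, $\|\xi\|_{\psi_2}=\inf\{t>0:\mathbb E e^{\xi^2/t^2}\le2\}$; for a random vector $X$, $\|X\|_{\psi_2}=\sup_{\|v\|_2=1}\|\langle X,v\rangle\|_{\psi_2}$. Privacy. Two datasets of $n$ points of $\mathbb R^d$ are adjacent if they differ in one observation. For $\lambda>1$ the R\'enyi divergence of laws $P,Q$ is $D_\lambda(P\|Q)=\frac1{\lambda-1}\log\int(\frac{dP}{dQ})^\lambda dQ$ ($=\infty$ if $P\not\ll Q$). A randomized algorithm $A$ is $\rho$-zCDP if $D_\lambda(A(S)\|A(S'))\le\rho\lambda$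 for all adjacent $S,S'$ and all $\lambda\in(1,\infty)$ (divergence over the internal randomness of $A$ only). $\mathcal M_\rho$ is the set of all $\rho$-zCDP estimators (random $d\times d$ matrices) based on $n$ observations. Covariance class. For a matrix $\Sigma$ and $R\subseteq[d]^2$, $\Sigma_R$ denotes $\Sigma$ with all entries outside $R$ set to zero. A block is a set $R=I\times J$ with $I,J\subseteq[d]$; it is $k$-off-diagonal if it is contained in $\{(i,j):j\ge i+k\}$ or in $\{(i,j):i\ge j+k\}$. The separated-block class $\mathcal F_\alpha(M_0,M)$ is the set of $d\times d$ covariance matrices with $0\preceq\Sigma\preceq M_0I_d$ and $\|\Sigma_R\|\le Mk^{-\alpha}$ for every $k\ge1$ and every $k$-off-diagonal block $R$. Model. $\mathcal P_\alpha^{\mathcal F}=\mathcal P_\alpha^{\mathcal F}(K,M_0,M)$ is the set of distributions $P$ on $\mathbb R^d$ such that $X\sim P$ with mean $\mu$ and covariance $\Sigma(P)$ satisfies $\|X-\mu\|_{\psi_2}\le K$ and $\Sigma(P)\in\mathcal F_\alpha(M_0,M)$. $\mathbb E_P$ is expectation over $n$ i.i.d. observations from $P$ and over the randomness of the estimator. Asymptotic regime. Statements are along sequences $(n,d,\rho)=(n,d_n,\rho_n)$, $n\to\infty$, with $d\gtrsim\log n$, $0<\rho\lesssim1$ (a fixed upper bound), and $d/(\rho n^2)\to0$. $a\gtrsim b$ means $a\ge cb$ for all sufficiently large $n$ with $c>0$ not depending on $n,d,\rho$ (it may depend on $\alpha,K,M_0,M$ and on the fixed constants in the regime conditions). *)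

theory Defs
  imports
    "HOL-Probability.Probability"
    "Jordan_Normal_Form.Char_Poly"
begin

hide_type (open) Finite_Cartesian_Product.vec
hide_const (open) Finite_Cartesian_Product.vec Determinants.det Finite_Cartesian_Product.mat Finite_Cartesian_Product.row
unbundle no inner_syntax

text \<open>The dimension varies with the sample size, so random vectors and matrices live on the product
  Borel spaces over \<open>{..<d}\<close> and \<open>{..<d} \<times> {..<d}\<close> (indices starting at 0), and \<^term>\<open>vec d\<close> and
  \<^term>\<open>mat d d\<close> turn their points into the vectors and matrices used for the linear algebra.\<close>

definition point_space :: "nat \<Rightarrow> (nat \<Rightarrow> real) measure" where
  "point_space d = PiM {..<d} (\<lambda>_. borel)"

definition data_space :: "nat \<Rightarrow> nat \<Rightarrow> (nat \<Rightarrow> nat \<Rightarrow> real) measure" where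
  "data_space n d = PiM {..<n} (\<lambda>_. point_space d)"

definition matrix_space :: "nat \<Rightarrow> (nat \<times> nat \<Rightarrow> real) measure" where
  "matrix_space d = PiM ({..<d} \<times> {..<d}) (\<lambda>_. borel)"

text \<open>The supremum is over the closed unit ball, which contains 0, so it is also meaningful in dimension 0.\<close>

definition spectral_norm :: "real mat \<Rightarrow> real" where
  "spectral_norm A =
     (SUP v\<in>{v \<in> carrier_vec (dim_col A). v \<bullet> v \<le> 1}. sqrt ((A *\<^sub>v v) \<bullet> (A *\<^sub>v v)))"

text \<open>The real symmetric matrix \<open>A\<^sup>T A\<close> has only real, nonnegative eigenvalues, so \<^const>\<open>proots\<close> lists
  all of them with multiplicity.\<close>

definition singular_values :: "real mat \<Rightarrow> real multiset" where
  "singular_values A = image_mset sqrt (proots (char_poly (transpose_mat A * A)))"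

definition schatten_norm :: "ereal \<Rightarrow> real mat \<Rightarrow> real" where
  "schatten_norm q A =
     (if q = \<infinity> then spectral_norm A
      else (\<Sum>s\<in>#singular_values A. s powr real_of_ereal q) powr (1 / real_of_ereal q))"

text \<open>The \<open>\<psi>\<^sub>2\<close> norms are extended valued: the infimum over the empty set is \<open>\<infinity>\<close>.\<close>

definition psi2_norm :: "'a measure \<Rightarrow> ('a \<Rightarrow> real) \<Rightarrow> ennreal" where
  "psi2_norm M \<xi> =
     (INF t\<in>{t::real. 0 < t \<and> (\<integral>\<^sup>+\<omega>. ennreal (exp ((\<xi> \<omega>)\<^sup>2 / t\<^sup>2)) \<partial>M) \<le> 2}. ennreal t)"

definition psi2_norm_vec :: "nat \<Rightarrow> 'a measure \<Rightarrow> ('a \<Rightarrow> real vec) \<Rightarrow> ennreal" where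
  "psi2_norm_vec d M X = (SUP v\<in>{v \<in> carrier_vec d. v \<bullet> v = 1}. psi2_norm M (\<lambda>\<omega>. X \<omega> \<bullet> v))"

definition mean_vec :: "nat \<Rightarrow> (nat \<Rightarrow> real) measure \<Rightarrow> real vec" where
  "mean_vec d P = vec d (\<lambda>i. \<integral>x. x i \<partial>P)"

definition cov_mat :: "nat \<Rightarrow> (nat \<Rightarrow> real) measure \<Rightarrow> real mat" where
  "cov_mat d P =
     mat d d (\<lambda>(i, j). \<integral>x. (x i - mean_vec d P $ i) * (x j - mean_vec d P $ j) \<partial>P)"

definition restrict_entries :: "real mat \<Rightarrow> (nat \<times> nat) set \<Rightarrow> real mat" where
  "restrict_entries A R =
     mat (dim_row A) (dim_col A) (\<lambda>ij. if ij \<in> R then A $$ ij else 0)"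

definition is_block :: "nat \<Rightarrow> (nat \<times> nat) set \<Rightarrow> bool" where
  "is_block d R \<longleftrightarrow> (\<exists>I J. I \<subseteq> {..<d} \<and> J \<subseteq> {..<d} \<and> R = I \<times> J)"

definition off_diagonal :: "nat \<Rightarrow> (nat \<times> nat) set \<Rightarrow> bool" where
  "off_diagonal k R \<longleftrightarrow> R \<subseteq> {(i, j). j \<ge> i + k} \<or> R \<subseteq> {(i, j). i \<ge> j + k}"

definition separated_block_class :: "nat \<Rightarrow> real \<Rightarrow> real \<Rightarrow> real \<Rightarrow> real mat set" where
  "separated_block_class d \<alpha> M\<^sub>0 M =
     {\<Sigma> \<in> carrier_mat d d.
        transpose_mat \<Sigma> = \<Sigma> \<and>
        (\<forall>v\<in>carrier_vec d. 0 \<le> v \<bullet> (\<Sigma> *\<^sub>v v) \<and> v \<bullet> (\<Sigma> *\<^sub>v v) \<le> M\<^sub>0 * (v \<bullet> v)) \<and>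
        (\<forall>k\<ge>1. \<forall>R. is_block d R \<and> off_diagonal k R \<longrightarrow>
           spectral_norm (restrict_entries \<Sigma> R) \<le> M * real k powr (- \<alpha>))}"

text \<open>A finite \<open>\<psi>\<^sub>2\<close> norm makes all coordinates square integrable, so that the Bochner integrals in
  \<^const>\<open>mean_vec\<close> and \<^const>\<open>cov_mat\<close> are the actual mean and covariance.\<close>

definition distribution_class ::
  "nat \<Rightarrow> real \<Rightarrow> real \<Rightarrow> real \<Rightarrow> real \<Rightarrow> (nat \<Rightarrow> real) measure set" where
  "distribution_class d \<alpha> K M\<^sub>0 M =
     {P \<in> space (prob_algebra (point_space d)).
        psi2_norm_vec d P (\<lambda>x. vec d x - mean_vec d P) \<le> ennreal K \<and>
        cov_mat d P \<in> separated_block_class d \<alpha> M\<^sub>0 M}"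

definition adjacent :: "nat \<Rightarrow> (nat \<Rightarrow> 'a) \<Rightarrow> (nat \<Rightarrow> 'a) \<Rightarrow> bool" where
  "adjacent n S S' \<longleftrightarrow> (\<exists>i<n. S i \<noteq> S' i \<and> (\<forall>j<n. j \<noteq> i \<longrightarrow> S j = S' j))"

text \<open>\<^term>\<open>RN_deriv Q P\<close> is \<open>dP/dQ\<close>.\<close>

definition renyi_divergence :: "real \<Rightarrow> 'a measure \<Rightarrow> 'a measure \<Rightarrow> ereal" where
  "renyi_divergence l P Q =
     (let I = \<integral>\<^sup>+x. ennreal (enn2real (RN_deriv Q P x) powr l) \<partial>Q
      in if absolutely_continuous Q P \<and> I < \<infinity> then ereal (ln (enn2real I) / (l - 1)) else \<infinity>)"

text \<open>A randomized algorithm is a Markov kernel from datasets to matrices.\<close>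

definition zCDP_estimators ::
  "nat \<Rightarrow> nat \<Rightarrow> real \<Rightarrow> ((nat \<Rightarrow> nat \<Rightarrow> real) \<Rightarrow> (nat \<times> nat \<Rightarrow> real) measure) set" where
  "zCDP_estimators n d \<rho> =
     {A \<in> data_space n d \<rightarrow>\<^sub>M prob_algebra (matrix_space d).
        \<forall>S\<in>space (data_space n d). \<forall>S'\<in>space (data_space n d). adjacent n S S' \<longrightarrow>
          (\<forall>l>1. renyi_divergence l (A S) (A S') \<le> ereal (\<rho> * l))}"

definition schatten_risk ::
  "nat \<Rightarrow> nat \<Rightarrow> ereal \<Rightarrow> ((nat \<Rightarrow> nat \<Rightarrow> real) \<Rightarrow> (nat \<times> nat \<Rightarrow> real) measure) \<Rightarrow>
     (nat \<Rightarrow> real) measure \<Rightarrow> ennreal" where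
  "schatten_risk n d q A P =
     (\<integral>\<^sup>+S. (\<integral>\<^sup>+B. ennreal ((schatten_norm q (mat d d B - cov_mat d P))\<^sup>2) \<partial>A S)
        \<partial>PiM {..<n} (\<lambda>_. P))"

end

theory Submission
  imports Defs "Jordan_Normal_Form.Schur_Decomposition"
begin

text \<open>For \<open>q \<ge> 2\<close> the power mean inequality gives
  \<open>d powr (-2/q) * (schatten_norm q A)\<^sup>2 \<ge> frobenius_sq A / d\<close>, so the case \<open>q = 2\<close> implies all
others with the same constant, and the task is to show that a matrix with many free entries cannot be
estimated well in Frobenius norm.

The hard distributions are sheared Gaussians. Cut the coordinates into blocks of length \<open>2k\<close>; in
each block let the first half \<open>z\<close> be standard Gaussian and the second half be \<open>\<delta> \<Theta> z + \<xi>\<close> with fresh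
standard Gaussian noise \<open>\<xi>\<close> and a \<open>k \<times> k\<close> matrix \<open>\<Theta>\<close>, and scale everything by a constant \<open>s\<close>. The
entries \<open>s\<^sup>2 \<delta> \<Theta>\<close> sit in the covariance, every \<open>\<Theta>\<close> is admissible as a parameter (there is no positivity
constraint), and the score of an entry at one observation is \<open>\<delta>\<close> times the product of the noise and the
regressor that the entry links; these products are orthonormal. If the operator norm of each \<open>\<Theta>\<close> is
\<open>O(\<surd>k)\<close>, the covariance lies in the separated-block class as soon as \<open>\<delta> \<surd>k\<close> is a small multiple of \<open>k powr (-\<alpha>)\<close>.

The prior on \<open>\<Theta>\<close> is Gaussian, multiplied in each block by a continuously differentiable factor, the square
of a cutoff, that vanishes unless finitely many exponentials \<open>exp (x\<^sup>T \<Theta> y / \<surd>k)\<close>, with \<open>x, y\<close> in a net of lattice vectors, have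
a bounded sum. This forces the operator norm bound, while integration by parts in the prior stays free of
boundary terms and the cutoff costs only a constant factor in the Fisher information of the prior.
Integrating the derivative of posterior density times error over each entry gives the exact identity
\<open>score_identity\<close>. Summed over all \<open>N\<close> entries and normalised, the left side is \<open>N\<close>, and the right side is a
correlation of the estimation error with the scores of the observations and of the prior. Two bounds for
this correlation give the two terms of the rate:

\<^item> By Cauchy-Schwarz and independence of the \<open>n\<close> scores it is controlled by \<open>n \<delta>\<^sup>2 N\<close>
  (\<open>independent_cross_bound\<close>); so \<open>\<delta>\<^sup>2\<close> of order \<open>1/n\<close> is affordable. This is the statistical term.

\<^item> The error correlates with the score of observation \<open>i\<close> only because the estimator has seen that
  observation. Exchanging it for an independent copy makes the correlation vanish, and zCDP at order 2
  bounds the change of the output law in \<open>\<chi>\<^sup>2\<close>-distance by \<open>exp (2\<rho>) - 1\<close>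
  (\<open>private_cross_bound\<close>); so \<open>\<delta>\<^sup>2\<close> of order \<open>N / (\<rho> n\<^sup>2)\<close> is affordable. This is the privacy term.

In both cases the risk in the entries is at least a constant times \<open>N\<close> (\<open>block_minimax_bound\<close>), hence
the normalised Frobenius risk is at least a constant times \<open>\<delta>\<^sup>2 N / d\<close>, which is of order \<open>\<delta>\<^sup>2 k\<close>.
Balancing the admissible \<open>\<delta>\<close> with the class constraint determines \<open>k\<close> and the stated rates.\<close>

section \<open>Gaussian product measures\<close>

abbreviation std_gauss :: "real measure" where
  "std_gauss \<equiv> density lborel (\<lambda>x. ennreal (std_normal_density x))"

definition gauss :: "'i set \<Rightarrow> ('i \<Rightarrow> real) measure" where
  "gauss I = PiM I (\<lambda>_. std_gauss)"

lemma prob_space_std_gauss: "prob_space std_gauss"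
  by (rule prob_space_normal_density) simp

interpretation std_gauss: product_prob_space "\<lambda>_. std_gauss" I for I :: "'i set"
  by (intro product_prob_spaceI prob_space_std_gauss)

lemma prob_space_gauss: "prob_space (gauss I)"
  unfolding gauss_def by (rule prob_space_PiM) (rule prob_space_std_gauss)

lemma sets_gauss [measurable_cong, simp]: "sets (gauss I) = sets (PiM I (\<lambda>_. borel))"
  unfolding gauss_def by (intro sets_PiM_cong) auto

lemma space_gauss [simp]: "space (gauss I) = PiE I (\<lambda>_. UNIV)"
  by (simp add: gauss_def space_PiM)

text \<open>Both sides are measures on the product space that agree on boxes, by Tonelli.\<close>

lemma PiM_density:
  assumes "finite I" and M: "\<And>i. prob_space (M i)"
    and f[measurable]: "\<And>i. i \<in> I \<Longrightarrow> f i \<in> borel_measurable (M i)"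
    and D: "\<And>i. i \<in> I \<Longrightarrow> prob_space (density (M i) (f i))"
  shows "PiM I (\<lambda>i. density (M i) (f i)) = density (PiM I M) (\<lambda>x. \<Prod>i\<in>I. f i (x i) :: ennreal)"
proof -
  define N where "N = (\<lambda>i. if i \<in> I then density (M i) (f i) else M i)"
  interpret N: product_prob_space N I
    by (intro product_prob_spaceI) (auto simp: N_def M D)
  interpret M: product_prob_space M I
    by (intro product_prob_spaceI M)
  have "density (PiM I M) (\<lambda>x. \<Prod>i\<in>I. f i (x i)) = PiM I N"
  proof (rule N.PiM_eqI[OF \<open>finite I\<close>])
    show "sets (density (PiM I M) (\<lambda>x. \<Prod>i\<in>I. f i (x i))) = sets (PiM I N)"
      by (simp, intro sets_PiM_cong) (auto simp: N_def)
    fix A assume A: "\<And>i. i \<in> I \<Longrightarrow> A i \<in> sets (N i)"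
    then have A'[measurable]: "\<And>i. i \<in> I \<Longrightarrow> A i \<in> sets (M i)" by (auto simp: N_def)
    have "emeasure (density (PiM I M) (\<lambda>x. \<Prod>i\<in>I. f i (x i))) (Pi\<^sub>E I A)
        = (\<integral>\<^sup>+x. (\<Prod>i\<in>I. f i (x i)) * indicator (Pi\<^sub>E I A) x \<partial>PiM I M)"
      using A' \<open>finite I\<close> by (intro emeasure_density sets_PiM_I_finite) measurable
    also have "\<dots> = (\<integral>\<^sup>+x. (\<Prod>i\<in>I. f i (x i) * indicator (A i) (x i)) \<partial>PiM I M)"
    proof (rule nn_integral_cong)
      fix x assume x: "x \<in> space (PiM I M)"
      have "indicator (Pi\<^sub>E I A) x = (\<Prod>i\<in>I. indicator (A i) (x i) :: ennreal)"
      proof (cases "x \<in> Pi\<^sub>E I A")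
        case True then show ?thesis by (auto simp: PiE_def Pi_def intro!: prod.neutral[symmetric])
      next
        case False
        then obtain i where "i \<in> I" "x i \<notin> A i" using x by (auto simp: space_PiM PiE_def Pi_def)
        then have "(\<Prod>i\<in>I. indicator (A i) (x i) :: ennreal) = 0"
          by (intro prod_zero \<open>finite I\<close>) (auto intro!: bexI[of _ i])
        then show ?thesis using False by simp
      qed
      then show "(\<Prod>i\<in>I. f i (x i)) * indicator (Pi\<^sub>E I A) x = (\<Prod>i\<in>I. f i (x i) * indicator (A i) (x i))"
        by (simp add: prod.distrib)
    qed
    also have "\<dots> = (\<Prod>i\<in>I. \<integral>\<^sup>+x. f i x * indicator (A i) x \<partial>M i)"
      by (intro M.product_nn_integral_prod \<open>finite I\<close>) measurable
    also have "\<dots> = (\<Prod>i\<in>I. emeasure (N i) (A i))"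
      using A' by (intro prod.cong refl) (simp add: N_def emeasure_density)
    finally show "emeasure (density (PiM I M) (\<lambda>x. \<Prod>i\<in>I. f i (x i))) (Pi\<^sub>E I A) = (\<Prod>i\<in>I. emeasure (N i) (A i))" .
  qed
  moreover have "PiM I N = PiM I (\<lambda>i. density (M i) (f i))"
    by (intro PiM_cong) (auto simp: N_def)
  ultimately show ?thesis by simp
qed

text \<open>The Cameron-Martin formula on the line: completing the square turns a shift of the standard Gaussian into an
exponential density.\<close>

lemma std_gauss_translate:
  "distr std_gauss borel (\<lambda>x. x + c) = density std_gauss (\<lambda>x. ennreal (exp (c * x - c\<^sup>2 / 2)))"
proof (rule measure_eqI)
  fix A :: "real set" assume "A \<in> sets (distr std_gauss borel (\<lambda>x. x + c))"
  then have A[measurable]: "A \<in> sets borel" by simp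
  have "emeasure (distr std_gauss borel (\<lambda>x. x + c)) A = (\<integral>\<^sup>+x. (indicator A (x + c) :: ennreal) \<partial>std_gauss)"
    by (subst nn_integral_indicator[symmetric], simp, subst nn_integral_distr) auto
  also have "\<dots> = (\<integral>\<^sup>+x. ennreal (std_normal_density x) * indicator A (c + 1 * x) \<partial>lborel)"
    by (subst nn_integral_density) (auto simp: add.commute)
  also have "\<dots> = (\<integral>\<^sup>+x. ennreal (std_normal_density (x - c)) * indicator A x \<partial>lborel)"
    using nn_integral_real_affine[of "\<lambda>x. ennreal (std_normal_density (x - c)) * indicator A x" 1 c] by simp
  also have "\<dots> = (\<integral>\<^sup>+x. ennreal (std_normal_density x) * (ennreal (exp (c * x - c\<^sup>2 / 2)) * indicator A x) \<partial>lborel)"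
  proof (rule nn_integral_cong)
    fix x
    have "std_normal_density (x - c) = std_normal_density x * exp (c * x - c\<^sup>2 / 2)"
      by (simp add: std_normal_density_def exp_add[symmetric] power2_eq_square field_simps)
    then show "ennreal (std_normal_density (x - c)) * indicator A x
       = ennreal (std_normal_density x) * (ennreal (exp (c * x - c\<^sup>2 / 2)) * indicator A x)"
      by (simp add: ennreal_mult' mult.assoc)
  qed
  also have "\<dots> = emeasure (density std_gauss (\<lambda>x. ennreal (exp (c * x - c\<^sup>2 / 2)))) A"
    by (subst emeasure_density) (auto simp: nn_integral_density)
  finally show "emeasure (distr std_gauss borel (\<lambda>x. x + c)) A
    = emeasure (density std_gauss (\<lambda>x. ennreal (exp (c * x - c\<^sup>2 / 2)))) A" .
qed simp

lemma gauss_translate: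
  assumes "finite W"
  shows "distr (gauss W) (gauss W) (\<lambda>w. \<lambda>i\<in>W. w i + c i)
       = density (gauss W) (\<lambda>w. \<Prod>i\<in>W. ennreal (exp (c i * w i - (c i)\<^sup>2 / 2)))"
proof -
  define N where "N = (\<lambda>i. density std_gauss (\<lambda>x. ennreal (exp (c i * x - (c i)\<^sup>2 / 2))))"
  have N: "prob_space (N i)" for i
    unfolding N_def std_gauss_translate[symmetric]
    by (intro prob_space.prob_space_distr prob_space_std_gauss) simp
  interpret N: product_prob_space N W by (intro product_prob_spaceI N)
  have "distr (gauss W) (gauss W) (\<lambda>w. \<lambda>i\<in>W. w i + c i) = PiM W N"
  proof (rule N.PiM_eqI[OF assms])
    show "sets (distr (gauss W) (gauss W) (\<lambda>w. \<lambda>i\<in>W. w i + c i)) = sets (PiM W N)"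
      by (simp add: N_def, intro sets_PiM_cong) auto
    fix A assume "\<And>i. i \<in> W \<Longrightarrow> A i \<in> sets (N i)"
    then have A[measurable]: "\<And>i. i \<in> W \<Longrightarrow> A i \<in> sets borel" by (auto simp: N_def)
    have "emeasure (distr (gauss W) (gauss W) (\<lambda>w. \<lambda>i\<in>W. w i + c i)) (Pi\<^sub>E W A)
       = emeasure (gauss W) ((\<lambda>w. \<lambda>i\<in>W. w i + c i) -` (Pi\<^sub>E W A) \<inter> space (gauss W))"
      using A assms by (intro emeasure_distr) (auto intro!: sets_PiM_I_finite)
    also have "(\<lambda>w. \<lambda>i\<in>W. w i + c i) -` (Pi\<^sub>E W A) \<inter> space (gauss W) = (\<Pi>\<^sub>E i\<in>W. (\<lambda>x. x + c i) -` A i)"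
      by (auto simp: PiE_def Pi_def)
    also have "emeasure (gauss W) \<dots> = (\<Prod>i\<in>W. emeasure std_gauss ((\<lambda>x. x + c i) -` A i))"
      unfolding gauss_def
      by (intro std_gauss.emeasure_PiM assms)
         (use A in \<open>auto intro!: measurable_sets_borel[of _ borel]\<close>)
    also have "\<dots> = (\<Prod>i\<in>W. emeasure (N i) (A i))"
      unfolding N_def std_gauss_translate[symmetric]
      using A by (intro prod.cong refl) (subst emeasure_distr, auto)
    finally show "emeasure (distr (gauss W) (gauss W) (\<lambda>w. \<lambda>i\<in>W. w i + c i)) (Pi\<^sub>E W A)
        = (\<Prod>i\<in>W. emeasure (N i) (A i))" .
  qed
  also have "\<dots> = density (gauss W) (\<lambda>w. \<Prod>i\<in>W. ennreal (exp (c i * w i - (c i)\<^sup>2 / 2)))"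
    unfolding N_def gauss_def
    by (intro PiM_density assms prob_space_std_gauss) (auto simp: N[unfolded N_def])
  finally show ?thesis .
qed

lemma std_gauss_moment_integrable: "integrable std_gauss (\<lambda>x. x ^ k)"
  using integrable_std_normal_moment[of k] by (subst integrable_density) auto

lemma std_gauss_moment_1: "(\<integral>x. x \<partial>std_gauss) = 0"
  using integral_std_normal_moment_odd[of 0] by (subst integral_density) auto

lemma std_gauss_moment_2: "(\<integral>x. x\<^sup>2 \<partial>std_gauss) = 1"
  using integral_std_normal_moment_even[of 1] by (subst integral_density) (auto simp: fact_numeral)

lemma
  assumes "finite I"
  shows gauss_monomial_integrable: "integrable (gauss I) (\<lambda>g. \<Prod>i\<in>I. g i ^ e i)"
    and gauss_monomial_integral: "(\<integral>g. (\<Prod>i\<in>I. g i ^ e i) \<partial>gauss I) = (\<Prod>i\<in>I. \<integral>x. x ^ e i \<partial>std_gauss)"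
  unfolding gauss_def
  by (rule std_gauss.product_integrable_prod std_gauss.product_integral_prod;
      simp add: assms std_gauss_moment_integrable)+

lemma gauss_monomial_integral_zero:
  assumes "finite I" "i \<in> I" "e i = 1"
  shows "(\<integral>g. (\<Prod>i\<in>I. g i ^ e i) \<partial>gauss I) = 0"
  using assms by (subst gauss_monomial_integral, simp)
    (rule prod_zero, auto intro!: bexI[of _ i] simp: std_gauss_moment_1)

lemma power_indicator_prod:
  assumes "finite I" "i \<in> I"
  shows "(\<Prod>l\<in>I. (g l :: real) ^ (if l = i then 1 else 0)) = g i"
proof -
  have "(\<Prod>l\<in>I. g l ^ (if l = i then 1 else 0)) = (\<Prod>l\<in>I. if l = i then g l else 1)"
    by (intro prod.cong) auto
  then show ?thesis using assms by simp
qed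

lemma
  assumes "finite I" "i \<in> I"
  shows gauss_integrable_coord: "integrable (gauss I) (\<lambda>g. g i)"
    and gauss_mean: "(\<integral>g. g i \<partial>gauss I) = 0"
  using gauss_monomial_integrable[OF assms(1), of "\<lambda>l. if l = i then 1 else 0"]
    gauss_monomial_integral_zero[OF assms, of "\<lambda>l. if l = i then 1 else 0"]
  by (simp_all add: power_indicator_prod[OF assms] del: One_nat_def)

lemma
  assumes I: "finite I" "i \<in> I" "j \<in> I"
  shows gauss_integrable_coord2: "integrable (gauss I) (\<lambda>g. g i * g j)"
    and gauss_cov: "(\<integral>g. g i * g j \<partial>gauss I) = (if i = j then 1 else 0)"
proof -
  define e where "e l = (if l = i then 1 else 0) + (if l = j then 1 else (0::nat))" for l
  have eq: "(\<Prod>l\<in>I. g l ^ e l) = g i * g j" for g :: "_ \<Rightarrow> real"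
    by (simp add: e_def power_add prod.distrib power_indicator_prod I del: One_nat_def)
  show "integrable (gauss I) (\<lambda>g. g i * g j)"
    using gauss_monomial_integrable[OF I(1), of e] by (simp add: eq)
  show "(\<integral>g. g i * g j \<partial>gauss I) = (if i = j then 1 else 0)"
  proof (cases "i = j")
    case True
    have "(\<integral>g. g i * g j \<partial>gauss I) = (\<Prod>l\<in>I. \<integral>x. x ^ e l \<partial>std_gauss)"
      using gauss_monomial_integral[OF I(1), of e] by (simp add: eq)
    also have "\<dots> = 1"
      by (rule prod.neutral) (auto simp: e_def True std_gauss_moment_2 numeral_2_eq_2[symmetric]
          prob_space.prob_space[OF prob_space_std_gauss, simplified])
    finally show ?thesis using True by simp
  next
    case False
    then show ?thesis using gauss_monomial_integral_zero[OF I(1,2), of e] by (simp add: eq) (simp add: e_def)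
  qed
qed

text \<open>These moments say that the products \<open>g w * g z\<close>, which are the scores of the model below, are orthonormal. A
product of four coordinates has nonzero mean only if every coordinate occurs an even number of times.\<close>

lemma
  assumes I: "finite I" "w \<in> W" "w' \<in> W" "z \<in> Z" "z' \<in> Z" "W \<subseteq> I" "Z \<subseteq> I" "W \<inter> Z = {}"
  shows gauss_integrable_coord4: "integrable (gauss I) (\<lambda>g. (g w * g z) * (g w' * g z'))"
    and gauss_moment4: "(\<integral>g. (g w * g z) * (g w' * g z') \<partial>gauss I) = (if (w, z) = (w', z') then 1 else 0)"
proof -
  have mem: "w \<in> I" "w' \<in> I" "z \<in> I" "z' \<in> I" and ne: "w \<noteq> z" "w \<noteq> z'" "w' \<noteq> z" "w' \<noteq> z'" using I by auto
  define e where "e l = ((if l = w then 1 else 0) + (if l = z then 1 else (0::nat)))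
     + ((if l = w' then 1 else 0) + (if l = z' then 1 else (0::nat)))" for l
  have eq: "(\<Prod>l\<in>I. g l ^ e l) = (g w * g z) * (g w' * g z')" for g :: "_ \<Rightarrow> real"
    by (simp add: e_def power_add prod.distrib power_indicator_prod I mem del: One_nat_def)
  show "integrable (gauss I) (\<lambda>g. (g w * g z) * (g w' * g z'))"
    using gauss_monomial_integrable[OF I(1), of e] by (simp add: eq)
  show "(\<integral>g. (g w * g z) * (g w' * g z') \<partial>gauss I) = (if (w, z) = (w', z') then 1 else 0)"
  proof (cases "(w, z) = (w', z')")
    case True
    have "(\<integral>g. (g w * g z) * (g w' * g z') \<partial>gauss I) = (\<Prod>l\<in>I. \<integral>x. x ^ e l \<partial>std_gauss)"
      using gauss_monomial_integral[OF I(1), of e] by (simp add: eq)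
    also have "\<dots> = 1"
      by (rule prod.neutral) (use True ne in \<open>auto simp: e_def std_gauss_moment_2 numeral_2_eq_2[symmetric]
          prob_space.prob_space[OF prob_space_std_gauss, simplified]\<close>)
    finally show ?thesis using True by simp
  next
    case False
    then consider "w \<noteq> w'" | "z \<noteq> z'" by auto
    then have "(\<integral>g. (\<Prod>l\<in>I. g l ^ e l) \<partial>gauss I) = 0"
    proof cases
      case 1 then show ?thesis using ne by (intro gauss_monomial_integral_zero[OF I(1) mem(1)]) (auto simp: e_def)
    next
      case 2 then show ?thesis using ne by (intro gauss_monomial_integral_zero[OF I(1) mem(3)]) (auto simp: e_def)
    qed
    then show ?thesis using False by (simp add: eq)
  qed
qed

lemma std_gauss_mgf: "(\<integral>\<^sup>+x. ennreal (exp (t * x)) \<partial>std_gauss) = ennreal (exp (t\<^sup>2 / 2))"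
proof -
  interpret D: prob_space "density std_gauss (\<lambda>x. ennreal (exp (t * x - t\<^sup>2 / 2)))"
    unfolding std_gauss_translate[symmetric]
    by (intro prob_space.prob_space_distr prob_space_std_gauss) simp
  have "(\<integral>\<^sup>+x. ennreal (exp (t * x)) \<partial>std_gauss)
      = (\<integral>\<^sup>+x. ennreal (exp (t\<^sup>2 / 2)) * ennreal (exp (t * x - t\<^sup>2 / 2)) \<partial>std_gauss)"
    by (simp add: ennreal_mult'[symmetric] exp_add[symmetric])
  also have "\<dots> = ennreal (exp (t\<^sup>2 / 2)) * (\<integral>\<^sup>+x. ennreal (exp (t * x - t\<^sup>2 / 2)) \<partial>std_gauss)"
    by (rule nn_integral_cmult) simp
  also have "(\<integral>\<^sup>+x. ennreal (exp (t * x - t\<^sup>2 / 2)) \<partial>std_gauss) = 1"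
    using D.emeasure_space_1 by (simp add: emeasure_density cong: nn_integral_cong)
  finally show ?thesis by simp
qed

lemma gauss_mgf:
  assumes "finite I"
  shows "(\<integral>\<^sup>+g. ennreal (exp (\<Sum>i\<in>I. t i * g i)) \<partial>gauss I) = ennreal (exp ((\<Sum>i\<in>I. (t i)\<^sup>2) / 2))"
proof -
  have "(\<integral>\<^sup>+g. ennreal (exp (\<Sum>i\<in>I. t i * g i)) \<partial>gauss I)
      = (\<integral>\<^sup>+g. (\<Prod>i\<in>I. ennreal (exp (t i * g i))) \<partial>gauss I)"
    by (simp add: exp_sum assms prod_ennreal)
  also have "\<dots> = (\<Prod>i\<in>I. ennreal (exp ((t i)\<^sup>2 / 2)))"
    unfolding gauss_def by (subst std_gauss.product_nn_integral_prod) (auto simp: assms std_gauss_mgf)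
  also have "\<dots> = ennreal (exp ((\<Sum>i\<in>I. (t i)\<^sup>2) / 2))"
    by (simp add: prod_ennreal exp_sum[symmetric] assms sum_divide_distrib)
  finally show ?thesis .
qed

text \<open>The square in the exponent is linearised by an auxiliary standard Gaussian \<open>h\<close>, using
\<open>exp (u\<^sup>2 / 2) = E exp (h u)\<close>; after exchanging the two integrals a one-dimensional Gaussian integral remains,
with value \<open>1 / sqrt (1 - u) \<le> 2\<close>.\<close>

lemma gauss_exp_square:
  assumes I: "finite I" and a: "0 \<le> a" "2 * a * (\<Sum>i\<in>I. (t i)\<^sup>2) \<le> 3 / 4"
  shows "(\<integral>\<^sup>+g. ennreal (exp (a * (\<Sum>i\<in>I. t i * g i)\<^sup>2)) \<partial>gauss I) \<le> 2"
proof -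
  define u where "u = 2 * a * (\<Sum>i\<in>I. (t i)\<^sup>2)"
  have u: "0 \<le> u" "u \<le> 3 / 4" using a by (auto simp: u_def intro!: mult_nonneg_nonneg sum_nonneg)
  interpret pair_sigma_finite "gauss I" std_gauss
    by (intro pair_sigma_finite.intro prob_space_imp_sigma_finite prob_space_gauss prob_space_std_gauss)
  have "(\<integral>\<^sup>+g. ennreal (exp (a * (\<Sum>i\<in>I. t i * g i)\<^sup>2)) \<partial>gauss I)
     = (\<integral>\<^sup>+g. (\<integral>\<^sup>+h. ennreal (exp (sqrt (2 * a) * (\<Sum>i\<in>I. t i * g i) * h)) \<partial>std_gauss) \<partial>gauss I)"
    using a by (simp add: std_gauss_mgf power_mult_distrib)
  also have "\<dots> = (\<integral>\<^sup>+h. (\<integral>\<^sup>+g. ennreal (exp (sqrt (2 * a) * (\<Sum>i\<in>I. t i * g i) * h)) \<partial>gauss I) \<partial>std_gauss)"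
    by (rule Fubini'[symmetric]) measurable
  also have "\<dots> = (\<integral>\<^sup>+h. (\<integral>\<^sup>+g. ennreal (exp (\<Sum>i\<in>I. (sqrt (2 * a) * h * t i) * g i)) \<partial>gauss I) \<partial>std_gauss)"
    by (simp add: sum_distrib_left mult_ac)
  also have "\<dots> = (\<integral>\<^sup>+h. ennreal (exp (u * h\<^sup>2 / 2)) \<partial>std_gauss)"
    using a by (subst gauss_mgf[OF I])
      (simp add: u_def power_mult_distrib sum_distrib_left[symmetric] mult_ac)
  also have "\<dots> = (\<integral>\<^sup>+h. ennreal (std_normal_density h) * ennreal (exp (u * h\<^sup>2 / 2)) \<partial>lborel)"
    by (subst nn_integral_density) auto
  also have "\<dots> = (\<integral>\<^sup>+h. ennreal (1 / sqrt (1 - u)) * ennreal (normal_density 0 (1 / sqrt (1 - u)) h) \<partial>lborel)"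
  proof (rule nn_integral_cong)
    fix h :: real
    have "std_normal_density h * exp (u * h\<^sup>2 / 2) = 1 / sqrt (1 - u) * normal_density 0 (1 / sqrt (1 - u)) h"
      using u by (simp add: normal_density_def std_normal_density_def exp_add[symmetric] power_divide
          real_sqrt_divide real_sqrt_mult field_simps)
    then show "ennreal (std_normal_density h) * ennreal (exp (u * h\<^sup>2 / 2))
       = ennreal (1 / sqrt (1 - u)) * ennreal (normal_density 0 (1 / sqrt (1 - u)) h)"
      using u by (simp add: ennreal_mult'[symmetric] del: ennreal_mult'')
  qed
  also have "\<dots> = ennreal (1 / sqrt (1 - u)) * (\<integral>\<^sup>+h. ennreal (normal_density 0 (1 / sqrt (1 - u)) h) \<partial>lborel)"
    by (rule nn_integral_cmult) simp
  also have "(\<integral>\<^sup>+h. ennreal (normal_density 0 (1 / sqrt (1 - u)) h) \<partial>lborel) = 1"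
    using u by (subst nn_integral_eq_integral) (auto intro!: integrable_normal_density integral_normal_density)
  also have "1 / sqrt (1 - u) \<le> 2"
  proof -
    have "sqrt (1/4) \<le> sqrt (1 - u)" using u by (intro real_sqrt_le_mono) simp
    then have "1 / 2 \<le> sqrt (1 - u)" by (simp add: real_sqrt_divide)
    then show ?thesis using u by (simp add: field_simps)
  qed
  finally show ?thesis by (simp add: ennreal_leI)
qed

section \<open>The sheared Gaussian model\<close>

text \<open>A pair \<open>(i, j) \<in> J\<close> stands for an entry through which coordinate \<open>j\<close> acts on coordinate \<open>i\<close>. Since no
coordinate occurs on both sides, the shear \<open>x \<mapsto> x + B x\<close> is unipotent with \<open>B\<^sup>2 = 0\<close>.\<close>

locale shear_model =
  fixes d :: nat and J :: "(nat \<times> nat) set"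
  assumes J_sub: "J \<subseteq> {..<d} \<times> {..<d}" and J_disj: "fst ` J \<inter> snd ` J = {}"
begin

lemma finite_J [simp]: "finite J"
  using J_sub by (rule finite_subset) simp

lemma finite_J_row [simp]: "finite {j. (i, j) \<in> J}"
  using J_sub by (auto intro!: finite_subset[of _ "{..<d}"])

definition shift :: "(nat \<times> nat \<Rightarrow> real) \<Rightarrow> (nat \<Rightarrow> real) \<Rightarrow> nat \<Rightarrow> real" where
  "shift B x i = (\<Sum>j | (i, j) \<in> J. B (i, j) * x j)"

definition shear :: "(nat \<times> nat \<Rightarrow> real) \<Rightarrow> (nat \<Rightarrow> real) \<Rightarrow> nat \<Rightarrow> real" where
  "shear B x = (\<lambda>i\<in>{..<d}. x i + shift B x i)"

definition lik :: "(nat \<times> nat \<Rightarrow> real) \<Rightarrow> (nat \<Rightarrow> real) \<Rightarrow> real" where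
  "lik B x = exp (\<Sum>i<d. shift B x i * x i - (shift B x i)\<^sup>2 / 2)"

lemma shift_measurable [measurable]:
  "(\<lambda>x. shift B x i) \<in> borel_measurable (PiM {..<d} (\<lambda>_. borel))"
proof -
  have [measurable]: "(\<lambda>x. x j) \<in> borel_measurable (PiM {..<d} (\<lambda>_. borel :: real measure))" if "(i, j) \<in> J" for j
    using that J_sub by (intro measurable_component_singleton) auto
  show ?thesis unfolding shift_def by measurable
qed

lemma lik_measurable [measurable]: "lik B \<in> borel_measurable (PiM {..<d} (\<lambda>_. borel))"
  unfolding lik_def by measurable

lemma shear_measurable [measurable]: "shear B \<in> PiM {..<d} (\<lambda>_. borel) \<rightarrow>\<^sub>M PiM {..<d} (\<lambda>_. borel)"
  unfolding shear_def by measurable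

lemma shift_outside: "i \<notin> fst ` J \<Longrightarrow> shift B x i = 0"
  unfolding shift_def by (rule sum.neutral) force

lemma shift_cong: "(\<And>j. j \<in> snd ` J \<Longrightarrow> x j = y j) \<Longrightarrow> shift B x i = shift B y i"
  unfolding shift_def by (rule sum.cong) force+

text \<open>Conditionally on the coordinates that are not shifted the shear is a translation, whose Gaussian density is
known from \<open>gauss_translate\<close>; Fubini removes the conditioning.\<close>

lemma shear_law:
  "distr (gauss {..<d}) (gauss {..<d}) (shear B) = density (gauss {..<d}) (\<lambda>x. ennreal (lik B x))"
proof (rule measure_eqI)
  define W where "W = fst ` J"
  define V where "V = {..<d} - W"
  have WV: "V \<union> W = {..<d}" "V \<inter> W = {}" "finite V" "finite W" "snd ` J \<subseteq> V"
    using J_sub J_disj by (auto simp: W_def V_def)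
  fix A assume "A \<in> sets (distr (gauss {..<d}) (gauss {..<d}) (shear B))"
  then have A[measurable]: "A \<in> sets (PiM {..<d} (\<lambda>_. borel))" by simp
  have fold: "(\<integral>\<^sup>+x. f x \<partial>gauss {..<d}) = (\<integral>\<^sup>+v. (\<integral>\<^sup>+w. f (merge V W (v, w)) \<partial>gauss W) \<partial>gauss V)"
    if "f \<in> borel_measurable (PiM {..<d} (\<lambda>_. borel))" for f
  proof -
    have "f \<in> borel_measurable (PiM (V \<union> W) (\<lambda>_. std_gauss))"
      using that WV sets_gauss[of "{..<d}"] unfolding gauss_def
      by (simp cong: measurable_cong_sets)
    from std_gauss.product_nn_integral_fold[OF WV(2-4) this] show ?thesis
      by (simp add: gauss_def WV)
  qed
  have merge_meas: "(\<lambda>w. merge V W (v, w)) \<in> PiM W (\<lambda>_. borel) \<rightarrow>\<^sub>M PiM {..<d} (\<lambda>_. borel)"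
    if "v \<in> space (gauss V)" for v :: "nat \<Rightarrow> real"
  proof -
    have "(\<lambda>w. merge V W (v, w)) \<in> PiM W (\<lambda>_. borel) \<rightarrow>\<^sub>M PiM (V \<union> W) (\<lambda>_. borel :: real measure)"
      using that by (intro measurable_compose[OF _ measurable_merge] measurable_Pair1') (auto simp: space_PiM)
    then show ?thesis by (simp add: WV)
  qed
  have "emeasure (distr (gauss {..<d}) (gauss {..<d}) (shear B)) A = (\<integral>\<^sup>+x. indicator A (shear B x) \<partial>gauss {..<d})"
    by (subst nn_integral_indicator[symmetric], simp, subst nn_integral_distr) auto
  also have "\<dots> = (\<integral>\<^sup>+v. (\<integral>\<^sup>+w. indicator A (shear B (merge V W (v, w))) \<partial>gauss W) \<partial>gauss V)"
    by (rule fold) measurable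
  also have "\<dots> = (\<integral>\<^sup>+v. (\<integral>\<^sup>+w. ennreal (lik B (merge V W (v, w))) * indicator A (merge V W (v, w)) \<partial>gauss W) \<partial>gauss V)"
  proof (rule nn_integral_cong)
    fix v assume v: "v \<in> space (gauss V)"
    note [measurable] = merge_meas[OF v]
    have sm: "shift B (merge V W (v, w)) i = shift B v i" for w i
      using WV(2,5) by (intro shift_cong) (auto simp: merge_def)
    have "(\<integral>\<^sup>+w. indicator A (shear B (merge V W (v, w))) \<partial>gauss W)
      = (\<integral>\<^sup>+w. indicator A (merge V W (v, \<lambda>i\<in>W. w i + shift B v i)) \<partial>gauss W)"
    proof (intro nn_integral_cong arg_cong[where f="indicator A"])
      fix w
      show "shear B (merge V W (v, w)) = merge V W (v, \<lambda>i\<in>W. w i + shift B v i)"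
        unfolding shear_def sm using WV
        by (auto simp: merge_def fun_eq_iff shift_outside W_def[symmetric])
    qed
    also have "\<dots> = (\<integral>\<^sup>+w. indicator A (merge V W (v, w)) \<partial>distr (gauss W) (gauss W) (\<lambda>w. \<lambda>i\<in>W. w i + shift B v i))"
      by (subst nn_integral_distr) auto
    also have "\<dots> = (\<integral>\<^sup>+w. (\<Prod>i\<in>W. ennreal (exp (shift B v i * w i - (shift B v i)\<^sup>2 / 2)))
         * indicator A (merge V W (v, w)) \<partial>gauss W)"
      unfolding gauss_translate[OF WV(4)] by (subst nn_integral_density) auto
    also have "\<dots> = (\<integral>\<^sup>+w. ennreal (lik B (merge V W (v, w))) * indicator A (merge V W (v, w)) \<partial>gauss W)"
    proof (intro nn_integral_cong arg_cong2[where f="(*)"] refl)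
      fix w
      have "(\<Sum>i<d. shift B v i * merge V W (v, w) i - (shift B v i)\<^sup>2 / 2)
        = (\<Sum>i\<in>W. shift B v i * merge V W (v, w) i - (shift B v i)\<^sup>2 / 2)"
        using WV by (intro sum.mono_neutral_right) (auto simp: shift_outside W_def[symmetric])
      also have "\<dots> = (\<Sum>i\<in>W. shift B v i * w i - (shift B v i)\<^sup>2 / 2)"
        using WV by (intro sum.cong) (auto simp: merge_def)
      finally show "(\<Prod>i\<in>W. ennreal (exp (shift B v i * w i - (shift B v i)\<^sup>2 / 2))) = ennreal (lik B (merge V W (v, w)))"
        unfolding lik_def sm by (simp add: prod_ennreal exp_sum WV)
    qed
    finally show "(\<integral>\<^sup>+w. indicator A (shear B (merge V W (v, w))) \<partial>gauss W)
      = (\<integral>\<^sup>+w. ennreal (lik B (merge V W (v, w))) * indicator A (merge V W (v, w)) \<partial>gauss W)" .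
  qed
  also have "\<dots> = (\<integral>\<^sup>+x. ennreal (lik B x) * indicator A x \<partial>gauss {..<d})"
    by (rule fold[symmetric]) measurable
  also have "\<dots> = emeasure (density (gauss {..<d}) (\<lambda>x. ennreal (lik B x))) A"
    by (subst emeasure_density) auto
  finally show "emeasure (distr (gauss {..<d}) (gauss {..<d}) (shear B)) A
    = emeasure (density (gauss {..<d}) (\<lambda>x. ennreal (lik B x))) A" .
qed simp

definition gdata :: "nat \<Rightarrow> (nat \<Rightarrow> nat \<Rightarrow> real) measure" where
  "gdata n = PiM {..<n} (\<lambda>_. gauss {..<d})"

definition shear_data :: "nat \<Rightarrow> (nat \<times> nat \<Rightarrow> real) \<Rightarrow> (nat \<Rightarrow> nat \<Rightarrow> real) \<Rightarrow> (nat \<Rightarrow> nat \<Rightarrow> real)" where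
  "shear_data n B S = (\<lambda>i\<in>{..<n}. shear B (S i))"

definition lik_data :: "nat \<Rightarrow> (nat \<times> nat \<Rightarrow> real) \<Rightarrow> (nat \<Rightarrow> nat \<Rightarrow> real) \<Rightarrow> real" where
  "lik_data n B S = (\<Prod>i<n. lik B (S i))"

lemma prob_space_gdata: "prob_space (gdata n)"
  unfolding gdata_def by (intro prob_space_PiM prob_space_gauss)

lemma sets_gdata [simp, measurable_cong]: "sets (gdata n) = sets (data_space n d)"
  unfolding gdata_def data_space_def point_space_def by (intro sets_PiM_cong) auto

lemma shear_data_measurable [measurable]: "shear_data n B \<in> data_space n d \<rightarrow>\<^sub>M data_space n d"
  unfolding shear_data_def data_space_def point_space_def by measurable

lemma lik_data_measurable [measurable]: "lik_data n B \<in> borel_measurable (data_space n d)"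
  unfolding lik_data_def data_space_def point_space_def by measurable

lemma shear_data_PiM:
  "distr (gdata n) (gdata n) (shear_data n B) = PiM {..<n} (\<lambda>_. distr (gauss {..<d}) (gauss {..<d}) (shear B))"
proof -
  have "distr (gdata n) (gdata n) (compose {..<n} (shear B)) = PiM {..<n} (\<lambda>_. distr (gauss {..<d}) (gauss {..<d}) (shear B))"
    unfolding gdata_def by (intro distr_PiM_finite_prob_space' prob_space_gauss) auto
  moreover have "compose {..<n} (shear B) = shear_data n B"
    by (simp add: fun_eq_iff compose_def shear_data_def)
  ultimately show ?thesis by simp
qed

lemma shear_data_law:
  "distr (gdata n) (gdata n) (shear_data n B) = density (gdata n) (\<lambda>S. ennreal (lik_data n B S))"
proof -
  have "prob_space (density (gauss {..<d}) (\<lambda>x. ennreal (lik B x)))"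
    unfolding shear_law[symmetric] by (intro prob_space.prob_space_distr prob_space_gauss) simp
  then have "PiM {..<n} (\<lambda>_. density (gauss {..<d}) (\<lambda>x. ennreal (lik B x)))
      = density (gdata n) (\<lambda>S. \<Prod>i<n. ennreal (lik B (S i)))"
    unfolding gdata_def by (intro PiM_density prob_space_gauss) auto
  also have "\<dots> = density (gdata n) (\<lambda>S. ennreal (lik_data n B S))"
    by (simp add: lik_data_def prod_ennreal lik_def)
  finally show ?thesis unfolding shear_data_PiM shear_law .
qed

lemma lik_data_nonneg: "0 \<le> lik_data n B S"
  by (auto simp: lik_data_def lik_def intro!: prod_nonneg)

text \<open>An expectation under the data distribution with parameter \<open>B\<close> can be computed in two ways: with the likelihood, in which
\<open>B\<close> can be differentiated while the data stay fixed, or with sheared standard Gaussians, in which the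
scores are products of independent coordinates.\<close>

lemma
  fixes F :: "(nat \<Rightarrow> nat \<Rightarrow> real) \<Rightarrow> real"
  assumes [measurable]: "F \<in> borel_measurable (data_space n d)"
  shows integral_lik_data: "(\<integral>S. lik_data n B S * F S \<partial>gdata n) = (\<integral>S. F (shear_data n B S) \<partial>gdata n)"
    and integrable_lik_data: "integrable (gdata n) (\<lambda>S. lik_data n B S * F S) \<longleftrightarrow> integrable (gdata n) (\<lambda>S. F (shear_data n B S))"
proof -
  have "(\<integral>S. F (shear_data n B S) \<partial>gdata n) = (\<integral>S. F S \<partial>distr (gdata n) (gdata n) (shear_data n B))"
    by (subst integral_distr) auto
  then show "(\<integral>S. lik_data n B S * F S \<partial>gdata n) = (\<integral>S. F (shear_data n B S) \<partial>gdata n)"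
    unfolding shear_data_law by (subst (asm) integral_density) (auto simp: lik_data_nonneg)
  have "integrable (gdata n) (\<lambda>S. F (shear_data n B S)) \<longleftrightarrow> integrable (distr (gdata n) (gdata n) (shear_data n B)) F"
    by (subst integrable_distr_eq) auto
  then show "integrable (gdata n) (\<lambda>S. lik_data n B S * F S) \<longleftrightarrow> integrable (gdata n) (\<lambda>S. F (shear_data n B S))"
    unfolding shear_data_law by (subst (asm) integrable_density) (auto simp: lik_data_nonneg)
qed

lemma shift_shear: "shift B (shear B x) i = shift B x i"
proof (rule shift_cong)
  fix j assume "j \<in> snd ` J"
  then have "j < d" "j \<notin> fst ` J" using J_disj J_sub by auto
  then show "shear B x j = x j" by (simp add: shear_def shift_outside)
qed

end

section \<open>Privacy as a change of measure, and the score identity\<close>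

text \<open>With \<open>D = dP/dQ\<close> the difference of the two expectations is the integral of \<open>(D - 1) f\<close>, and the integral of
\<open>(D - 1)\<^sup>2\<close> is at most \<open>exp (2 \<rho>) - 1\<close> by the divergence bound of order 2. The inequality is stated in its
additive form with a free \<open>\<gamma>\<close>, rather than with a product of square roots, because that form can be integrated.\<close>

lemma renyi_change_of_measure:
  fixes f :: "'a \<Rightarrow> real"
  assumes P: "prob_space P" and Q: "prob_space Q" and PQ: "sets P = sets Q"
    and div: "renyi_divergence 2 P Q \<le> ereal (\<rho> * 2)"
    and f[measurable]: "f \<in> borel_measurable Q" and bnd: "\<And>x. \<bar>f x\<bar> \<le> C" and \<gamma>: "\<gamma> > 0"
  shows "(\<integral>x. f x \<partial>P) \<le> (\<integral>x. f x \<partial>Q) + \<gamma> / 2 * (exp (2 * \<rho>) - 1) + 1 / (2 * \<gamma>) * (\<integral>x. (f x)\<^sup>2 \<partial>Q)"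
proof -
  interpret P: prob_space P by fact
  interpret Q: prob_space Q by fact
  define I where "I = (\<integral>\<^sup>+x. ennreal (enn2real (RN_deriv Q P x) powr 2) \<partial>Q)"
  have ac: "absolutely_continuous Q P" and fin: "I < \<infinity>" and ln: "ln (enn2real I) \<le> \<rho> * 2"
    using div unfolding renyi_divergence_def I_def[symmetric] Let_def by (auto split: if_splits)
  obtain D where D[measurable]: "D \<in> borel_measurable Q" and RN: "AE x in Q. RN_deriv Q P x = ennreal (D x)"
    and D0: "\<And>x. 0 \<le> D x"
    using Q.real_RN_deriv[OF P.finite_measure_axioms ac PQ] by metis
  have P_eq: "P = density Q (\<lambda>x. ennreal (D x))"
  proof -
    have "P = density Q (RN_deriv Q P)" using Q.density_RN_deriv[OF ac PQ] by simp
    also have "\<dots> = density Q (\<lambda>x. ennreal (D x))" using RN by (intro density_cong) auto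
    finally show ?thesis .
  qed
  have I_eq: "I = (\<integral>\<^sup>+x. ennreal ((D x)\<^sup>2) \<partial>Q)"
    unfolding I_def by (intro nn_integral_cong_AE) (use RN D0 in \<open>auto simp: powr_numeral\<close>)
  have D2: "integrable Q (\<lambda>x. (D x)\<^sup>2)"
    by (rule integrableI_nonneg) (use fin I_eq in auto)
  have intI: "(\<integral>x. (D x)\<^sup>2 \<partial>Q) = enn2real I"
    unfolding I_eq by (subst integral_eq_nn_integral) auto
  have le: "(\<integral>x. (D x)\<^sup>2 \<partial>Q) \<le> exp (2 * \<rho>)"
  proof (cases "enn2real I > 0")
    case True
    then show ?thesis unfolding intI using ln by (metis exp_le_cancel_iff exp_ln mult.commute)
  next
    case False
    then have "enn2real I \<le> 0" by simp
    also have "0 \<le> exp (2 * \<rho>)" by simp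
    finally show ?thesis unfolding intI .
  qed
  have D1: "integrable Q D" "(\<integral>x. D x \<partial>Q) = 1"
  proof -
    have *: "(\<integral>\<^sup>+x. ennreal (D x) \<partial>Q) = 1"
      using P.emeasure_space_1 sets_eq_imp_space_eq[OF PQ] unfolding P_eq
      by (simp add: emeasure_density cong: nn_integral_cong)
    show "integrable Q D" by (rule integrableI_nonneg) (use * D0 in auto)
    show "(\<integral>x. D x \<partial>Q) = 1" using * D0 by (subst integral_eq_nn_integral) auto
  qed
  have int_f: "integrable Q f" by (rule Q.integrable_const_bound[where B=C]) (use bnd in auto)
  have int_f2: "integrable Q (\<lambda>x. (f x)\<^sup>2)"
    by (rule Q.integrable_const_bound[where B="C\<^sup>2"]) (use bnd[THEN order_trans, OF abs_ge_self] in \<open>auto simp: abs_le_square_iff[symmetric]\<close>)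
  have int_Df: "integrable Q (\<lambda>x. D x * f x)"
    by (rule Bochner_Integration.integrable_bound[OF integrable_mult_right[OF D1(1), of C]])
       (use bnd D0 in \<open>auto simp: abs_mult mult.commute[of C] intro!: mult_left_mono order_trans[OF bnd]\<close>)
  have "(\<integral>x. f x \<partial>P) = (\<integral>x. D x * f x \<partial>Q)"
    unfolding P_eq by (subst integral_density) (auto simp: D0)
  also have "\<dots> \<le> (\<integral>x. f x + \<gamma> / 2 * ((D x)\<^sup>2 - 2 * D x + 1) + 1 / (2 * \<gamma>) * (f x)\<^sup>2 \<partial>Q)"
  proof (rule integral_mono[OF int_Df])
    show "integrable Q (\<lambda>x. f x + \<gamma> / 2 * ((D x)\<^sup>2 - 2 * D x + 1) + 1 / (2 * \<gamma>) * (f x)\<^sup>2)"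
      using int_f int_f2 D1 D2 by auto
    fix x
    have "0 \<le> (\<gamma> * (D x - 1) - f x)\<^sup>2 / (2 * \<gamma>)" using \<gamma> by simp
    also have "\<dots> = \<gamma> / 2 * (D x - 1)\<^sup>2 + 1 / (2 * \<gamma>) * (f x)\<^sup>2 - (D x - 1) * f x"
      using \<gamma> by (simp add: power2_eq_square field_simps)
    finally show "D x * f x \<le> f x + \<gamma> / 2 * ((D x)\<^sup>2 - 2 * D x + 1) + 1 / (2 * \<gamma>) * (f x)\<^sup>2"
      by (simp add: power2_eq_square algebra_simps)
  qed
  also have "\<dots> = (\<integral>x. f x \<partial>Q) + \<gamma> / 2 * ((\<integral>x. (D x)\<^sup>2 \<partial>Q) - 1) + 1 / (2 * \<gamma>) * (\<integral>x. (f x)\<^sup>2 \<partial>Q)"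
    using int_f int_f2 D1 D2 by (simp add: Q.prob_space)
  also have "\<dots> \<le> (\<integral>x. f x \<partial>Q) + \<gamma> / 2 * (exp (2 * \<rho>) - 1) + 1 / (2 * \<gamma>) * (\<integral>x. (f x)\<^sup>2 \<partial>Q)"
    using le \<gamma> by (intro add_mono mult_left_mono order_refl) auto
  finally show ?thesis .
qed

text \<open>Integration by parts against the Gaussian density: \<open>F' - t F\<close> times the density is the derivative of \<open>F\<close> times
the density.\<close>

lemma stein_compact_support:
  fixes F F' :: "real \<Rightarrow> real"
  assumes deriv: "\<And>t. (F has_real_derivative F' t) (at t)" and cont: "continuous_on UNIV F'"
    and zero: "\<And>t. \<bar>t\<bar> > L \<Longrightarrow> F t = 0" "\<And>t. \<bar>t\<bar> > L \<Longrightarrow> F' t = 0"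
  shows "(\<integral>t. F' t - t * F t \<partial>std_gauss) = 0"
proof -
  define a where "a = \<bar>L\<bar> + 1"
  have [continuous_intros]: "isCont F' t" for t using cont by (simp add: continuous_on_eq_continuous_at)
  have [continuous_intros]: "isCont F t" for t using deriv by (rule DERIV_isCont)
  have Fb: "F \<in> borel_measurable borel" "F' \<in> borel_measurable borel"
    using cont by (auto intro!: borel_measurable_continuous_onI continuous_at_imp_continuous_on continuous_intros)
  define g where "g t = std_normal_density t * (F' t - t * F t)" for t
  have "(\<integral>t. F' t - t * F t \<partial>std_gauss) = (\<integral>t. g t \<partial>lborel)"
    using Fb by (subst integral_density) (auto simp: g_def[abs_def])
  also have "\<dots> = (\<integral>t. g t * indicator {-a..a} t \<partial>lborel)"
  proof (rule Bochner_Integration.integral_cong[OF refl])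
    fix t show "g t = g t * indicator {-a..a} t"
    proof (cases "\<bar>t\<bar> > L")
      case True then show ?thesis using zero[of t] by (simp add: g_def)
    next
      case False then show ?thesis by (auto simp: a_def indicator_def)
    qed
  qed
  also have "\<dots> = std_normal_density a * F a - std_normal_density (-a) * F (-a)"
  proof (rule integral_FTC_Icc_real)
    show "-a \<le> a" by (simp add: a_def)
    fix t
    have "((\<lambda>t. std_normal_density t * F t) has_real_derivative (- t * std_normal_density t) * F t + F' t * std_normal_density t) (at t)"
    proof (rule DERIV_mult[OF _ deriv])
      show "(std_normal_density has_real_derivative - t * std_normal_density t) (at t)"
      proof -
        have "((\<lambda>t. c * exp (- t\<^sup>2 / 2)) has_real_derivative - t * (c * exp (- t\<^sup>2 / 2))) (at t)" for c :: real
          by (rule derivative_eq_intros refl | simp)+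
        then show ?thesis unfolding std_normal_density_def .
      qed
    qed
    then show "((\<lambda>t. std_normal_density t * F t) has_real_derivative g t) (at t)"
      by (simp add: g_def algebra_simps)
    show "isCont g t" unfolding g_def std_normal_density_def by (intro continuous_intros)  auto
  qed
  also have "\<dots> = 0" using zero(1)[of a] zero(1)[of "-a"] by (simp add: a_def)
  finally show ?thesis .
qed

context shear_model
begin

lemma space_gdata: "space (gdata n) = space (data_space n d)"
  by (rule sets_eq_imp_space_eq) simp

lemma measurable_data_row [measurable]: "i < n \<Longrightarrow> (\<lambda>S. S i) \<in> data_space n d \<rightarrow>\<^sub>M PiM {..<d} (\<lambda>_. borel)"
  unfolding data_space_def point_space_def by (rule measurable_component_singleton) simp

lemma measurable_shift_joint [measurable]:
  assumes [measurable]: "f \<in> N \<rightarrow>\<^sub>M PiM J (\<lambda>_. borel)" "g \<in> N \<rightarrow>\<^sub>M PiM {..<d} (\<lambda>_. borel)"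
  shows "(\<lambda>x. shift (\<lambda>r. \<delta> * f x r) (g x) l) \<in> borel_measurable N"
proof -
  have [measurable]: "(\<lambda>x. g x j) \<in> borel_measurable N" "(\<lambda>x. f x (l, j)) \<in> borel_measurable N" if "(l, j) \<in> J" for j
    using that J_sub by (auto intro!: measurable_compose[OF assms(2)] measurable_compose[OF assms(1)] measurable_component_singleton)
  show ?thesis unfolding shift_def by measurable
qed

lemma measurable_lik_data_joint [measurable]:
  "(\<lambda>x. lik_data n (\<lambda>r. \<delta> * fst x r) (snd x)) \<in> borel_measurable (gauss J \<Otimes>\<^sub>M gdata n)"
  unfolding lik_data_def lik_def by measurable

lemma shear_snd: "j \<in> snd ` J \<Longrightarrow> shear B x j = x j"
proof -
  assume "j \<in> snd ` J"
  then have "j < d" "j \<notin> fst ` J" using J_disj J_sub by auto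
  then show ?thesis by (simp add: shear_def shift_outside)
qed

lemma residual_shear: "i \<in> fst ` J \<Longrightarrow> shear B x i - shift B (shear B x) i = x i"
  using J_sub by (auto simp: shift_shear) (auto simp: shear_def)

lemma shift_upd:
  assumes "(w, z) \<in> J"
  shows "shift (\<lambda>r. \<delta> * (\<theta>((w, z) := t)) r) x l
    = shift (\<lambda>r. \<delta> * (\<theta>((w, z) := 0)) r) x l + (if l = w then \<delta> * x z * t else 0)"
proof (cases "l = w")
  case True
  have z: "z \<in> {j. (w, j) \<in> J}" using assms by simp
  have "(\<Sum>j | (w, j) \<in> J. \<delta> * (\<theta>((w, z) := t)) (w, j) * x j)
    = \<delta> * t * x z + (\<Sum>j \<in> {j. (w, j) \<in> J} - {z}. \<delta> * \<theta> (w, j) * x j)" for t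
    by (subst sum.remove[OF finite_J_row z]) (auto intro!: sum.cong)
  from this[of t] this[of 0] show ?thesis by (simp add: shift_def True mult_ac)
next
  case False then show ?thesis by (auto simp: shift_def intro!: sum.cong)
qed

text \<open>The sum is the score of the entry \<open>(w, z)\<close>: the residual of coordinate \<open>w\<close> times the regressor \<open>z\<close>.\<close>

lemma lik_data_has_derivative:
  assumes wz: "(w, z) \<in> J"
  shows "((\<lambda>t. lik_data n (\<lambda>r. \<delta> * (\<theta>((w, z) := t)) r) S) has_real_derivative
     lik_data n (\<lambda>r. \<delta> * (\<theta>((w, z) := t)) r) S *
       (\<Sum>i<n. \<delta> * (S i z * (S i w - shift (\<lambda>r. \<delta> * (\<theta>((w, z) := t)) r) (S i) w)))) (at t)"
proof -
  have w: "w < d" using wz J_sub by auto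
  define c where "c x l = shift (\<lambda>r. \<delta> * (\<theta>((w, z) := 0)) r) x l" for x l
  define a where "a t x l = c x l + (if l = w then \<delta> * x z * t else 0)" for t x l
  have sh: "shift (\<lambda>r. \<delta> * (\<theta>((w, z) := t)) r) x l = a t x l" for t x l
    unfolding a_def c_def by (rule shift_upd[OF wz])
  have 1: "((\<lambda>t. \<Sum>l<d. a t x l * x l - (a t x l)\<^sup>2 / 2) has_real_derivative
       \<delta> * (x z * (x w - a t x w))) (at t)" for x
  proof -
    have "((\<lambda>t. \<Sum>l<d. a t x l * x l - (a t x l)\<^sup>2 / 2) has_real_derivative
       (\<Sum>l<d. if l = w then \<delta> * (x z * (x w - a t x w)) else 0)) (at t)"
      by (rule DERIV_sum) (auto simp: a_def algebra_simps intro!: derivative_eq_intros)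
    then show ?thesis using w by simp
  qed
  have "((\<lambda>t. exp (\<Sum>i<n. \<Sum>l<d. a t (S i) l * S i l - (a t (S i) l)\<^sup>2 / 2)) has_real_derivative
      exp (\<Sum>i<n. \<Sum>l<d. a t (S i) l * S i l - (a t (S i) l)\<^sup>2 / 2) *
        (\<Sum>i<n. \<delta> * (S i z * (S i w - a t (S i) w)))) (at t)"
    by (intro DERIV_fun_exp DERIV_sum 1)
  then show ?thesis unfolding lik_data_def lik_def sh by (simp add: exp_sum)
qed

text \<open>For fixed data and fixed other entries, integrate by parts in the entry \<open>\<theta> p\<close> the function
\<open>(m - \<theta> p) * \<omega> * likelihood\<close>. Its derivative consists of \<open>- \<omega> * likelihood\<close>, whose total mass is
the integral of \<open>\<omega>\<close> up to sign, and of the error times the logarithmic derivatives of the prior weight (\<open>q\<close>) and of the likelihood.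
Afterwards Fubini puts the data integral inside, and the change of variables to sheared Gaussians turns
the score into the sum of the products \<open>S i (fst p) * S i (snd p)\<close>.\<close>

lemma score_identity:
  fixes \<omega> q :: "(nat \<times> nat \<Rightarrow> real) \<Rightarrow> real" and m :: "(nat \<Rightarrow> nat \<Rightarrow> real) \<Rightarrow> real"
  assumes p: "p \<in> J"
    and \<omega>_meas[measurable]: "\<omega> \<in> borel_measurable (PiM J (\<lambda>_. borel))" and \<omega>01: "\<And>\<theta>. 0 \<le> \<omega> \<theta>" "\<And>\<theta>. \<omega> \<theta> \<le> 1"
    and q_meas[measurable]: "q \<in> borel_measurable (PiM J (\<lambda>_. borel))"
    and deriv: "\<And>\<theta> t. ((\<lambda>t. \<omega> (\<theta>(p := t))) has_real_derivative \<omega> (\<theta>(p := t)) * q (\<theta>(p := t))) (at t)"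
    and cont: "\<And>\<theta>. continuous_on UNIV (\<lambda>t. \<omega> (\<theta>(p := t)) * q (\<theta>(p := t)))"
    and supp: "\<And>\<theta>. \<omega> \<theta> \<noteq> 0 \<Longrightarrow> \<bar>\<theta> p\<bar> \<le> L" and qb: "\<And>\<theta>. \<bar>\<omega> \<theta> * q \<theta>\<bar> \<le> Q"
    and m_meas[measurable]: "m \<in> borel_measurable (data_space n d)" and mb: "\<And>S. S \<in> space (data_space n d) \<Longrightarrow> \<bar>m S\<bar> \<le> L" and L0: "0 \<le> L"
  shows "has_bochner_integral (gauss J) (\<lambda>\<theta>. \<integral>S. \<omega> \<theta> * (m (shear_data n (\<lambda>r. \<delta> * \<theta> r) S) - \<theta> p)
      * ((\<Sum>i<n. \<delta> * (S i (fst p) * S i (snd p))) + q \<theta> - \<theta> p) \<partial>gdata n) (\<integral>\<theta>. \<omega> \<theta> \<partial>gauss J)"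
proof -
  obtain w z where wz: "p = (w, z)" "(w, z) \<in> J" using p by (cases p) auto
  have wzd: "w < d" "z < d" using wz J_sub by auto
  interpret X: prob_space "gauss J" by (rule prob_space_gauss)
  interpret S: prob_space "gdata n" by (rule prob_space_gdata)
  interpret pair_sigma_finite "gauss J" "gdata n"
    by (intro pair_sigma_finite.intro prob_space_imp_sigma_finite prob_space_gauss prob_space_gdata)
  define \<ll> where "\<ll> \<theta> S = lik_data n (\<lambda>r. \<delta> * \<theta> r) S" for \<theta> S
  define sc where "sc \<theta> S = (\<Sum>i<n. \<delta> * (S i z * (S i w - shift (\<lambda>r. \<delta> * \<theta> r) (S i) w)))" for \<theta> S
  define G where "G \<theta> S = \<omega> \<theta> * (m S - \<theta> p) * (sc \<theta> S + q \<theta> - \<theta> p)" for \<theta> S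
  define H where "H = (\<lambda>x. \<ll> (fst x) (snd x) * (\<omega> (fst x) - G (fst x) (snd x)))"
  have [measurable]: "(\<lambda>\<theta>. \<theta> p) \<in> borel_measurable (PiM J (\<lambda>_. borel :: real measure))"
    using p by (intro measurable_component_singleton)
  have [measurable]: "(\<lambda>S. S i w) \<in> borel_measurable (data_space n d)"
     "(\<lambda>S. S i z) \<in> borel_measurable (data_space n d)" if "i < n" for i
    using that wzd by (auto intro!: measurable_compose[OF measurable_data_row] measurable_component_singleton)
  have [measurable]: "H \<in> borel_measurable (gauss J \<Otimes>\<^sub>M gdata n)"
    unfolding H_def G_def \<ll>_def sc_def by measurable
  have Gm[measurable]: "G \<theta> \<in> borel_measurable (data_space n d)" for \<theta>
    unfolding G_def sc_def by measurable
  have scm[measurable]: "sc \<theta> \<in> borel_measurable (data_space n d)" for \<theta>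
    unfolding sc_def by measurable
  define sg where "sg S = (\<Sum>i<n. \<delta> * (S i w * S i z))" for S :: "nat \<Rightarrow> nat \<Rightarrow> real"
  have sgm[measurable]: "sg \<in> borel_measurable (data_space n d)" unfolding sg_def by measurable
  have sc_sh: "sc \<theta> (shear_data n (\<lambda>r. \<delta> * \<theta> r) S) = sg S" for \<theta> S
    unfolding sc_def sg_def shear_data_def
  proof (intro sum.cong refl)
    have "w \<in> fst ` J" "z \<in> snd ` J" using wz by force+
    from residual_shear[OF this(1)] shear_snd[OF this(2)]
    show "\<delta> * ((restrict (\<lambda>i. shear (\<lambda>r. \<delta> * \<theta> r) (S i)) {..<n}) i z * ((restrict (\<lambda>i. shear (\<lambda>r. \<delta> * \<theta> r) (S i)) {..<n}) i w
      - shift (\<lambda>r. \<delta> * \<theta> r) ((restrict (\<lambda>i. shear (\<lambda>r. \<delta> * \<theta> r) (S i)) {..<n}) i) w)) = \<delta> * (S i w * S i z)"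
      if "i \<in> {..<n}" for i using that by simp
  qed
  have int_sg: "integrable (gdata n) sg"
    unfolding sg_def
  proof (intro Bochner_Integration.integrable_sum integrable_mult_right)
    fix i assume i: "i \<in> {..<n}"
    have "integrable (distr (gdata n) (gauss {..<d}) (\<lambda>S. S i)) (\<lambda>g. g w * g z)"
      unfolding gdata_def using i
      by (subst distr_PiM_component) (auto intro!: prob_space_gauss gauss_integrable_coord2 simp: wzd)
    then show "integrable (gdata n) (\<lambda>S. S i w * S i z)"
      using i wzd by (subst (asm) integrable_distr_eq) (auto simp: gdata_def intro!: measurable_component_singleton borel_measurable_integrable[OF gauss_integrable_coord2])
  qed
  have Gbound: "\<bar>\<omega> \<theta> - G \<theta> S\<bar> \<le> 1 + 2 * L * (\<bar>sc \<theta> S\<bar> + Q + L)" if S: "S \<in> space (data_space n d)" for \<theta> S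
  proof (cases "\<omega> \<theta> = 0")
    case True
    then have "Q \<ge> 0" using qb[of \<theta>] by simp
    then show ?thesis using L0 True by (simp add: G_def)
  next
    case False
    then have th: "\<bar>\<theta> p\<bar> \<le> L" by (rule supp)
    have "\<bar>m S - \<theta> p\<bar> \<le> 2 * L" using th mb[OF S] by linarith
    moreover have "\<bar>\<omega> \<theta> * sc \<theta> S + \<omega> \<theta> * q \<theta> - \<omega> \<theta> * \<theta> p\<bar> \<le> \<bar>sc \<theta> S\<bar> + Q + L"
    proof -
      have "\<bar>\<omega> \<theta> * sc \<theta> S\<bar> \<le> 1 * \<bar>sc \<theta> S\<bar>"
        unfolding abs_mult using \<omega>01[of \<theta>] by (intro mult_mono) auto
      moreover have "\<bar>\<omega> \<theta> * \<theta> p\<bar> \<le> 1 * L"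
        unfolding abs_mult using \<omega>01[of \<theta>] th by (intro mult_mono) auto
      ultimately show ?thesis using qb[of \<theta>] by linarith
    qed
    ultimately have "\<bar>(m S - \<theta> p) * (\<omega> \<theta> * sc \<theta> S + \<omega> \<theta> * q \<theta> - \<omega> \<theta> * \<theta> p)\<bar> \<le> 2 * L * (\<bar>sc \<theta> S\<bar> + Q + L)"
      unfolding abs_mult using L0 by (intro mult_mono) auto
    moreover have "G \<theta> S = (m S - \<theta> p) * (\<omega> \<theta> * sc \<theta> S + \<omega> \<theta> * q \<theta> - \<omega> \<theta> * \<theta> p)"
      by (simp add: G_def algebra_simps)
    ultimately show ?thesis using \<omega>01[of \<theta>] by linarith
  qed
  have Gsh: "\<bar>\<omega> \<theta> - G \<theta> (shear_data n (\<lambda>r. \<delta> * \<theta> r) S)\<bar> \<le> 1 + 2 * L * (\<bar>sg S\<bar> + Q + L)"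
    if "S \<in> space (gdata n)" for \<theta> S
  proof -
    have "shear_data n (\<lambda>r. \<delta> * \<theta> r) S \<in> space (data_space n d)"
      using that unfolding space_gdata by (rule measurable_space[OF shear_data_measurable])
    from Gbound[OF this, of \<theta>] show ?thesis unfolding sc_sh .
  qed
  define C where "C = (\<integral>S. 1 + 2 * L * (\<bar>sg S\<bar> + Q + L) \<partial>gdata n)"
  have int_bd: "integrable (gdata n) (\<lambda>S. 1 + 2 * L * (\<bar>sg S\<bar> + Q + L))"
    using int_sg by (auto intro!: Bochner_Integration.integrable_add integrable_mult_right)
  have intS: "integrable (gdata n) (\<lambda>S. \<omega> \<theta> - G \<theta> (shear_data n (\<lambda>r. \<delta> * \<theta> r) S))" for \<theta>
  proof (rule Bochner_Integration.integrable_bound[OF int_bd], goal_cases)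
    case 2
    show ?case
    proof (rule AE_I2)
      fix S assume "S \<in> space (gdata n)"
      then have "1 + 2 * L * (\<bar>sg S\<bar> + Q + L) \<ge> \<bar>\<omega> \<theta> - G \<theta> (shear_data n (\<lambda>r. \<delta> * \<theta> r) S)\<bar>" by (rule Gsh[of S \<theta>])
      then show "norm (\<omega> \<theta> - G \<theta> (shear_data n (\<lambda>r. \<delta> * \<theta> r) S)) \<le> norm (1 + 2 * L * (\<bar>sg S\<bar> + Q + L))"
        unfolding real_norm_def by (rule order_trans[OF _ abs_ge_self])
    qed
  next
    case 1
    have "(\<lambda>S. \<omega> \<theta> - G \<theta> (shear_data n (\<lambda>r. \<delta> * \<theta> r) S)) \<in> borel_measurable (data_space n d)"
      by (intro borel_measurable_diff borel_measurable_const measurable_compose[OF shear_data_measurable Gm])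
    then show ?case
      by (simp only: measurable_cong_sets[OF sets_gdata refl])
  qed
  have intS': "integrable (gdata n) (\<lambda>S. H (\<theta>, S))" for \<theta>
    unfolding H_def \<ll>_def using intS[of \<theta>] by (simp add: integrable_lik_data)
  have intH: "integrable (gauss J \<Otimes>\<^sub>M gdata n) H"
  proof (rule Fubini_integrable)
    show "AE \<theta> in gauss J. integrable (gdata n) (\<lambda>S. H (\<theta>, S))" by (simp add: intS')
    show "integrable (gauss J) (\<lambda>\<theta>. \<integral>S. norm (H (\<theta>, S)) \<partial>gdata n)"
    proof (rule X.integrable_const_bound[where B=C])
      show "AE \<theta> in gauss J. norm (\<integral>S. norm (H (\<theta>, S)) \<partial>gdata n) \<le> C"
      proof (rule AE_I2)
        fix \<theta>
        have "(\<integral>S. norm (H (\<theta>, S)) \<partial>gdata n) = (\<integral>S. \<ll> \<theta> S * \<bar>\<omega> \<theta> - G \<theta> S\<bar> \<partial>gdata n)"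
          by (simp add: H_def abs_mult lik_data_nonneg \<ll>_def)
        also have "\<dots> = (\<integral>S. \<bar>\<omega> \<theta> - G \<theta> (shear_data n (\<lambda>r. \<delta> * \<theta> r) S)\<bar> \<partial>gdata n)"
          unfolding \<ll>_def by (subst integral_lik_data) auto
        also have "\<dots> \<le> C" unfolding C_def
          by (rule integral_mono[OF integrable_abs[OF intS[of \<theta>]] int_bd Gsh[of _ \<theta>]])
        finally show "norm (\<integral>S. norm (H (\<theta>, S)) \<partial>gdata n) \<le> C" by simp
      qed
    qed measurable
  qed measurable
  have inner: "(\<integral>t. H (\<theta>(p := t), S) \<partial>std_gauss) = 0" for \<theta> S
  proof -
    define F where "F t = \<omega> (\<theta>(p := t)) * ((m S - t) * \<ll> (\<theta>(p := t)) S)" for t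
    \<comment> \<open>The derivative of \<open>F\<close>; up to sign, \<open>F' - t F\<close> is the integrand \<open>H\<close>.\<close>
    define F' where "F' t = (\<omega> (\<theta>(p := t)) * q (\<theta>(p := t))) * ((m S - t) * \<ll> (\<theta>(p := t)) S)
       + \<omega> (\<theta>(p := t)) * (- \<ll> (\<theta>(p := t)) S + (m S - t) * (\<ll> (\<theta>(p := t)) S * sc (\<theta>(p := t)) S))" for t
    have dl: "((\<lambda>t. \<ll> (\<theta>(p := t)) S) has_real_derivative \<ll> (\<theta>(p := t)) S * sc (\<theta>(p := t)) S) (at t)" for t
      unfolding \<ll>_def sc_def wz(1) by (rule lik_data_has_derivative[OF wz(2)])
    have "(\<integral>t. F' t - t * F t \<partial>std_gauss) = 0"
    proof (rule stein_compact_support[where L=L])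
      show "(F has_real_derivative F' t) (at t)" for t
      proof -
        have lin: "((\<lambda>t. m S - t) has_real_derivative - 1) (at t)"
          by (rule derivative_eq_intros refl | simp)+
        have "(F has_real_derivative \<omega> (\<theta>(p := t)) * q (\<theta>(p := t)) * ((m S - t) * \<ll> (\<theta>(p := t)) S)
           + (- 1 * \<ll> (\<theta>(p := t)) S + \<ll> (\<theta>(p := t)) S * sc (\<theta>(p := t)) S * (m S - t)) * \<omega> (\<theta>(p := t))) (at t)"
          unfolding F_def by (rule DERIV_mult[OF deriv DERIV_mult[OF lin dl]])
        then show ?thesis unfolding F'_def by (simp add: algebra_simps)
      qed
      have "continuous_on UNIV (\<lambda>t. sc (\<theta>(p := t)) S)"
      proof -
        have "sc (\<theta>(p := t)) S = (\<Sum>i<n. \<delta> * (S i z * (S i w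
            - (shift (\<lambda>r. \<delta> * (\<theta>((w, z) := 0)) r) (S i) w + \<delta> * S i z * t))))" for t
          unfolding sc_def wz(1) by (intro sum.cong refl) (subst shift_upd[OF wz(2)], simp)
        then show ?thesis by (simp only:) (intro continuous_intros)
      qed
      moreover have "continuous_on UNIV (\<lambda>t. \<ll> (\<theta>(p := t)) S)" "continuous_on UNIV (\<lambda>t. \<omega> (\<theta>(p := t)))"
        using dl deriv by (auto intro!: continuous_at_imp_continuous_on DERIV_isCont)
      ultimately show "continuous_on UNIV F'"
        unfolding F'_def by (intro continuous_intros cont)
      show "F t = 0" "F' t = 0" if "\<bar>t\<bar> > L" for t
      proof -
        have "\<omega> (\<theta>(p := t)) = 0" using supp[of "\<theta>(p := t)"] that by (cases "\<omega> (\<theta>(p := t)) = 0") auto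
        then show "F t = 0" "F' t = 0" by (auto simp: F_def F'_def)
      qed
    qed
    moreover have "F' t - t * F t = - H (\<theta>(p := t), S)" for t
      by (simp add: F_def F'_def H_def G_def algebra_simps)
    ultimately show ?thesis by simp
  qed
  have HG: "(\<integral>S. H (\<theta>, S) \<partial>gdata n) = \<omega> \<theta> - (\<integral>S. G \<theta> (shear_data n (\<lambda>r. \<delta> * \<theta> r) S) \<partial>gdata n)" for \<theta>
  proof -
    have intG: "integrable (gdata n) (\<lambda>S. G \<theta> (shear_data n (\<lambda>r. \<delta> * \<theta> r) S))"
      using Bochner_Integration.integrable_diff[OF S.integrable_const[of "\<omega> \<theta>"] intS[of \<theta>]] by simp
    have "(\<integral>S. H (\<theta>, S) \<partial>gdata n) = (\<integral>S. \<omega> \<theta> - G \<theta> (shear_data n (\<lambda>r. \<delta> * \<theta> r) S) \<partial>gdata n)"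
      unfolding H_def \<ll>_def fst_conv snd_conv by (subst integral_lik_data) auto
    then show ?thesis using intG by (simp add: S.prob_space)
  qed
  have \<omega>i: "integrable (gauss J) \<omega>"
    by (rule X.integrable_const_bound[where B=1]) (use \<omega>01 in auto)
  have intG: "integrable (gauss J) (\<lambda>\<theta>. \<integral>S. G \<theta> (shear_data n (\<lambda>r. \<delta> * \<theta> r) S) \<partial>gdata n)"
  proof -
    have "integrable (gauss J) (\<lambda>\<theta>. \<omega> \<theta> - (\<integral>S. H (\<theta>, S) \<partial>gdata n))"
      by (rule Bochner_Integration.integrable_diff[OF \<omega>i integrable_fst'[OF intH]])
    then show ?thesis unfolding HG by simp
  qed
  have "0 = (\<integral>S. (\<integral>\<theta>. H (\<theta>, S) \<partial>gauss J) \<partial>gdata n)"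
  proof (rule sym, rule integral_eq_zero_AE)
    have "AE S in gdata n. integrable (gauss J) (\<lambda>\<theta>. H (\<theta>, S))"
      using AE_integrable_snd[of "\<lambda>\<theta> S. H (\<theta>, S)"] intH by (simp add: case_prod_beta')
    then show "AE S in gdata n. (\<integral>\<theta>. H (\<theta>, S) \<partial>gauss J) = 0"
    proof (rule AE_mp, intro AE_I2 impI)
      fix S assume i: "integrable (gauss J) (\<lambda>\<theta>. H (\<theta>, S))"
      have J: "insert p (J - {p}) = J" using p by auto
      have "(\<integral>\<theta>. H (\<theta>, S) \<partial>gauss J) = (\<integral>\<theta>. (\<integral>t. H (\<theta>(p := t), S) \<partial>std_gauss) \<partial>gauss (J - {p}))"
        using std_gauss.product_integral_insert[of "J - {p}" p "\<lambda>\<theta>. H (\<theta>, S)"] i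
        unfolding gauss_def[symmetric] J by simp
      then show "(\<integral>\<theta>. H (\<theta>, S) \<partial>gauss J) = 0" by (simp add: inner)
    qed
  qed
  also have "\<dots> = (\<integral>\<theta>. (\<integral>S. H (\<theta>, S) \<partial>gdata n) \<partial>gauss J)"
    using Fubini_integral[of "\<lambda>\<theta> S. H (\<theta>, S)"] intH by (simp add: case_prod_beta')
  also have "\<dots> = (\<integral>\<theta>. \<omega> \<theta> - (\<integral>S. G \<theta> (shear_data n (\<lambda>r. \<delta> * \<theta> r) S) \<partial>gdata n) \<partial>gauss J)"
    unfolding HG ..
  also have "\<dots> = (\<integral>\<theta>. \<omega> \<theta> \<partial>gauss J) - (\<integral>\<theta>. (\<integral>S. G \<theta> (shear_data n (\<lambda>r. \<delta> * \<theta> r) S) \<partial>gdata n) \<partial>gauss J)"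
    by (rule Bochner_Integration.integral_diff[OF \<omega>i intG])
  finally have "(\<integral>\<theta>. (\<integral>S. G \<theta> (shear_data n (\<lambda>r. \<delta> * \<theta> r) S) \<partial>gdata n) \<partial>gauss J) = (\<integral>\<theta>. \<omega> \<theta> \<partial>gauss J)"
    by linarith
  with intG have "has_bochner_integral (gauss J) (\<lambda>\<theta>. \<integral>S. G \<theta> (shear_data n (\<lambda>r. \<delta> * \<theta> r) S) \<partial>gdata n) (\<integral>\<theta>. \<omega> \<theta> \<partial>gauss J)"
    unfolding has_bochner_integral_iff by blast
  then show ?thesis unfolding G_def sc_sh sg_def unfolding wz(1) fst_conv snd_conv .
qed

end

section \<open>Randomised estimators and a weighted van Trees inequality\<close>

lemma AM_GM_weighted: "(x :: real) * y \<le> \<beta> / 2 * x\<^sup>2 + 1 / (2 * \<beta>) * y\<^sup>2" if "\<beta> > 0"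
proof -
  have "0 \<le> (\<beta> * x - y)\<^sup>2 / (2 * \<beta>)" using that by simp
  also have "\<dots> = \<beta> / 2 * x\<^sup>2 + 1 / (2 * \<beta>) * y\<^sup>2 - x * y"
    using that by (simp add: power2_eq_square field_simps)
  finally show ?thesis by simp
qed

text \<open>The kernel \<open>A\<close> is a randomised algorithm; \<open>b p\<close> reads off its output an estimate of the entry \<open>p\<close>. Boundedness
costs nothing, since clipping to the range of the parameter only decreases the error, and it makes every
integral below converge.\<close>

locale bounded_estimator = shear_model +
  fixes n :: nat and N :: "'b measure" and A :: "(nat \<Rightarrow> nat \<Rightarrow> real) \<Rightarrow> 'b measure"
    and b :: "nat \<times> nat \<Rightarrow> 'b \<Rightarrow> real" and L \<delta> :: real
  assumes A_kernel: "A \<in> data_space n d \<rightarrow>\<^sub>M prob_algebra N"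
    and b_meas [measurable]: "\<And>p. b p \<in> borel_measurable N" and b_bound: "\<And>p x. \<bar>b p x\<bar> \<le> L"
begin

lemma L_nonneg: "0 \<le> L" using b_bound by (meson abs_ge_zero order_trans)

lemma A_prob: "S \<in> space (data_space n d) \<Longrightarrow> prob_space (A S)"
  and A_sets: "S \<in> space (data_space n d) \<Longrightarrow> sets (A S) = sets N"
  using measurable_space[OF A_kernel] by (auto simp: space_prob_algebra)

lemma A_subprob [measurable]: "A \<in> data_space n d \<rightarrow>\<^sub>M subprob_algebra N"
  by (rule measurable_prob_algebraD[OF A_kernel])

definition post_mean :: "nat \<times> nat \<Rightarrow> (nat \<Rightarrow> nat \<Rightarrow> real) \<Rightarrow> real" where
  "post_mean p S = (\<integral>x. b p x \<partial>A S)"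

definition sq_loss :: "(nat \<times> nat \<Rightarrow> real) \<Rightarrow> (nat \<Rightarrow> nat \<Rightarrow> real) \<Rightarrow> real" where
  "sq_loss \<theta> S = (\<integral>x. (\<Sum>p\<in>J. (b p x - \<theta> p)\<^sup>2) \<partial>A S)"

abbreviation obs :: "(nat \<times> nat \<Rightarrow> real) \<Rightarrow> (nat \<Rightarrow> nat \<Rightarrow> real) \<Rightarrow> (nat \<Rightarrow> nat \<Rightarrow> real)" where
  "obs \<theta> \<equiv> shear_data n (\<lambda>r. \<delta> * \<theta> r)"

definition risk :: "(nat \<times> nat \<Rightarrow> real) \<Rightarrow> real" where
  "risk \<theta> = (\<integral>S. sq_loss \<theta> (obs \<theta> S) \<partial>gdata n)"

definition cross :: "nat \<times> nat \<Rightarrow> (nat \<Rightarrow> real) \<Rightarrow> real" where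
  "cross p g = g (fst p) * g (snd p)"

lemma post_mean_measurable [measurable]: "post_mean p \<in> borel_measurable (data_space n d)"
  unfolding post_mean_def
  by (rule measurable_compose[OF A_subprob integral_measurable_subprob_algebra[OF b_meas]])

lemma sq_loss_measurable [measurable]: "sq_loss \<theta> \<in> borel_measurable (data_space n d)"
  unfolding sq_loss_def
  by (rule measurable_compose[OF A_subprob integral_measurable_subprob_algebra]) measurable

lemma integrable_bounded_A:
  assumes S: "S \<in> space (data_space n d)" and f[measurable]: "f \<in> borel_measurable N"
    and "\<And>x. \<bar>f x\<bar> \<le> (C::real)"
  shows "integrable (A S) f"
proof -
  interpret prob_space "A S" by (rule A_prob[OF S])
  have "f \<in> borel_measurable (A S)" using A_sets[OF S] by (simp cong: measurable_cong_sets)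
  then show ?thesis by (intro integrable_const_bound[where B=C]) (use assms in auto)
qed

lemma abs_dev_le: "\<bar>b p x - \<theta> p\<bar> \<le> L + \<bar>\<theta> p\<bar>"
  using b_bound[of p x] by linarith

lemma integrable_dev2: "S \<in> space (data_space n d) \<Longrightarrow> integrable (A S) (\<lambda>x. (b p x - \<theta> p) * (b p' x - \<theta> p'))"
proof (rule integrable_bounded_A)
  show "\<bar>(b p x - \<theta> p) * (b p' x - \<theta> p')\<bar> \<le> (L + \<bar>\<theta> p\<bar>) * (L + \<bar>\<theta> p'\<bar>)" for x
    unfolding abs_mult by (intro mult_mono abs_dev_le) (use L_nonneg in auto)
qed auto

lemma integrable_b: "S \<in> space (data_space n d) \<Longrightarrow> integrable (A S) (b p)"
  by (rule integrable_bounded_A) (auto intro: b_bound)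

lemma post_mean_bound: "S \<in> space (data_space n d) \<Longrightarrow> \<bar>post_mean p S\<bar> \<le> L"
proof -
  assume S: "S \<in> space (data_space n d)"
  interpret prob_space "A S" by (rule A_prob[OF S])
  have "\<bar>post_mean p S\<bar> \<le> (\<integral>x. \<bar>b p x\<bar> \<partial>A S)"
    unfolding post_mean_def by (rule integral_abs_bound)
  also have "\<dots> \<le> (\<integral>x. L \<partial>A S)"
    by (intro integral_mono integrable_abs integrable_b S) (auto intro: b_bound)
  finally show ?thesis by (simp add: prob_space)
qed

lemma sq_loss_eq: "S \<in> space (data_space n d) \<Longrightarrow> sq_loss \<theta> S = (\<Sum>p\<in>J. \<integral>x. (b p x - \<theta> p)\<^sup>2 \<partial>A S)"
  unfolding sq_loss_def using integrable_dev2[of S p \<theta> p for p]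
  by (subst Bochner_Integration.integral_sum) (auto simp: power2_eq_square)

lemma post_mean_sq_le:
  assumes S: "S \<in> space (data_space n d)"
  shows "(\<Sum>p\<in>J. (post_mean p S - \<theta> p)\<^sup>2) \<le> sq_loss \<theta> S"
  unfolding sq_loss_eq[OF S]
proof (rule sum_mono)
  fix p
  interpret prob_space "A S" by (rule A_prob[OF S])
  define m where "m = post_mean p S"
  have i: "integrable (A S) (b p)" by (rule integrable_b[OF S])
  have i2: "integrable (A S) (\<lambda>x. (b p x - \<theta> p)\<^sup>2)"
    using integrable_dev2[OF S, of p \<theta> p] by (simp add: power2_eq_square)
  have "0 \<le> (\<integral>x. (b p x - m)\<^sup>2 \<partial>A S)" by simp
  also have "\<dots> = (\<integral>x. (b p x - \<theta> p)\<^sup>2 + (m - \<theta> p) * (\<theta> p + m - 2 * b p x) \<partial>A S)"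
    by (intro Bochner_Integration.integral_cong) (auto simp: power2_eq_square algebra_simps)
  also have "\<dots> = (\<integral>x. (b p x - \<theta> p)\<^sup>2 \<partial>A S) + (m - \<theta> p) * (\<theta> p + m - 2 * m)"
    using i i2 by (simp add: prob_space m_def post_mean_def)
  finally show "(post_mean p S - \<theta> p)\<^sup>2 \<le> (\<integral>x. (b p x - \<theta> p)\<^sup>2 \<partial>A S)"
    unfolding m_def by (simp add: power2_eq_square algebra_simps)
qed

lemma sq_loss_bound: "S \<in> space (data_space n d) \<Longrightarrow> \<bar>sq_loss \<theta> S\<bar> \<le> (\<Sum>p\<in>J. (L + \<bar>\<theta> p\<bar>)\<^sup>2)"
proof -
  assume S: "S \<in> space (data_space n d)"
  interpret prob_space "A S" by (rule A_prob[OF S])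
  have "(\<integral>x. (b p x - \<theta> p)\<^sup>2 \<partial>A S) \<le> (\<integral>x. (L + \<bar>\<theta> p\<bar>)\<^sup>2 \<partial>A S)" for p
    using integrable_dev2[OF S, of p \<theta> p] abs_dev_le[of p _ \<theta>] L_nonneg
    by (intro integral_mono) (auto simp: power2_eq_square[symmetric] abs_le_square_iff[symmetric])
  then have "sq_loss \<theta> S \<le> (\<Sum>p\<in>J. (L + \<bar>\<theta> p\<bar>)\<^sup>2)"
    unfolding sq_loss_eq[OF S] by (intro sum_mono) (simp add: prob_space)
  moreover have "0 \<le> sq_loss \<theta> S" unfolding sq_loss_def by (intro Bochner_Integration.integral_nonneg sum_nonneg) auto
  ultimately show ?thesis by simp
qed

lemma sq_loss_nonneg: "0 \<le> sq_loss \<theta> S"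
  unfolding sq_loss_def by (intro Bochner_Integration.integral_nonneg sum_nonneg) auto

lemma obs_space: "S \<in> space (data_space n d) \<Longrightarrow> obs \<theta> S \<in> space (data_space n d)"
  by (rule measurable_space[OF shear_data_measurable])

lemma integrable_sq_loss: "integrable (gdata n) (\<lambda>S. sq_loss \<theta> (obs \<theta> S))"
proof -
  interpret prob_space "gdata n" by (rule prob_space_gdata)
  show ?thesis
    by (rule integrable_const_bound[where B="\<Sum>p\<in>J. (L + \<bar>\<theta> p\<bar>)\<^sup>2"])
       (auto intro!: AE_I2 sq_loss_bound obs_space simp: space_gdata)
qed

lemma cross_measurable [measurable]: "p \<in> J \<Longrightarrow> cross p \<in> borel_measurable (PiM {..<d} (\<lambda>_. borel))"
  unfolding cross_def using J_sub by (auto intro!: borel_measurable_times measurable_component_singleton)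

lemma W_subset: "fst ` J \<subseteq> {..<d}" "snd ` J \<subseteq> {..<d}" using J_sub by auto

lemma
  assumes "p \<in> J" "p' \<in> J"
  shows cross_integrable2: "integrable (gauss {..<d}) (\<lambda>g. cross p g * cross p' g)"
    and cross_orthonormal: "(\<integral>g. cross p g * cross p' g \<partial>gauss {..<d}) = (if p = p' then 1 else 0)"
  using gauss_integrable_coord4[OF _ _ _ _ _ W_subset J_disj, of "fst p" "fst p'" "snd p" "snd p'"]
    gauss_moment4[OF _ _ _ _ _ W_subset J_disj, of "fst p" "fst p'" "snd p" "snd p'"] assms
  by (auto simp: cross_def prod_eq_iff)

lemma
  assumes "p \<in> J"
  shows cross_integrable: "integrable (gauss {..<d}) (cross p)"
    and cross_mean: "(\<integral>g. cross p g \<partial>gauss {..<d}) = 0"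
proof -
  have *: "fst p < d" "snd p < d" "fst p \<noteq> snd p" using assms J_sub J_disj by force+
  then show "integrable (gauss {..<d}) (cross p)"
    unfolding cross_def by (intro gauss_integrable_coord2) auto
  show "(\<integral>g. cross p g \<partial>gauss {..<d}) = 0"
    unfolding cross_def using * by (subst gauss_cov) auto
qed

lemma gdata_integrable_coord:
  fixes f :: "(nat \<Rightarrow> real) \<Rightarrow> real"
  assumes i: "i < n" and f: "f \<in> borel_measurable (PiM {..<d} (\<lambda>_. borel))"
  shows "integrable (gdata n) (\<lambda>S. f (S i)) \<longleftrightarrow> integrable (gauss {..<d}) f"
proof -
  have *: "distr (gdata n) (gauss {..<d}) (\<lambda>S. S i) = gauss {..<d}"
    unfolding gdata_def using i by (intro distr_PiM_component prob_space_gauss) auto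
  have f: "f \<in> borel_measurable (gauss {..<d})" using f by (simp cong: measurable_cong_sets)
  have m: "(\<lambda>S. S i) \<in> gdata n \<rightarrow>\<^sub>M gauss {..<d}" using i by measurable
  show ?thesis using integrable_distr_eq[OF m, of f] f by (simp add: *)
qed

lemma integrable_dev_cross:
  assumes i: "i < n" and p: "p \<in> J"
  shows "integrable (gdata n) (\<lambda>S. (post_mean p (obs \<theta> S) - \<theta> p) * cross p (S i))"
proof (rule Bochner_Integration.integrable_bound)
  show "integrable (gdata n) (\<lambda>S. (L + \<bar>\<theta> p\<bar>) * cross p (S i))"
    using p i cross_integrable[OF p] by (intro integrable_mult_right) (simp add: gdata_integrable_coord)
  show "(\<lambda>S. (post_mean p (obs \<theta> S) - \<theta> p) * cross p (S i)) \<in> borel_measurable (gdata n)"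
    using p i by measurable
  show "AE S in gdata n. norm ((post_mean p (obs \<theta> S) - \<theta> p) * cross p (S i)) \<le> norm ((L + \<bar>\<theta> p\<bar>) * cross p (S i))"
  proof (rule AE_I2)
    fix S assume "S \<in> space (gdata n)"
    then have "\<bar>post_mean p (obs \<theta> S)\<bar> \<le> L" by (intro post_mean_bound obs_space) (simp add: space_gdata)
    then have "\<bar>post_mean p (obs \<theta> S) - \<theta> p\<bar> \<le> \<bar>L + \<bar>\<theta> p\<bar>\<bar>" by linarith
    then show "norm ((post_mean p (obs \<theta> S) - \<theta> p) * cross p (S i)) \<le> norm ((L + \<bar>\<theta> p\<bar>) * cross p (S i))"
      by (simp add: abs_mult mult_right_mono)
  qed
qed

definition stable :: "real \<Rightarrow> bool" where
  "stable \<rho> \<longleftrightarrow> (\<forall>S\<in>space (data_space n d). \<forall>S'\<in>space (data_space n d). adjacent n S S' \<longrightarrow>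
     renyi_divergence 2 (A S) (A S') \<le> ereal (\<rho> * 2))"

text \<open>Data sets that agree outside \<open>i\<close> may also agree at \<open>i\<close>; they are then equal and not adjacent, and the bound is
trivial.\<close>

lemma stable_change_of_measure:
  assumes st: "stable \<rho>" "\<rho> \<ge> 0" and S: "S \<in> space (data_space n d)" "S' \<in> space (data_space n d)"
    and i: "i < n" and eq: "\<And>j. j < n \<Longrightarrow> j \<noteq> i \<Longrightarrow> S j = S' j"
    and f[measurable]: "f \<in> borel_measurable N" and bnd: "\<And>x. \<bar>f x\<bar> \<le> C" and \<gamma>: "\<gamma> > 0"
  shows "(\<integral>x. f x \<partial>A S) \<le> (\<integral>x. f x \<partial>A S') + \<gamma> / 2 * (exp (2 * \<rho>) - 1) + 1 / (2 * \<gamma>) * (\<integral>x. (f x)\<^sup>2 \<partial>A S')"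
proof (cases "S i = S' i")
  case True
  have "S = S'"
  proof
    fix j show "S j = S' j"
      using eq[of j] True S by (cases "j < n"; cases "j = i") (auto simp: data_space_def space_PiM PiE_def extensional_def)
  qed
  then have "A S = A S'" by simp
  moreover have "0 \<le> \<gamma> / 2 * (exp (2 * \<rho>) - 1)" using st \<gamma> by simp
  moreover have "0 \<le> 1 / (2 * \<gamma>) * (\<integral>x. (f x)\<^sup>2 \<partial>A S')" using \<gamma> by simp
  ultimately show ?thesis by simp
next
  case False
  then have "adjacent n S S'" unfolding adjacent_def using i eq by blast
  then have "renyi_divergence 2 (A S) (A S') \<le> ereal (\<rho> * 2)" using st S by (auto simp: stable_def)
  moreover have "f \<in> borel_measurable (A S')" using A_sets[OF S(2)] by (simp cong: measurable_cong_sets)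
  ultimately show ?thesis
    by (intro renyi_change_of_measure[OF A_prob A_prob, where C=C]) (auto simp: S A_sets bnd \<gamma>)
qed

text \<open>Write the data as \<open>x(i := g)\<close> with \<open>g\<close> independent of \<open>x\<close>, and let \<open>g'\<close> be any other value of the
observation. By \<open>stable_change_of_measure\<close> the correlation of the error with the score at \<open>g\<close> changes by
a controlled amount if the algorithm is run on \<open>x(i := g')\<close> instead. There the error does not depend on \<open>g\<close>, so
integration over \<open>g\<close> removes the linear term because scores have mean zero, and turns the quadratic
term into the squared loss at \<open>x(i := g')\<close> because they are orthonormal. Averaging over \<open>g'\<close> and \<open>x\<close>
gives back the risk.\<close>

lemma private_cross_bound:
  assumes st: "stable \<rho>" "\<rho> \<ge> 0" and i: "i < n" and \<gamma>: "\<gamma> > 0"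
  shows "(\<Sum>p\<in>J. \<integral>S. (post_mean p (obs \<theta> S) - \<theta> p) * cross p (S i) \<partial>gdata n)
     \<le> \<gamma> / 2 * (exp (2 * \<rho>) - 1) + 1 / (2 * \<gamma>) * risk \<theta>"
proof -
  define I where "I = {..<n} - {i}"
  have I: "finite I" "i \<notin> I" "insert i I = {..<n}" using i by (auto simp: I_def)
  define c where "c = \<gamma> / 2 * (exp (2 * \<rho>) - 1)"
  define \<Phi> where "\<Phi> S = (\<Sum>p\<in>J. (post_mean p (obs \<theta> S) - \<theta> p) * cross p (S i))" for S
  interpret g: prob_space "gauss {..<d}" by (rule prob_space_gauss)
  interpret G: product_prob_space "\<lambda>_. gauss {..<d}" I by (intro product_prob_spaceI prob_space_gauss)
  have pair: "pair_sigma_finite (PiM I (\<lambda>_. gauss {..<d})) (gauss {..<d})"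
    by (intro pair_sigma_finite.intro prob_space_imp_sigma_finite prob_space_gauss prob_space_PiM)
  have int\<Phi>: "integrable (gdata n) \<Phi>"
    unfolding \<Phi>_def by (intro Bochner_Integration.integrable_sum integrable_dev_cross i)
  have split: "(\<integral>S. f S \<partial>gdata n) = (\<integral>x. (\<integral>g. f (x(i := g)) \<partial>gauss {..<d}) \<partial>PiM I (\<lambda>_. gauss {..<d}))"
      and split_int: "integrable (PiM I (\<lambda>_. gauss {..<d})) (\<lambda>x. \<integral>g. f (x(i := g)) \<partial>gauss {..<d})"
      and split_AE: "AE x in PiM I (\<lambda>_. gauss {..<d}). integrable (gauss {..<d}) (\<lambda>g. f (x(i := g)))"
    if f: "integrable (gdata n) f" for f :: "_ \<Rightarrow> real"
  proof -
    have f': "integrable (PiM (insert i I) (\<lambda>_. gauss {..<d})) f" using f by (simp add: gdata_def I)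
    show "(\<integral>S. f S \<partial>gdata n) = (\<integral>x. (\<integral>g. f (x(i := g)) \<partial>gauss {..<d}) \<partial>PiM I (\<lambda>_. gauss {..<d}))"
      using G.product_integral_insert[OF I(1,2) f'] by (simp add: gdata_def I)
    have mm: "(\<lambda>(x, g). x(i := g)) \<in> PiM I (\<lambda>_. gauss {..<d}) \<Otimes>\<^sub>M gauss {..<d} \<rightarrow>\<^sub>M PiM (insert i I) (\<lambda>_. gauss {..<d})"
      by (rule measurable_add_dim)
    have dd: "distr (PiM I (\<lambda>_. gauss {..<d}) \<Otimes>\<^sub>M gauss {..<d}) (PiM (insert i I) (\<lambda>_. gauss {..<d})) (\<lambda>(x, g). x(i := g))
        = PiM (insert i I) (\<lambda>_. gauss {..<d})"
    proof (rule G.PiM_eqI)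
      fix B assume B: "\<And>j. j \<in> insert i I \<Longrightarrow> B j \<in> sets (gauss {..<d})"
      have eq: "(\<lambda>(x, g). x(i := g)) -` (Pi\<^sub>E (insert i I) B) \<inter> space (PiM I (\<lambda>_. gauss {..<d}) \<Otimes>\<^sub>M gauss {..<d})
         = Pi\<^sub>E I B \<times> B i"
        using I B[THEN sets.sets_into_space]
        by (auto simp: space_pair_measure space_PiM PiE_def Pi_def extensional_def split: if_splits) blast+
      then show "emeasure (distr (PiM I (\<lambda>_. gauss {..<d}) \<Otimes>\<^sub>M gauss {..<d}) (PiM (insert i I) (\<lambda>_. gauss {..<d})) (\<lambda>(x, g). x(i := g))) (Pi\<^sub>E (insert i I) B)
         = (\<Prod>j\<in>insert i I. emeasure (gauss {..<d}) (B j))"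
      proof -
        have "emeasure (distr (PiM I (\<lambda>_. gauss {..<d}) \<Otimes>\<^sub>M gauss {..<d}) (PiM (insert i I) (\<lambda>_. gauss {..<d})) (\<lambda>(x, g). x(i := g))) (Pi\<^sub>E (insert i I) B)
          = emeasure (PiM I (\<lambda>_. gauss {..<d}) \<Otimes>\<^sub>M gauss {..<d}) (Pi\<^sub>E I B \<times> B i)"
          unfolding eq[symmetric] by (rule emeasure_distr[OF mm]) (intro sets_PiM_I_finite finite.insertI I B)
        also have "\<dots> = emeasure (PiM I (\<lambda>_. gauss {..<d})) (Pi\<^sub>E I B) * emeasure (gauss {..<d}) (B i)"
          by (intro g.emeasure_pair_measure_Times sets_PiM_I_finite I B) auto
        also have "\<dots> = (\<Prod>j\<in>insert i I. emeasure (gauss {..<d}) (B j))"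
          unfolding prod.insert[OF I(1,2)]
          by (subst G.emeasure_PiM) (use I B in \<open>auto simp: mult.commute simp del: sets_gauss\<close>)
        finally show ?thesis .
      qed
    qed (use I in auto)
    have fp: "integrable (PiM I (\<lambda>_. gauss {..<d}) \<Otimes>\<^sub>M gauss {..<d}) (\<lambda>(x, g). f (x(i := g)))"
      using integrable_distr[OF mm, of f] f' unfolding dd by (simp add: split_beta')
    show "integrable (PiM I (\<lambda>_. gauss {..<d})) (\<lambda>x. \<integral>g. f (x(i := g)) \<partial>gauss {..<d})"
      using pair_sigma_finite.integrable_fst[OF pair fp] .
    show "AE x in PiM I (\<lambda>_. gauss {..<d}). integrable (gauss {..<d}) (\<lambda>g. f (x(i := g)))"
      using pair_sigma_finite.AE_integrable_fst[OF pair fp] .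
  qed
  have "(\<Sum>p\<in>J. \<integral>S. (post_mean p (obs \<theta> S) - \<theta> p) * cross p (S i) \<partial>gdata n) = (\<integral>S. \<Phi> S \<partial>gdata n)"
    unfolding \<Phi>_def by (rule Bochner_Integration.integral_sum[symmetric]) (rule integrable_dev_cross[OF i])
  also have "\<dots> = (\<integral>x. (\<integral>g. \<Phi> (x(i := g)) \<partial>gauss {..<d}) \<partial>PiM I (\<lambda>_. gauss {..<d}))"
    by (rule split[OF int\<Phi>])
  also have "\<dots> \<le> (\<integral>x. (\<integral>g. c + 1 / (2 * \<gamma>) * sq_loss \<theta> (obs \<theta> (x(i := g))) \<partial>gauss {..<d}) \<partial>PiM I (\<lambda>_. gauss {..<d}))"
  proof (rule integral_mono_AE[OF split_int[OF int\<Phi>]])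
    have i1: "integrable (gdata n) (\<lambda>S. c + 1 / (2 * \<gamma>) * sq_loss \<theta> (obs \<theta> S))"
      using prob_space.finite_measure[OF prob_space_gdata, of n] integrable_sq_loss[of \<theta>]
      by (auto intro!: finite_measure.integrable_const)
    from split_int[OF this]
    show "integrable (PiM I (\<lambda>_. gauss {..<d})) (\<lambda>x. \<integral>g. c + 1 / (2 * \<gamma>) * sq_loss \<theta> (obs \<theta> (x(i := g))) \<partial>gauss {..<d})" .
    show "AE x in PiM I (\<lambda>_. gauss {..<d}). (\<integral>g. \<Phi> (x(i := g)) \<partial>gauss {..<d})
        \<le> (\<integral>g. c + 1 / (2 * \<gamma>) * sq_loss \<theta> (obs \<theta> (x(i := g))) \<partial>gauss {..<d})"
      using split_AE[OF int\<Phi>] split_AE[OF i1] AE_space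
    proof eventually_elim
      case (elim x)
      have xsp: "x(i := g) \<in> space (data_space n d)" if "g \<in> space (gauss {..<d})" for g
        using that elim(3) I by (auto simp: data_space_def point_space_def space_PiM PiE_def Pi_def extensional_def I_def)
      define X where "X g = obs \<theta> (x(i := g))" for g
      have Xsp: "X g \<in> space (data_space n d)" if "g \<in> space (gauss {..<d})" for g
        unfolding X_def by (intro obs_space xsp that)
      have "(\<integral>g. \<Phi> (x(i := g)) \<partial>gauss {..<d}) \<le> c + 1 / (2 * \<gamma>) * sq_loss \<theta> (X g')"
        if g': "g' \<in> space (gauss {..<d})" for g'
      proof -
        define U where "U p p' = (\<integral>y. (b p y - \<theta> p) * (b p' y - \<theta> p') \<partial>A (X g'))" for p p'
        have "(\<integral>g. \<Phi> (x(i := g)) \<partial>gauss {..<d})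
           \<le> (\<integral>g. (\<Sum>p\<in>J. (post_mean p (X g') - \<theta> p) * cross p g) + c
                + 1 / (2 * \<gamma>) * (\<Sum>p\<in>J. \<Sum>p'\<in>J. cross p g * cross p' g * U p p') \<partial>gauss {..<d})"
        proof (rule integral_mono[OF elim(1)])
          show "integrable (gauss {..<d}) (\<lambda>g. (\<Sum>p\<in>J. (post_mean p (X g') - \<theta> p) * cross p g) + c
                + 1 / (2 * \<gamma>) * (\<Sum>p\<in>J. \<Sum>p'\<in>J. cross p g * cross p' g * U p p'))"
            by (intro Bochner_Integration.integrable_add integrable_mult_right Bochner_Integration.integrable_sum
                integrable_mult_left cross_integrable cross_integrable2 g.integrable_const)
          fix g assume g: "g \<in> space (gauss {..<d})"
          define f where "f y = (\<Sum>p\<in>J. cross p g * (b p y - \<theta> p))" for y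
          have fm: "f \<in> borel_measurable N" unfolding f_def by measurable
          have fb: "\<bar>f y\<bar> \<le> (\<Sum>p\<in>J. \<bar>cross p g\<bar> * (L + \<bar>\<theta> p\<bar>))" for y
            unfolding f_def by (rule order_trans[OF sum_abs])
              (auto simp: abs_mult intro!: sum_mono mult_left_mono abs_dev_le)
          have fint: "(\<integral>y. f y \<partial>A S) = (\<Sum>p\<in>J. (post_mean p S - \<theta> p) * cross p g)"
            if "S \<in> space (data_space n d)" for S
          proof -
            interpret prob_space "A S" by (rule A_prob[OF that])
            show ?thesis unfolding f_def using integrable_b[OF that]
              by (subst Bochner_Integration.integral_sum) (auto simp: post_mean_def prob_space mult.commute)
          qed
          have f2: "(\<integral>y. (f y)\<^sup>2 \<partial>A (X g')) = (\<Sum>p\<in>J. \<Sum>p'\<in>J. cross p g * cross p' g * U p p')"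
          proof -
            have "(\<integral>y. (f y)\<^sup>2 \<partial>A (X g')) = (\<integral>y. (\<Sum>p\<in>J. \<Sum>p'\<in>J. cross p g * cross p' g * ((b p y - \<theta> p) * (b p' y - \<theta> p'))) \<partial>A (X g'))"
              by (simp add: f_def power2_eq_square sum_product mult_ac)
            also have "\<dots> = (\<Sum>p\<in>J. \<Sum>p'\<in>J. cross p g * cross p' g * U p p')"
              using integrable_dev2[OF Xsp[OF g'], of _ \<theta>] unfolding U_def
              by (subst Bochner_Integration.integral_sum | force intro!: sum.cong Bochner_Integration.integrable_sum)+
            finally show ?thesis .
          qed
          have "\<Phi> (x(i := g)) = (\<integral>y. f y \<partial>A (X g))"
            using fint[OF Xsp[OF g]] by (simp add: \<Phi>_def X_def)
          also have "\<dots> \<le> (\<integral>y. f y \<partial>A (X g')) + \<gamma> / 2 * (exp (2 * \<rho>) - 1) + 1 / (2 * \<gamma>) * (\<integral>y. (f y)\<^sup>2 \<partial>A (X g'))"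
            by (rule stable_change_of_measure[OF st Xsp[OF g] Xsp[OF g'] i _ fm fb \<gamma>])
               (auto simp: X_def shear_data_def)
          finally show "\<Phi> (x(i := g)) \<le> (\<Sum>p\<in>J. (post_mean p (X g') - \<theta> p) * cross p g) + c
                + 1 / (2 * \<gamma>) * (\<Sum>p\<in>J. \<Sum>p'\<in>J. cross p g * cross p' g * U p p')"
            unfolding f2 fint[OF Xsp[OF g']] c_def by simp
        qed
        also have "\<dots> = c + 1 / (2 * \<gamma>) * (\<integral>g. (\<Sum>p\<in>J. \<Sum>p'\<in>J. cross p g * cross p' g * U p p') \<partial>gauss {..<d})"
        proof -
          have 1: "integrable (gauss {..<d}) (\<lambda>g. \<Sum>p\<in>J. (post_mean p (X g') - \<theta> p) * cross p g)"
            by (intro Bochner_Integration.integrable_sum integrable_mult_right cross_integrable)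
          have 2: "integrable (gauss {..<d}) (\<lambda>g. \<Sum>p\<in>J. \<Sum>p'\<in>J. cross p g * cross p' g * U p p')"
            by (intro Bochner_Integration.integrable_sum integrable_mult_left cross_integrable2)
          have 3: "(\<integral>g. (\<Sum>p\<in>J. (post_mean p (X g') - \<theta> p) * cross p g) \<partial>gauss {..<d}) = 0"
            by (subst Bochner_Integration.integral_sum)
               (auto intro!: integrable_mult_right cross_integrable simp: cross_mean)
          show ?thesis using 1 2 g.prob_space by (simp add: 3)
        qed
        also have "(\<integral>g. (\<Sum>p\<in>J. \<Sum>p'\<in>J. cross p g * cross p' g * U p p') \<partial>gauss {..<d})
           = (\<Sum>p\<in>J. \<integral>g. (\<Sum>p'\<in>J. cross p g * cross p' g * U p p') \<partial>gauss {..<d})"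
          by (intro Bochner_Integration.integral_sum Bochner_Integration.integrable_sum integrable_mult_left cross_integrable2)
        also have "\<dots> = (\<Sum>p\<in>J. \<Sum>p'\<in>J. \<integral>g. cross p g * cross p' g * U p p' \<partial>gauss {..<d})"
          by (intro sum.cong refl Bochner_Integration.integral_sum integrable_mult_left cross_integrable2)
        also have "\<dots> = (\<Sum>p\<in>J. \<Sum>p'\<in>J. (if p = p' then 1 else 0) * U p p')"
          by (intro sum.cong refl) (simp add: cross_orthonormal)
        also have "\<dots> = sq_loss \<theta> (X g')"
          by (simp add: sq_loss_eq[OF Xsp[OF g']] U_def power2_eq_square if_distrib[of "\<lambda>x. x * _"] cong: if_cong)
        finally show ?thesis .
      qed
      then have "(\<integral>g'. (\<integral>g. \<Phi> (x(i := g)) \<partial>gauss {..<d}) \<partial>gauss {..<d})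
          \<le> (\<integral>g'. c + 1 / (2 * \<gamma>) * sq_loss \<theta> (obs \<theta> (x(i := g'))) \<partial>gauss {..<d})"
        using elim(2) by (intro integral_mono) (auto simp: X_def)
      then show ?case using g.prob_space by simp
    qed
  qed
  also have "\<dots> = (\<integral>S. c + 1 / (2 * \<gamma>) * sq_loss \<theta> (obs \<theta> S) \<partial>gdata n)"
    using prob_space.finite_measure[OF prob_space_gdata, of n] integrable_sq_loss[of \<theta>]
    by (intro split[symmetric]) (auto intro!: finite_measure.integrable_const)
  also have "\<dots> = c + 1 / (2 * \<gamma>) * risk \<theta>"
    using prob_space.prob_space[OF prob_space_gdata, of n] integrable_sq_loss[of \<theta>]
      prob_space.finite_measure[OF prob_space_gdata, of n] unfolding risk_def
    by (subst Bochner_Integration.integral_add) (auto intro!: finite_measure.integrable_const)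
  finally show ?thesis unfolding c_def .
qed

end

context bounded_estimator
begin

lemma
  assumes i: "i < n" "i' < n" and p: "p \<in> J"
  shows gdata_cross2_integrable: "integrable (gdata n) (\<lambda>S. cross p (S i) * cross p (S i'))"
    and gdata_cross2: "(\<integral>S. cross p (S i) * cross p (S i') \<partial>gdata n) = (if i = i' then 1 else 0)"
proof -
  interpret g: prob_space "gauss {..<d}" by (rule prob_space_gauss)
  interpret G: product_prob_space "\<lambda>_. gauss {..<d}" "{..<n}" by (intro product_prob_spaceI prob_space_gauss)
  define e where "e l = (if l = i then 1 else 0) + (if l = i' then 1 else (0::nat))" for l
  have eq: "(\<Prod>l<n. cross p (S l) ^ e l) = cross p (S i) * cross p (S i')" for S
    using power_indicator_prod[of "{..<n}" i "\<lambda>l. cross p (S l)"] power_indicator_prod[of "{..<n}" i' "\<lambda>l. cross p (S l)"] i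
    by (simp add: e_def power_add prod.distrib del: One_nat_def)
  have int: "integrable (gauss {..<d}) (\<lambda>g. cross p g ^ e l)" for l
    using cross_integrable[OF p] cross_integrable2[OF p p]
    by (auto simp: e_def numeral_2_eq_2[symmetric] power2_eq_square)
  show "integrable (gdata n) (\<lambda>S. cross p (S i) * cross p (S i'))"
    using G.product_integrable_prod[of "{..<n}" "\<lambda>l g. cross p g ^ e l"] int by (simp add: eq gdata_def)
  have "(\<integral>S. cross p (S i) * cross p (S i') \<partial>gdata n) = (\<Prod>l<n. \<integral>g. cross p g ^ e l \<partial>gauss {..<d})"
    using G.product_integral_prod[of "{..<n}" "\<lambda>l g. cross p g ^ e l"] int by (simp add: eq gdata_def)
  also have "\<dots> = (if i = i' then 1 else 0)"
  proof (cases "i = i'")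
    case True
    then have "(\<Prod>l<n. \<integral>g. cross p g ^ e l \<partial>gauss {..<d}) = 1"
      using cross_orthonormal[OF p p]
      by (intro prod.neutral) (auto simp: e_def numeral_2_eq_2[symmetric] power2_eq_square g.prob_space[simplified])
    then show ?thesis using True by simp
  next
    case False
    then have "(\<integral>g. cross p g ^ e i \<partial>gauss {..<d}) = 0" by (simp add: e_def cross_mean[OF p])
    then have "(\<Prod>l<n. \<integral>g. cross p g ^ e l \<partial>gauss {..<d}) = 0" using i by (intro prod_zero) auto
    then show ?thesis using False by simp
  qed
  finally show "(\<integral>S. cross p (S i) * cross p (S i') \<partial>gdata n) = (if i = i' then 1 else 0)" .
qed

lemma integrable_dev_sq: "integrable (gdata n) (\<lambda>S. (post_mean p (obs \<theta> S) - \<theta> p)\<^sup>2)"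
proof -
  interpret prob_space "gdata n" by (rule prob_space_gdata)
  show ?thesis
  proof (rule integrable_const_bound[where B="(L + \<bar>\<theta> p\<bar>)\<^sup>2"])
    show "AE S in gdata n. norm ((post_mean p (obs \<theta> S) - \<theta> p)\<^sup>2) \<le> (L + \<bar>\<theta> p\<bar>)\<^sup>2"
    proof (rule AE_I2)
      fix S assume "S \<in> space (gdata n)"
      then have "\<bar>post_mean p (obs \<theta> S)\<bar> \<le> L" by (intro post_mean_bound obs_space) (simp add: space_gdata)
      then have "\<bar>post_mean p (obs \<theta> S) - \<theta> p\<bar> \<le> \<bar>L + \<bar>\<theta> p\<bar>\<bar>" by linarith
      then show "norm ((post_mean p (obs \<theta> S) - \<theta> p)\<^sup>2) \<le> (L + \<bar>\<theta> p\<bar>)\<^sup>2"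
        by (simp add: abs_le_square_iff)
    qed
  qed measurable
qed

lemma integrable_dev: "integrable (gdata n) (\<lambda>S. post_mean p (obs \<theta> S) - \<theta> p)"
proof -
  interpret prob_space "gdata n" by (rule prob_space_gdata)
  show ?thesis
  proof (rule integrable_const_bound[where B="L + \<bar>\<theta> p\<bar>"])
    show "AE S in gdata n. norm (post_mean p (obs \<theta> S) - \<theta> p) \<le> L + \<bar>\<theta> p\<bar>"
    proof (rule AE_I2)
      fix S assume "S \<in> space (gdata n)"
      then have "\<bar>post_mean p (obs \<theta> S)\<bar> \<le> L" by (intro post_mean_bound obs_space) (simp add: space_gdata)
      then show "norm (post_mean p (obs \<theta> S) - \<theta> p) \<le> L + \<bar>\<theta> p\<bar>" unfolding real_norm_def by linarith
    qed
  qed measurable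
qed

lemma dev_sq_sum_le: "(\<Sum>p\<in>J. \<integral>S. (post_mean p (obs \<theta> S) - \<theta> p)\<^sup>2 \<partial>gdata n) \<le> risk \<theta>"
proof -
  have "(\<Sum>p\<in>J. \<integral>S. (post_mean p (obs \<theta> S) - \<theta> p)\<^sup>2 \<partial>gdata n)
      = (\<integral>S. (\<Sum>p\<in>J. (post_mean p (obs \<theta> S) - \<theta> p)\<^sup>2) \<partial>gdata n)"
    by (rule Bochner_Integration.integral_sum[symmetric]) (rule integrable_dev_sq)
  also have "\<dots> \<le> risk \<theta>"
    unfolding risk_def
    by (intro integral_mono Bochner_Integration.integrable_sum integrable_dev_sq integrable_sq_loss post_mean_sq_le obs_space)
       (simp add: space_gdata)
  finally show ?thesis .
qed

text \<open>The sum of the scores of \<open>n\<close> independent observations has second moment \<open>n * \<delta>\<^sup>2\<close> for each entry.\<close>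

lemma independent_cross_bound:
  assumes \<beta>: "\<beta> > 0"
  shows "(\<Sum>p\<in>J. \<integral>S. (post_mean p (obs \<theta> S) - \<theta> p) * (\<Sum>i<n. \<delta> * cross p (S i)) \<partial>gdata n)
     \<le> \<beta> / 2 * risk \<theta> + 1 / (2 * \<beta>) * (card J * (n * \<delta>\<^sup>2))"
proof -
  have "(\<integral>S. (post_mean p (obs \<theta> S) - \<theta> p) * (\<Sum>i<n. \<delta> * cross p (S i)) \<partial>gdata n)
    \<le> \<beta> / 2 * (\<integral>S. (post_mean p (obs \<theta> S) - \<theta> p)\<^sup>2 \<partial>gdata n) + 1 / (2 * \<beta>) * (n * \<delta>\<^sup>2)" if p: "p \<in> J" for p
  proof -
    have sq: "(\<Sum>i<n. \<delta> * cross p (S i))\<^sup>2 = \<delta>\<^sup>2 * (\<Sum>i<n. \<Sum>i'<n. cross p (S i) * cross p (S i'))" for S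
      by (simp add: power2_eq_square sum_product sum_distrib_left mult_ac)
    have isq: "integrable (gdata n) (\<lambda>S. (\<Sum>i<n. \<delta> * cross p (S i))\<^sup>2)"
      unfolding sq by (intro integrable_mult_right Bochner_Integration.integrable_sum gdata_cross2_integrable p) auto
    have esq: "(\<integral>S. (\<Sum>i<n. \<delta> * cross p (S i))\<^sup>2 \<partial>gdata n) = n * \<delta>\<^sup>2"
    proof -
      have "(\<integral>S. (\<Sum>i<n. \<Sum>i'<n. cross p (S i) * cross p (S i')) \<partial>gdata n)
         = (\<Sum>i<n. \<integral>S. (\<Sum>i'<n. cross p (S i) * cross p (S i')) \<partial>gdata n)"
        by (intro Bochner_Integration.integral_sum Bochner_Integration.integrable_sum gdata_cross2_integrable p) auto
      also have "\<dots> = (\<Sum>i<n. \<Sum>i'<n. \<integral>S. cross p (S i) * cross p (S i') \<partial>gdata n)"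
        by (intro sum.cong refl Bochner_Integration.integral_sum gdata_cross2_integrable p) auto
      also have "\<dots> = (\<Sum>i<n. \<Sum>i'<n. if i = i' then 1 else 0)"
        by (intro sum.cong refl gdata_cross2 p) auto
      also have "\<dots> = n" by simp
      finally show ?thesis unfolding sq by simp
    qed
    have "(\<integral>S. (post_mean p (obs \<theta> S) - \<theta> p) * (\<Sum>i<n. \<delta> * cross p (S i)) \<partial>gdata n)
       \<le> (\<integral>S. \<beta> / 2 * (post_mean p (obs \<theta> S) - \<theta> p)\<^sup>2 + 1 / (2 * \<beta>) * (\<Sum>i<n. \<delta> * cross p (S i))\<^sup>2 \<partial>gdata n)"
    proof (rule integral_mono)
      have "integrable (gdata n) (\<lambda>S. \<Sum>i<n. \<delta> * ((post_mean p (obs \<theta> S) - \<theta> p) * cross p (S i)))"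
        by (intro Bochner_Integration.integrable_sum integrable_mult_right integrable_dev_cross p) auto
      then show "integrable (gdata n) (\<lambda>S. (post_mean p (obs \<theta> S) - \<theta> p) * (\<Sum>i<n. \<delta> * cross p (S i)))"
        by (simp only: sum_distrib_left mult.left_commute)
      show "integrable (gdata n) (\<lambda>S. \<beta> / 2 * (post_mean p (obs \<theta> S) - \<theta> p)\<^sup>2 + 1 / (2 * \<beta>) * (\<Sum>i<n. \<delta> * cross p (S i))\<^sup>2)"
        by (intro Bochner_Integration.integrable_add integrable_mult_right integrable_dev_sq isq)
    qed (rule AM_GM_weighted[OF \<beta>])
    also have "\<dots> = \<beta> / 2 * (\<integral>S. (post_mean p (obs \<theta> S) - \<theta> p)\<^sup>2 \<partial>gdata n) + 1 / (2 * \<beta>) * (n * \<delta>\<^sup>2)"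
      using integrable_dev_sq[of p \<theta>] isq esq by simp
    finally show ?thesis .
  qed
  then have "(\<Sum>p\<in>J. \<integral>S. (post_mean p (obs \<theta> S) - \<theta> p) * (\<Sum>i<n. \<delta> * cross p (S i)) \<partial>gdata n)
    \<le> (\<Sum>p\<in>J. \<beta> / 2 * (\<integral>S. (post_mean p (obs \<theta> S) - \<theta> p)\<^sup>2 \<partial>gdata n) + 1 / (2 * \<beta>) * (n * \<delta>\<^sup>2))"
    by (rule sum_mono)
  also have "\<dots> = \<beta> / 2 * (\<Sum>p\<in>J. \<integral>S. (post_mean p (obs \<theta> S) - \<theta> p)\<^sup>2 \<partial>gdata n) + 1 / (2 * \<beta>) * (card J * (n * \<delta>\<^sup>2))"
    by (simp add: sum.distrib sum_distrib_left)
  also have "\<dots> \<le> \<beta> / 2 * risk \<theta> + 1 / (2 * \<beta>) * (card J * (n * \<delta>\<^sup>2))"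
    using \<beta> by (intro add_mono mult_left_mono dev_sq_sum_le) auto
  finally show ?thesis .
qed

text \<open>The \<open>n\<close> observations contribute linearly, not in quadrature: this is why \<open>n\<^sup>2\<close> appears. The free parameter of
\<open>private_cross_bound\<close> is chosen to make the coefficient of the risk equal to \<open>\<beta> / 2\<close>.\<close>

lemma private_cross_bound_total:
  assumes st: "stable \<rho>" "\<rho> \<ge> 0" and \<beta>: "\<beta> > 0" and \<delta>: "\<delta> > 0"
  shows "(\<Sum>p\<in>J. \<integral>S. (post_mean p (obs \<theta> S) - \<theta> p) * (\<Sum>i<n. \<delta> * cross p (S i)) \<partial>gdata n)
     \<le> \<beta> / 2 * risk \<theta> + 1 / (2 * \<beta>) * ((real n)\<^sup>2 * \<delta>\<^sup>2 * (exp (2 * \<rho>) - 1))"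
proof (cases "n = 0")
  case True
  have "0 \<le> risk \<theta>" unfolding risk_def
    by (intro Bochner_Integration.integral_nonneg sq_loss_nonneg)
  then show ?thesis using True \<beta> by simp
next
  case False
  \<comment> \<open>Chosen so that \<open>n * \<delta> / (2 * \<gamma>) = \<beta> / 2\<close>.\<close>
  define \<gamma> where "\<gamma> = n * \<delta> / \<beta>"
  have \<gamma>: "\<gamma> > 0" using False \<beta> \<delta> by (simp add: \<gamma>_def)
  have "(\<integral>S. (post_mean p (obs \<theta> S) - \<theta> p) * (\<Sum>i<n. \<delta> * cross p (S i)) \<partial>gdata n)
     = (\<Sum>i<n. \<delta> * (\<integral>S. (post_mean p (obs \<theta> S) - \<theta> p) * cross p (S i) \<partial>gdata n))" if p: "p \<in> J" for p
  proof -
    have "(\<integral>S. (post_mean p (obs \<theta> S) - \<theta> p) * (\<Sum>i<n. \<delta> * cross p (S i)) \<partial>gdata n)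
      = (\<integral>S. (\<Sum>i<n. \<delta> * ((post_mean p (obs \<theta> S) - \<theta> p) * cross p (S i))) \<partial>gdata n)"
      by (simp only: sum_distrib_left mult.left_commute)
    also have "\<dots> = (\<Sum>i<n. \<integral>S. \<delta> * ((post_mean p (obs \<theta> S) - \<theta> p) * cross p (S i)) \<partial>gdata n)"
      by (intro Bochner_Integration.integral_sum integrable_mult_right integrable_dev_cross p) auto
    finally show ?thesis by simp
  qed
  then have "(\<Sum>p\<in>J. \<integral>S. (post_mean p (obs \<theta> S) - \<theta> p) * (\<Sum>i<n. \<delta> * cross p (S i)) \<partial>gdata n)
    = (\<Sum>i<n. \<delta> * (\<Sum>p\<in>J. \<integral>S. (post_mean p (obs \<theta> S) - \<theta> p) * cross p (S i) \<partial>gdata n))"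
    by (simp add: sum_distrib_left sum.swap[of _ J])
  also have "\<dots> \<le> (\<Sum>i<n. \<delta> * (\<gamma> / 2 * (exp (2 * \<rho>) - 1) + 1 / (2 * \<gamma>) * risk \<theta>))"
    using \<delta> by (intro sum_mono mult_left_mono private_cross_bound st \<gamma>) auto
  also have "\<dots> = \<beta> / 2 * risk \<theta> + 1 / (2 * \<beta>) * ((real n)\<^sup>2 * \<delta>\<^sup>2 * (exp (2 * \<rho>) - 1))"
    using False \<beta> \<delta> by (simp add: \<gamma>_def field_simps power2_eq_square)
  finally show ?thesis .
qed

text \<open>The van Trees (Bayesian Cramer-Rao) inequality for the prior with density proportional to \<open>\<omega>\<close> with respect to the
standard Gaussian, in additive form. The assumption \<open>cross\<close> isolates the only place where the information
in the data enters, so that the statistical and the private bound can both be inserted.\<close>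

theorem weighted_van_trees:
  fixes \<omega> :: "(nat \<times> nat \<Rightarrow> real) \<Rightarrow> real" and q :: "nat \<times> nat \<Rightarrow> (nat \<times> nat \<Rightarrow> real) \<Rightarrow> real"
  assumes \<omega>_meas[measurable]: "\<omega> \<in> borel_measurable (PiM J (\<lambda>_. borel))" and \<omega>01: "\<And>\<theta>. 0 \<le> \<omega> \<theta>" "\<And>\<theta>. \<omega> \<theta> \<le> 1"
    and q_meas[measurable]: "\<And>p. p \<in> J \<Longrightarrow> q p \<in> borel_measurable (PiM J (\<lambda>_. borel))"
    and deriv: "\<And>p \<theta> t. p \<in> J \<Longrightarrow> ((\<lambda>t. \<omega> (\<theta>(p := t))) has_real_derivative \<omega> (\<theta>(p := t)) * q p (\<theta>(p := t))) (at t)"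
    and cont: "\<And>p \<theta>. p \<in> J \<Longrightarrow> continuous_on UNIV (\<lambda>t. \<omega> (\<theta>(p := t)) * q p (\<theta>(p := t)))"
    and supp: "\<And>p \<theta>. p \<in> J \<Longrightarrow> \<omega> \<theta> \<noteq> 0 \<Longrightarrow> \<bar>\<theta> p\<bar> \<le> L" and qb: "\<And>p \<theta>. p \<in> J \<Longrightarrow> \<bar>\<omega> \<theta> * q p \<theta>\<bar> \<le> Q"
    and iq: "\<And>p. p \<in> J \<Longrightarrow> integrable (gauss J) (\<lambda>\<theta>. \<omega> \<theta> * (q p \<theta>)\<^sup>2)"
    and \<beta>: "\<beta> > 0"
    and cross: "\<And>\<theta>. \<omega> \<theta> \<noteq> 0 \<Longrightarrow> (\<Sum>p\<in>J. \<integral>S. (post_mean p (obs \<theta> S) - \<theta> p) * (\<Sum>i<n. \<delta> * cross p (S i)) \<partial>gdata n)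
         \<le> \<beta> / 2 * risk \<theta> + 1 / (2 * \<beta>) * V"
    and R: "\<And>\<theta>. \<omega> \<theta> \<noteq> 0 \<Longrightarrow> risk \<theta> \<le> R"
  shows "card J * (\<integral>\<theta>. \<omega> \<theta> \<partial>gauss J) \<le> (3 * \<beta> / 2 * R + 1 / (2 * \<beta>) * V) * (\<integral>\<theta>. \<omega> \<theta> \<partial>gauss J)
     + 1 / (2 * \<beta>) * (\<Sum>p\<in>J. (\<integral>\<theta>. \<omega> \<theta> * (q p \<theta>)\<^sup>2 \<partial>gauss J) + (\<integral>\<theta>. \<omega> \<theta> * (\<theta> p)\<^sup>2 \<partial>gauss J))"
proof -
  interpret X: prob_space "gauss J" by (rule prob_space_gauss)
  interpret S: prob_space "gdata n" by (rule prob_space_gdata)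
  have i\<omega>: "integrable (gauss J) \<omega>"
    by (rule X.integrable_const_bound[where B=1]) (use \<omega>01 in auto)
  have [measurable]: "(\<lambda>\<theta>. \<theta> p) \<in> borel_measurable (PiM J (\<lambda>_. borel :: real measure))" if "p \<in> J" for p
    using that by (intro measurable_component_singleton)
  have it: "integrable (gauss J) (\<lambda>\<theta>. \<omega> \<theta> * (\<theta> p)\<^sup>2)" if p: "p \<in> J" for p
  proof (rule X.integrable_const_bound[where B="L\<^sup>2"])
    show "AE \<theta> in gauss J. norm (\<omega> \<theta> * (\<theta> p)\<^sup>2) \<le> L\<^sup>2"
    proof (rule AE_I2)
      fix \<theta>
      have "\<omega> \<theta> * (\<theta> p)\<^sup>2 \<le> 1 * L\<^sup>2"
      proof (cases "\<omega> \<theta> = 0")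
        case False
        then have "\<bar>\<theta> p\<bar> \<le> \<bar>L\<bar>" using supp[OF p, of \<theta>] L_nonneg by simp
        then have "(\<theta> p)\<^sup>2 \<le> L\<^sup>2" by (simp add: abs_le_square_iff)
        then show ?thesis using \<omega>01[of \<theta>] by (intro mult_mono) auto
      qed simp
      then show "norm (\<omega> \<theta> * (\<theta> p)\<^sup>2) \<le> L\<^sup>2" using \<omega>01[of \<theta>] by simp
    qed
  qed (use p in measurable)
  define E where "E p \<theta> = (\<integral>S. \<omega> \<theta> * (post_mean p (obs \<theta> S) - \<theta> p)
      * ((\<Sum>i<n. \<delta> * (S i (fst p) * S i (snd p))) + q p \<theta> - \<theta> p) \<partial>gdata n)" for p \<theta>
  have sc: "has_bochner_integral (gauss J) (E p) (\<integral>\<theta>. \<omega> \<theta> \<partial>gauss J)" if p: "p \<in> J" for p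
    unfolding E_def
    by (rule score_identity[where m="post_mean p" and \<omega>=\<omega> and q="q p" and L=L and Q=Q])
       (rule p \<omega>_meas \<omega>01 q_meas[OF p] deriv[OF p] cont[OF p] qb[OF p] post_mean_measurable L_nonneg
         | erule supp[OF p] | erule post_mean_bound)+
  have "card J * (\<integral>\<theta>. \<omega> \<theta> \<partial>gauss J) = (\<Sum>p\<in>J. \<integral>\<theta>. E p \<theta> \<partial>gauss J)"
    using sc by (simp add: has_bochner_integral_iff)
  also have "\<dots> = (\<integral>\<theta>. (\<Sum>p\<in>J. E p \<theta>) \<partial>gauss J)"
    by (rule Bochner_Integration.integral_sum[symmetric]) (use sc in \<open>simp add: has_bochner_integral_iff\<close>)
  also have "\<dots> \<le> (\<integral>\<theta>. (3 * \<beta> / 2 * R + 1 / (2 * \<beta>) * V) * \<omega> \<theta>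
     + 1 / (2 * \<beta>) * (\<Sum>p\<in>J. \<omega> \<theta> * (q p \<theta>)\<^sup>2 + \<omega> \<theta> * (\<theta> p)\<^sup>2) \<partial>gauss J)"
  proof (rule integral_mono)
    show "integrable (gauss J) (\<lambda>\<theta>. \<Sum>p\<in>J. E p \<theta>)"
      using sc by (intro Bochner_Integration.integrable_sum) (simp add: has_bochner_integral_iff)
    show "integrable (gauss J) (\<lambda>\<theta>. (3 * \<beta> / 2 * R + 1 / (2 * \<beta>) * V) * \<omega> \<theta>
     + 1 / (2 * \<beta>) * (\<Sum>p\<in>J. \<omega> \<theta> * (q p \<theta>)\<^sup>2 + \<omega> \<theta> * (\<theta> p)\<^sup>2))"
      by (intro Bochner_Integration.integrable_add integrable_mult_right Bochner_Integration.integrable_sum i\<omega> iq it)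
    fix \<theta>
    show "(\<Sum>p\<in>J. E p \<theta>) \<le> (3 * \<beta> / 2 * R + 1 / (2 * \<beta>) * V) * \<omega> \<theta>
     + 1 / (2 * \<beta>) * (\<Sum>p\<in>J. \<omega> \<theta> * (q p \<theta>)\<^sup>2 + \<omega> \<theta> * (\<theta> p)\<^sup>2)"
    proof (cases "\<omega> \<theta> = 0")
      case True then show ?thesis by (simp add: E_def)
    next
      case False
      define D where "D p = (\<integral>S. (post_mean p (obs \<theta> S) - \<theta> p)\<^sup>2 \<partial>gdata n)" for p
      define T where "T p = (\<integral>S. (post_mean p (obs \<theta> S) - \<theta> p) * (\<Sum>i<n. \<delta> * cross p (S i)) \<partial>gdata n)" for p
      have lin: "(\<integral>S. post_mean p (obs \<theta> S) - \<theta> p \<partial>gdata n) * y \<le> \<beta> / 2 * D p + 1 / (2 * \<beta>) * y\<^sup>2" for p y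
      proof -
        have "(\<integral>S. post_mean p (obs \<theta> S) - \<theta> p \<partial>gdata n) * y = (\<integral>S. (post_mean p (obs \<theta> S) - \<theta> p) * y \<partial>gdata n)"
          by simp
        also have "\<dots> \<le> (\<integral>S. \<beta> / 2 * (post_mean p (obs \<theta> S) - \<theta> p)\<^sup>2 + 1 / (2 * \<beta>) * y\<^sup>2 \<partial>gdata n)"
          by (intro integral_mono integrable_mult_left integrable_dev Bochner_Integration.integrable_add
              integrable_mult_right integrable_dev_sq S.integrable_const AM_GM_weighted \<beta>)
        also have "\<dots> = \<beta> / 2 * D p + 1 / (2 * \<beta>) * y\<^sup>2"
          using integrable_dev_sq[of p \<theta>] by (simp add: D_def S.prob_space)
        finally show ?thesis .
      qed
      have E_le: "E p \<theta> \<le> \<omega> \<theta> * (T p + (\<beta> / 2 * D p + 1 / (2 * \<beta>) * (q p \<theta>)\<^sup>2) + (\<beta> / 2 * D p + 1 / (2 * \<beta>) * (\<theta> p)\<^sup>2))"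
        if p: "p \<in> J" for p
      proof -
        have iT: "integrable (gdata n) (\<lambda>S. (post_mean p (obs \<theta> S) - \<theta> p) * (\<Sum>i<n. \<delta> * cross p (S i)))"
        proof -
          have "integrable (gdata n) (\<lambda>S. \<Sum>i<n. \<delta> * ((post_mean p (obs \<theta> S) - \<theta> p) * cross p (S i)))"
            by (intro Bochner_Integration.integrable_sum integrable_mult_right integrable_dev_cross p) auto
          then show ?thesis by (simp only: sum_distrib_left mult.left_commute)
        qed
        have "E p \<theta> = (\<integral>S. \<omega> \<theta> * ((post_mean p (obs \<theta> S) - \<theta> p) * (\<Sum>i<n. \<delta> * cross p (S i))
            + (post_mean p (obs \<theta> S) - \<theta> p) * (q p \<theta> - \<theta> p)) \<partial>gdata n)"
          unfolding E_def cross_def by (intro Bochner_Integration.integral_cong refl) (simp add: algebra_simps)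
        also have "\<dots> = \<omega> \<theta> * (T p + (\<integral>S. post_mean p (obs \<theta> S) - \<theta> p \<partial>gdata n) * (q p \<theta> - \<theta> p))"
          unfolding T_def integral_mult_right_zero
            Bochner_Integration.integral_add[OF iT integrable_mult_left[OF integrable_dev[of p \<theta>], of "q p \<theta> - \<theta> p"]]
            integral_mult_left_zero ..
        also have "\<dots> \<le> \<omega> \<theta> * (T p + (\<beta> / 2 * D p + 1 / (2 * \<beta>) * (q p \<theta>)\<^sup>2) + (\<beta> / 2 * D p + 1 / (2 * \<beta>) * (\<theta> p)\<^sup>2))"
          using lin[of p "q p \<theta>"] lin[of p "- \<theta> p"] \<omega>01[of \<theta>]
          by (intro mult_left_mono) (auto simp: right_diff_distrib)
        finally show ?thesis .
      qed
      have "(\<Sum>p\<in>J. E p \<theta>) \<le> (\<Sum>p\<in>J. \<omega> \<theta> * (T p + (\<beta> / 2 * D p + 1 / (2 * \<beta>) * (q p \<theta>)\<^sup>2) + (\<beta> / 2 * D p + 1 / (2 * \<beta>) * (\<theta> p)\<^sup>2)))"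
        by (intro sum_mono E_le)
      also have "\<dots> = \<omega> \<theta> * ((\<Sum>p\<in>J. T p) + \<beta> * (\<Sum>p\<in>J. D p)) + 1 / (2 * \<beta>) * (\<Sum>p\<in>J. \<omega> \<theta> * (q p \<theta>)\<^sup>2 + \<omega> \<theta> * (\<theta> p)\<^sup>2)"
        by (simp add: sum.distrib sum_distrib_left algebra_simps)
      also have "\<dots> \<le> \<omega> \<theta> * ((\<beta> / 2 * R + 1 / (2 * \<beta>) * V) + \<beta> * R) + 1 / (2 * \<beta>) * (\<Sum>p\<in>J. \<omega> \<theta> * (q p \<theta>)\<^sup>2 + \<omega> \<theta> * (\<theta> p)\<^sup>2)"
      proof (intro add_mono mult_left_mono order_refl \<omega>01(1))
        have "\<beta> / 2 * risk \<theta> \<le> \<beta> / 2 * R" using R[OF False] \<beta> by simp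
        then show "(\<Sum>p\<in>J. T p) \<le> \<beta> / 2 * R + 1 / (2 * \<beta>) * V"
          using cross[OF False] unfolding T_def by linarith
        show "(\<Sum>p\<in>J. D p) \<le> R" using dev_sq_sum_le[of \<theta>] R[OF False] unfolding D_def by linarith
      qed (use \<beta> in auto)
      also have "\<dots> = (3 * \<beta> / 2 * R + 1 / (2 * \<beta>) * V) * \<omega> \<theta>
         + 1 / (2 * \<beta>) * (\<Sum>p\<in>J. \<omega> \<theta> * (q p \<theta>)\<^sup>2 + \<omega> \<theta> * (\<theta> p)\<^sup>2)"
        by (simp add: algebra_simps)
      finally show ?thesis .
    qed
  qed
  also have "\<dots> = (3 * \<beta> / 2 * R + 1 / (2 * \<beta>) * V) * (\<integral>\<theta>. \<omega> \<theta> \<partial>gauss J)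
     + 1 / (2 * \<beta>) * (\<integral>\<theta>. (\<Sum>p\<in>J. \<omega> \<theta> * (q p \<theta>)\<^sup>2 + \<omega> \<theta> * (\<theta> p)\<^sup>2) \<partial>gauss J)"
  proof -
    have "integrable (gauss J) (\<lambda>\<theta>. \<Sum>p\<in>J. \<omega> \<theta> * (q p \<theta>)\<^sup>2 + \<omega> \<theta> * (\<theta> p)\<^sup>2)"
      by (intro Bochner_Integration.integrable_sum Bochner_Integration.integrable_add iq it)
    then show ?thesis using i\<omega> by simp
  qed
  also have "(\<integral>\<theta>. (\<Sum>p\<in>J. \<omega> \<theta> * (q p \<theta>)\<^sup>2 + \<omega> \<theta> * (\<theta> p)\<^sup>2) \<partial>gauss J)
    = (\<Sum>p\<in>J. (\<integral>\<theta>. \<omega> \<theta> * (q p \<theta>)\<^sup>2 \<partial>gauss J) + (\<integral>\<theta>. \<omega> \<theta> * (\<theta> p)\<^sup>2 \<partial>gauss J))"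
    using iq it by (subst Bochner_Integration.integral_sum) auto
  finally show ?thesis .
qed

end

section \<open>Smoothly truncated Gaussian priors\<close>

lemma gauss_independent:
  fixes f g :: "('i \<Rightarrow> real) \<Rightarrow> ennreal"
  assumes J: "finite J" and I: "I \<subseteq> J"
    and f[measurable]: "f \<in> borel_measurable (PiM J (\<lambda>_. borel))" and g[measurable]: "g \<in> borel_measurable (PiM J (\<lambda>_. borel))"
    and fI: "\<And>\<theta> \<theta>'. (\<And>p. p \<in> I \<Longrightarrow> \<theta> p = \<theta>' p) \<Longrightarrow> f \<theta> = f \<theta>'"
    and gI: "\<And>\<theta> \<theta>'. (\<And>p. p \<in> J - I \<Longrightarrow> \<theta> p = \<theta>' p) \<Longrightarrow> g \<theta> = g \<theta>'"
  shows "(\<integral>\<^sup>+\<theta>. f \<theta> * g \<theta> \<partial>gauss J) = (\<integral>\<^sup>+\<theta>. f \<theta> \<partial>gauss J) * (\<integral>\<^sup>+\<theta>. g \<theta> \<partial>gauss J)"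
proof -
  define K where "K = J - I"
  have IK: "I \<inter> K = {}" "finite I" "finite K" "I \<union> K = J" using J I by (auto simp: K_def finite_subset)
  interpret X: prob_space "gauss I" by (rule prob_space_gauss)
  interpret Y: prob_space "gauss K" by (rule prob_space_gauss)
  have fold: "(\<integral>\<^sup>+\<theta>. h \<theta> \<partial>gauss J) = (\<integral>\<^sup>+x. (\<integral>\<^sup>+y. h (merge I K (x, y)) \<partial>gauss K) \<partial>gauss I)"
    if "h \<in> borel_measurable (PiM J (\<lambda>_. borel))" for h
  proof -
    have "h \<in> borel_measurable (PiM (I \<union> K) (\<lambda>_. std_gauss))"
      using that IK sets_gauss[of J] unfolding gauss_def by (simp cong: measurable_cong_sets)
    from std_gauss.product_nn_integral_fold[OF IK(1-3) this] show ?thesis by (simp add: gauss_def IK)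
  qed
  define x0 :: "'i \<Rightarrow> real" where "x0 = (\<lambda>i\<in>I. 0)"
  define y0 :: "'i \<Rightarrow> real" where "y0 = (\<lambda>i\<in>K. 0)"
  have mg: "(\<lambda>(x, y). merge I K (x, y)) \<in> PiM I (\<lambda>_. borel) \<Otimes>\<^sub>M PiM K (\<lambda>_. borel) \<rightarrow>\<^sub>M PiM J (\<lambda>_. borel :: real measure)"
    using measurable_merge[of I K "\<lambda>_. borel :: real measure"] by (simp add: IK(4) split_def)
  have [measurable]: "(\<lambda>y. merge I K (x0, y)) \<in> PiM K (\<lambda>_. borel) \<rightarrow>\<^sub>M PiM J (\<lambda>_. borel)"
    using measurable_compose[OF measurable_Pair1'[of x0 "PiM I (\<lambda>_. borel)" "PiM K (\<lambda>_. borel)"] mg]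
    by (simp add: x0_def space_PiM)
  have [measurable]: "(\<lambda>x. merge I K (x, y0)) \<in> PiM I (\<lambda>_. borel) \<rightarrow>\<^sub>M PiM J (\<lambda>_. borel)"
    using measurable_compose[OF measurable_Pair2'[of y0 "PiM K (\<lambda>_. borel)" "PiM I (\<lambda>_. borel)"] mg]
    by (simp add: y0_def space_PiM)
  have fm: "f (merge I K (x, y)) = f (merge I K (x, y0))" for x y by (rule fI) (simp add: merge_def)
  have gm: "g (merge I K (x, y)) = g (merge I K (x0, y))" for x y
    using IK by (intro gI) (auto simp: merge_def K_def)
  have f_int: "(\<integral>\<^sup>+\<theta>. f \<theta> \<partial>gauss J) = (\<integral>\<^sup>+x. f (merge I K (x, y0)) \<partial>gauss I)"
  proof -
    have "(\<integral>\<^sup>+y. f (merge I K (x, y)) \<partial>gauss K) = f (merge I K (x, y0))" for x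
      using Y.emeasure_space_1 by (subst fm) simp
    then show ?thesis unfolding fold[OF f] by simp
  qed
  have g_int: "(\<integral>\<^sup>+\<theta>. g \<theta> \<partial>gauss J) = (\<integral>\<^sup>+y. g (merge I K (x0, y)) \<partial>gauss K)"
  proof -
    have "(\<integral>\<^sup>+\<theta>. g \<theta> \<partial>gauss J) = (\<integral>\<^sup>+x. (\<integral>\<^sup>+y. g (merge I K (x0, y)) \<partial>gauss K) \<partial>gauss I)"
      unfolding fold[OF g] by (intro nn_integral_cong) (rule gm)
    also have "\<dots> = (\<integral>\<^sup>+y. g (merge I K (x0, y)) \<partial>gauss K)"
      using X.emeasure_space_1 by (simp only: nn_integral_const mult_1_right)
    finally show ?thesis .
  qed
  have "(\<integral>\<^sup>+\<theta>. f \<theta> * g \<theta> \<partial>gauss J) = (\<integral>\<^sup>+x. (\<integral>\<^sup>+y. f (merge I K (x, y)) * g (merge I K (x, y)) \<partial>gauss K) \<partial>gauss I)"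
    by (rule fold) measurable
  also have "\<dots> = (\<integral>\<^sup>+x. (\<integral>\<^sup>+y. f (merge I K (x, y0)) * g (merge I K (x0, y)) \<partial>gauss K) \<partial>gauss I)"
    by (intro nn_integral_cong arg_cong2[where f="(*)"] fm gm)
  also have "\<dots> = (\<integral>\<^sup>+x. f (merge I K (x, y0)) * (\<integral>\<^sup>+\<theta>. g \<theta> \<partial>gauss J) \<partial>gauss I)"
    unfolding g_int by (intro nn_integral_cong nn_integral_cmult) measurable
  also have "\<dots> = (\<integral>\<^sup>+\<theta>. f \<theta> \<partial>gauss J) * (\<integral>\<^sup>+\<theta>. g \<theta> \<partial>gauss J)"
    unfolding f_int by (intro nn_integral_multc) measurable
  finally show ?thesis .
qed

text \<open>The square makes the cutoff continuously differentiable where it vanishes.\<close>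

lemma has_derivative_positive_part_sq:
  "((\<lambda>x::real. (max 0 x)\<^sup>2) has_real_derivative 2 * max 0 x) (at x)"
proof -
  consider "x > 0" | "x < 0" | "x = 0" by linarith
  then show ?thesis
  proof cases
    case 1
    have "((\<lambda>x. x\<^sup>2) has_real_derivative 2 * max 0 x) (at x)"
      using 1 by (auto intro!: derivative_eq_intros)
    then show ?thesis
      by (rule has_field_derivative_transform_within_open[of _ _ _ "{0<..}"]) (use 1 in auto)
  next
    case 2
    have "((\<lambda>x. 0) has_real_derivative 2 * max 0 x) (at x)" using 2 by simp
    then show ?thesis
      by (rule has_field_derivative_transform_within_open[of _ _ _ "{..<0}"]) (use 2 in auto)
  next
    case 3
    have "((\<lambda>h::real. max 0 h) \<longlongrightarrow> max 0 0) (at 0)" by (intro tendsto_intros)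
    moreover have "eventually (\<lambda>h::real. max 0 h = (max 0 h)\<^sup>2 / h) (at 0)"
      by (auto simp: eventually_at_filter max_def power2_eq_square)
    ultimately have "((\<lambda>h::real. (max 0 h)\<^sup>2 / h) \<longlongrightarrow> 0) (at 0)"
      using Lim_transform_eventually by fastforce
    then show ?thesis by (simp add: 3 DERIV_def)
  qed
qed

text \<open>In each block \<open>b\<close> finitely many linear forms \<open>c u\<close> of the entries are kept small by a cutoff that depends on
the sum of their exponentials. The assumption on \<open>T\<close> guarantees that this sum has mean at most \<open>T / 2\<close> under the standard
Gaussian, so that the cutoff keeps a constant fraction of the mass of every block.\<close>

locale soft_prior =
  fixes J :: "'p set" and blk :: "'p \<Rightarrow> 'b" and Bs :: "'b set" and U :: "'u set"
    and c :: "'u \<Rightarrow> 'p \<Rightarrow> real" and \<kappa> T :: real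
  assumes finite_J [simp]: "finite J" and finite_U [simp]: "finite U" and finite_Bs [simp]: "finite Bs"
    and blk: "blk ` J \<subseteq> Bs"
    and \<kappa>: "\<And>b u. b \<in> Bs \<Longrightarrow> u \<in> U \<Longrightarrow> (\<Sum>p | p \<in> J \<and> blk p = b. (c u p)\<^sup>2) \<le> \<kappa>" and \<kappa>0: "0 \<le> \<kappa>"
    and T0: "T > 0" and T: "real (card U) * exp (\<kappa> / 2) \<le> T / 2"
begin

definition pos :: "'b \<Rightarrow> 'p set" where "pos b = {p \<in> J. blk p = b}"

lemma finite_pos [simp]: "finite (pos b)" by (simp add: pos_def)
lemma pos_sub: "pos b \<subseteq> J" by (auto simp: pos_def)

definition ex :: "'u \<Rightarrow> 'b \<Rightarrow> ('p \<Rightarrow> real) \<Rightarrow> real" where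
  "ex u b \<theta> = exp (\<Sum>p\<in>pos b. c u p * \<theta> p)"

definition F :: "'b \<Rightarrow> ('p \<Rightarrow> real) \<Rightarrow> real" where "F b \<theta> = (\<Sum>u\<in>U. ex u b \<theta>)"

definition cutoff :: "'b \<Rightarrow> ('p \<Rightarrow> real) \<Rightarrow> real" where "cutoff b \<theta> = max 0 (1 - F b \<theta> / T)"

definition weight :: "('p \<Rightarrow> real) \<Rightarrow> real" where "weight \<theta> = (\<Prod>b\<in>Bs. (cutoff b \<theta>)\<^sup>2)"

definition dF :: "'p \<Rightarrow> ('p \<Rightarrow> real) \<Rightarrow> real" where
  "dF p \<theta> = (\<Sum>u\<in>U. c u p * ex u (blk p) \<theta>)"

text \<open>The partial derivative of \<open>ln (weight \<theta>)\<close> in the entry \<open>p\<close>; where the cutoff vanishes it is 0, by the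
convention for division by zero, in accordance with the vanishing derivative of \<open>weight\<close>.\<close>

definition q :: "'p \<Rightarrow> ('p \<Rightarrow> real) \<Rightarrow> real" where
  "q p \<theta> = - 2 * (dF p \<theta> / T) / cutoff (blk p) \<theta>"

definition rest :: "'b \<Rightarrow> ('p \<Rightarrow> real) \<Rightarrow> real" where "rest b \<theta> = (\<Prod>b'\<in>Bs - {b}. (cutoff b' \<theta>)\<^sup>2)"

lemma component_measurable [measurable]: "p \<in> J \<Longrightarrow> (\<lambda>\<theta>. \<theta> p) \<in> borel_measurable (PiM J (\<lambda>_. borel :: real measure))"
  by (intro measurable_component_singleton)

lemma ex_measurable [measurable]: "ex u b \<in> borel_measurable (PiM J (\<lambda>_. borel))"
proof -
  have [measurable]: "\<And>p. p \<in> pos b \<Longrightarrow> (\<lambda>\<theta>. \<theta> p) \<in> borel_measurable (PiM J (\<lambda>_. borel :: real measure))"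
    using pos_sub by (intro component_measurable) auto
  show ?thesis unfolding ex_def by measurable
qed

lemma F_measurable [measurable]: "F b \<in> borel_measurable (PiM J (\<lambda>_. borel))"
  unfolding F_def by measurable
lemma cutoff_measurable [measurable]: "cutoff b \<in> borel_measurable (PiM J (\<lambda>_. borel))"
  unfolding cutoff_def by measurable
lemma weight_measurable [measurable]: "weight \<in> borel_measurable (PiM J (\<lambda>_. borel))"
  unfolding weight_def by measurable
lemma rest_measurable [measurable]: "rest b \<in> borel_measurable (PiM J (\<lambda>_. borel))"
  unfolding rest_def by measurable
lemma dF_measurable [measurable]: "dF p \<in> borel_measurable (PiM J (\<lambda>_. borel))"
  unfolding dF_def by measurable
lemma q_measurable [measurable]: "q p \<in> borel_measurable (PiM J (\<lambda>_. borel))"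
  unfolding q_def by measurable

lemma ex_pos: "0 < ex u b \<theta>" by (simp add: ex_def)
lemma F_nonneg: "0 \<le> F b \<theta>" by (auto simp: F_def intro!: sum_nonneg less_imp_le[OF ex_pos])

lemma cutoff_bounds: "0 \<le> cutoff b \<theta>" "cutoff b \<theta> \<le> 1"
  using F_nonneg[of b \<theta>] T0 by (auto simp: cutoff_def)

lemma cutoff_sq_bounds: "0 \<le> (cutoff b \<theta>)\<^sup>2" "(cutoff b \<theta>)\<^sup>2 \<le> 1"
  using cutoff_bounds[of b \<theta>] by (auto simp: power_le_one)

lemma weight_bounds: "0 \<le> weight \<theta>" "weight \<theta> \<le> 1"
  unfolding weight_def using cutoff_sq_bounds by (auto intro!: prod_nonneg prod_le_1)

lemma rest_bounds: "0 \<le> rest b \<theta>" "rest b \<theta> \<le> 1"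
  unfolding rest_def using cutoff_sq_bounds by (auto intro!: prod_nonneg prod_le_1)

lemma weight_split: "b \<in> Bs \<Longrightarrow> weight \<theta> = (cutoff b \<theta>)\<^sup>2 * rest b \<theta>"
  unfolding weight_def rest_def by (rule prod.remove) auto

lemma weight_pos_iff: "weight \<theta> \<noteq> 0 \<longleftrightarrow> (\<forall>b\<in>Bs. F b \<theta> < T)"
  using T0 by (auto simp: weight_def cutoff_def max_def field_simps)

lemma cutoff_cong: "(\<And>p. p \<in> pos b \<Longrightarrow> \<theta> p = \<theta>' p) \<Longrightarrow> cutoff b \<theta> = cutoff b \<theta>'"
  unfolding cutoff_def F_def ex_def by (auto intro!: arg_cong[where f="\<lambda>x. max 0 (1 - x / T)"] sum.cong)

lemma cutoff_upd_other: "blk p \<noteq> b \<Longrightarrow> cutoff b (\<theta>(p := t)) = cutoff b \<theta>"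
  by (rule cutoff_cong) (auto simp: pos_def)

lemma rest_upd: "rest (blk p) (\<theta>(p := t)) = rest (blk p) \<theta>"
  unfolding rest_def by (rule prod.cong) (auto simp: cutoff_upd_other)

lemma ex_has_derivative:
  assumes p: "p \<in> J"
  shows "((\<lambda>t. ex u (blk p) (\<theta>(p := t))) has_real_derivative c u p * ex u (blk p) (\<theta>(p := t))) (at t)"
proof -
  have pp: "p \<in> pos (blk p)" using p by (simp add: pos_def)
  have "(\<Sum>r\<in>pos (blk p). c u r * (\<theta>(p := t)) r) = c u p * t + (\<Sum>r\<in>pos (blk p) - {p}. c u r * \<theta> r)" for t
    by (subst sum.remove[OF finite_pos pp]) (auto intro!: sum.cong)
  then show ?thesis unfolding ex_def by (auto intro!: derivative_eq_intros)
qed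

lemma cutoff_sq_has_derivative:
  assumes p: "p \<in> J"
  shows "((\<lambda>t. (cutoff (blk p) (\<theta>(p := t)))\<^sup>2) has_real_derivative
     2 * cutoff (blk p) (\<theta>(p := t)) * (- dF p (\<theta>(p := t)) / T)) (at t)"
proof -
  have "((\<lambda>t. 1 - F (blk p) (\<theta>(p := t)) / T) has_real_derivative (- dF p (\<theta>(p := t)) / T)) (at t)"
  proof -
    have "((\<lambda>t. F (blk p) (\<theta>(p := t))) has_real_derivative dF p (\<theta>(p := t))) (at t)"
      unfolding F_def dF_def by (rule DERIV_sum) (rule ex_has_derivative[OF p])
    from DERIV_diff[OF DERIV_const[of 1] DERIV_cdivide[OF this, of T]] show ?thesis by simp
  qed
  from DERIV_chain2[OF has_derivative_positive_part_sq this] show ?thesis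
    unfolding cutoff_def by simp
qed

lemma weight_q: "p \<in> J \<Longrightarrow> weight \<theta> * q p \<theta> = 2 * cutoff (blk p) \<theta> * (- dF p \<theta> / T) * rest (blk p) \<theta>"
  using blk by (subst weight_split[of "blk p"]) (auto simp: q_def power2_eq_square)

lemma weight_has_derivative:
  assumes p: "p \<in> J"
  shows "((\<lambda>t. weight (\<theta>(p := t))) has_real_derivative weight (\<theta>(p := t)) * q p (\<theta>(p := t))) (at t)"
proof -
  have b: "blk p \<in> Bs" using p blk by auto
  have "((\<lambda>t. (cutoff (blk p) (\<theta>(p := t)))\<^sup>2 * rest (blk p) \<theta>) has_real_derivative
     2 * cutoff (blk p) (\<theta>(p := t)) * (- dF p (\<theta>(p := t)) / T) * rest (blk p) \<theta>) (at t)"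
    by (rule DERIV_cmult_right[OF cutoff_sq_has_derivative[OF p]])
  moreover have "weight (\<theta>(p := t)) * q p (\<theta>(p := t))
      = 2 * cutoff (blk p) (\<theta>(p := t)) * (- dF p (\<theta>(p := t)) / T) * rest (blk p) \<theta>"
    by (simp only: weight_q[OF p] rest_upd)
  moreover have "(\<lambda>t. weight (\<theta>(p := t))) = (\<lambda>t. (cutoff (blk p) (\<theta>(p := t)))\<^sup>2 * rest (blk p) \<theta>)"
    by (simp only: weight_split[OF b] rest_upd)
  ultimately show ?thesis by simp
qed

lemma weight_q_continuous:
  assumes p: "p \<in> J"
  shows "continuous_on UNIV (\<lambda>t. weight (\<theta>(p := t)) * q p (\<theta>(p := t)))"
proof -
  have e: "continuous_on UNIV (\<lambda>t. ex u (blk p) (\<theta>(p := t)))" for u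
    using ex_has_derivative[OF p] by (intro continuous_at_imp_continuous_on) (auto intro: DERIV_isCont)
  have "continuous_on UNIV (\<lambda>t. cutoff (blk p) (\<theta>(p := t)))"
    unfolding cutoff_def F_def by (intro continuous_intros e) (use T0 in auto)
  then show ?thesis unfolding weight_q[OF p] rest_upd dF_def
    by (intro continuous_intros e) (use T0 in auto)
qed

text \<open>The gradient of a sum of exponentials is a combination of the coefficient vectors with positive weights
adding up to \<open>F\<close>, and each of these vectors has squared length at most \<open>\<kappa>\<close>.\<close>

lemma sum_dF_sq:
  assumes b: "b \<in> Bs"
  shows "(\<Sum>p\<in>pos b. (dF p \<theta>)\<^sup>2) \<le> \<kappa> * (F b \<theta>)\<^sup>2"
proof -
  have "(\<Sum>p\<in>pos b. (dF p \<theta>)\<^sup>2) = (\<Sum>p\<in>pos b. (\<Sum>u\<in>U. c u p * ex u b \<theta>)\<^sup>2)"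
    by (intro sum.cong) (auto simp: dF_def pos_def)
  also have "\<dots> \<le> (\<Sum>p\<in>pos b. F b \<theta> * (\<Sum>u\<in>U. (c u p)\<^sup>2 * ex u b \<theta>))"
  proof (rule sum_mono)
    fix p
    have "(\<Sum>u\<in>U. c u p * ex u b \<theta>)\<^sup>2 = (\<Sum>u\<in>U. (sqrt (ex u b \<theta>)) * (c u p * sqrt (ex u b \<theta>)))\<^sup>2"
      using ex_pos by (intro arg_cong[where f="\<lambda>x. x\<^sup>2"] sum.cong) (auto simp: less_imp_le)
    also have "\<dots> \<le> (\<Sum>u\<in>U. (sqrt (ex u b \<theta>))\<^sup>2) * (\<Sum>u\<in>U. (c u p * sqrt (ex u b \<theta>))\<^sup>2)"
      by (rule Cauchy_Schwarz_ineq_sum)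
    also have "\<dots> = F b \<theta> * (\<Sum>u\<in>U. (c u p)\<^sup>2 * ex u b \<theta>)"
      using ex_pos by (simp add: F_def power_mult_distrib less_imp_le)
    finally show "(\<Sum>u\<in>U. c u p * ex u b \<theta>)\<^sup>2 \<le> F b \<theta> * (\<Sum>u\<in>U. (c u p)\<^sup>2 * ex u b \<theta>)" .
  qed
  also have "\<dots> = F b \<theta> * (\<Sum>u\<in>U. (\<Sum>p\<in>pos b. (c u p)\<^sup>2) * ex u b \<theta>)"
    by (simp add: sum_distrib_left[symmetric] sum_distrib_right sum.swap[of _ U])
  also have "\<dots> \<le> F b \<theta> * (\<Sum>u\<in>U. \<kappa> * ex u b \<theta>)"
    using \<kappa>[OF b] by (intro mult_left_mono sum_mono mult_right_mono F_nonneg less_imp_le[OF ex_pos])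
      (auto simp: pos_def)
  also have "\<dots> = \<kappa> * (F b \<theta>)\<^sup>2"
    by (simp add: F_def sum_distrib_left[symmetric] power2_eq_square)
  finally show ?thesis .
qed

text \<open>On the support of the cutoff \<open>F < T\<close>, so the squared gradient of \<open>cutoff b\<close> is at most \<open>\<kappa>\<close>. The factor \<open>(cutoff b)\<^sup>2\<close> of the
weight cancels against the denominator of \<open>q\<close>.\<close>

lemma weight_q_sq_sum:
  assumes b: "b \<in> Bs"
  shows "(\<Sum>p\<in>pos b. weight \<theta> * (q p \<theta>)\<^sup>2) \<le> 4 * \<kappa> * rest b \<theta>"
proof (cases "cutoff b \<theta> = 0")
  case True
  then show ?thesis using rest_bounds[of b \<theta>] \<kappa>0 weight_split[OF b, of \<theta>] by simp
next
  case False
  then have FT: "F b \<theta> < T" using T0 by (auto simp: cutoff_def max_def field_simps split: if_splits)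
  have "(\<Sum>p\<in>pos b. weight \<theta> * (q p \<theta>)\<^sup>2) = (\<Sum>p\<in>pos b. 4 * rest b \<theta> / T\<^sup>2 * (dF p \<theta>)\<^sup>2)"
    using False by (intro sum.cong refl) (auto simp: weight_split[OF b] q_def pos_def power_divide power_mult_distrib field_simps)
  also have "\<dots> = 4 * rest b \<theta> / T\<^sup>2 * (\<Sum>p\<in>pos b. (dF p \<theta>)\<^sup>2)" by (simp add: sum_distrib_left)
  also have "\<dots> \<le> 4 * rest b \<theta> / T\<^sup>2 * (\<kappa> * T\<^sup>2)"
  proof (intro mult_left_mono order_trans[OF sum_dF_sq[OF b]])
    show "(F b \<theta>)\<^sup>2 \<le> T\<^sup>2" using FT F_nonneg[of b \<theta>] by (intro power_mono) auto
  qed (use rest_bounds[of b \<theta>] \<kappa>0 in auto)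
  also have "\<dots> = 4 * \<kappa> * rest b \<theta>" using T0 by simp
  finally show ?thesis .
qed

lemma weight_q_sq_le: "p \<in> J \<Longrightarrow> weight \<theta> * (q p \<theta>)\<^sup>2 \<le> 4 * \<kappa>"
proof -
  assume p: "p \<in> J"
  then have b: "blk p \<in> Bs" "p \<in> pos (blk p)" using blk by (auto simp: pos_def)
  have "weight \<theta> * (q p \<theta>)\<^sup>2 \<le> (\<Sum>p\<in>pos (blk p). weight \<theta> * (q p \<theta>)\<^sup>2)"
    using b weight_bounds by (intro member_le_sum) auto
  also have "\<dots> \<le> 4 * \<kappa> * rest (blk p) \<theta>" by (rule weight_q_sq_sum[OF b(1)])
  also have "\<dots> \<le> 4 * \<kappa> * 1" using \<kappa>0 rest_bounds by (intro mult_left_mono) auto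
  finally show ?thesis by simp
qed

lemma weight_q_le: "p \<in> J \<Longrightarrow> \<bar>weight \<theta> * q p \<theta>\<bar> \<le> sqrt (4 * \<kappa>)"
proof -
  assume p: "p \<in> J"
  have "(weight \<theta> * q p \<theta>)\<^sup>2 = weight \<theta> * (weight \<theta> * (q p \<theta>)\<^sup>2)" by (simp add: power2_eq_square)
  also have "\<dots> \<le> 1 * (weight \<theta> * (q p \<theta>)\<^sup>2)"
    using weight_bounds[of \<theta>] by (intro mult_right_mono) auto
  also have "\<dots> \<le> 1 * (4 * \<kappa>)"
    using weight_q_sq_le[OF p, of \<theta>] by simp
  finally show ?thesis by (metis mult_1 real_sqrt_abs real_sqrt_le_mono)
qed

lemma integrable_bounded_gauss:
  "f \<in> borel_measurable (PiM J (\<lambda>_. borel)) \<Longrightarrow> (\<And>\<theta>. \<bar>f \<theta>\<bar> \<le> (C::real)) \<Longrightarrow> integrable (gauss J) f"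
  by (rule finite_measure.integrable_const_bound[OF prob_space.finite_measure[OF prob_space_gauss], where B=C]) auto

text \<open>The mean of the cutoff is at least 1/2, because it dominates \<open>1 - F / T\<close>, and a square dominates its tangent at 1/2.\<close>

lemma cutoff_sq_mean: assumes b: "b \<in> Bs" shows "1 / 4 \<le> (\<integral>\<theta>. (cutoff b \<theta>)\<^sup>2 \<partial>gauss J)"
proof -
  interpret X: prob_space "gauss J" by (rule prob_space_gauss)
  have nnF: "(\<integral>\<^sup>+\<theta>. ennreal (F b \<theta>) \<partial>gauss J) \<le> ennreal (T / 2)"
  proof -
    have "(\<integral>\<^sup>+\<theta>. ennreal (F b \<theta>) \<partial>gauss J) = (\<Sum>u\<in>U. \<integral>\<^sup>+\<theta>. ennreal (ex u b \<theta>) \<partial>gauss J)"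
      unfolding F_def using ex_pos
      by (subst nn_integral_sum[symmetric]) (auto simp: sum_ennreal less_imp_le)
    also have "\<dots> \<le> (\<Sum>u\<in>U. ennreal (exp (\<kappa> / 2)))"
    proof (rule sum_mono)
      fix u assume u: "u \<in> U"
      have eq: "ex u b \<theta> = exp (\<Sum>p\<in>J. (if blk p = b then c u p else 0) * \<theta> p)" for \<theta>
        unfolding ex_def pos_def by (simp add: sum.inter_filter if_distrib[of "\<lambda>x. x * _"] cong: if_cong)
      have "(\<Sum>p\<in>J. (if blk p = b then c u p else 0)\<^sup>2) = (\<Sum>p | p \<in> J \<and> blk p = b. (c u p)\<^sup>2)"
        by (subst sum.inter_filter) (auto intro!: sum.cong)
      then show "(\<integral>\<^sup>+\<theta>. ennreal (ex u b \<theta>) \<partial>gauss J) \<le> ennreal (exp (\<kappa> / 2))"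
        unfolding eq gauss_mgf[OF finite_J] using \<kappa>[OF b u] by (intro ennreal_leI) simp
    qed
    also have "\<dots> = ennreal (card U * exp (\<kappa> / 2))" by (simp add: ennreal_mult' ennreal_of_nat_eq_real_of_nat)
    also have "\<dots> \<le> ennreal (T / 2)" using T by (rule ennreal_leI)
    finally show ?thesis .
  qed
  have iF: "integrable (gauss J) (F b)"
    by (rule integrableI_nonneg) (use nnF F_nonneg in \<open>auto intro: le_less_trans\<close>)
  have EF: "(\<integral>\<theta>. F b \<theta> \<partial>gauss J) \<le> T / 2"
    using nnF nn_integral_eq_integral[OF iF] F_nonneg T0 by simp
  have iv: "integrable (gauss J) (cutoff b)"
    by (rule integrable_bounded_gauss[where C=1]) (use cutoff_bounds in auto)
  have iv2: "integrable (gauss J) (\<lambda>\<theta>. (cutoff b \<theta>)\<^sup>2)"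
    by (rule integrable_bounded_gauss[where C=1]) (use cutoff_sq_bounds in auto)
  have "1 / 2 \<le> 1 - (\<integral>\<theta>. F b \<theta> \<partial>gauss J) / T" using EF T0 by (simp add: field_simps)
  also have "\<dots> = (\<integral>\<theta>. 1 - F b \<theta> / T \<partial>gauss J)" using iF X.prob_space by simp
  also have "\<dots> \<le> (\<integral>\<theta>. cutoff b \<theta> \<partial>gauss J)"
    using iF by (intro integral_mono iv) (auto simp: cutoff_def)
  finally have Ev: "1 / 2 \<le> (\<integral>\<theta>. cutoff b \<theta> \<partial>gauss J)" .
  have "(\<integral>\<theta>. cutoff b \<theta> \<partial>gauss J) - 1 / 4 = (\<integral>\<theta>. cutoff b \<theta> - 1 / 4 \<partial>gauss J)" using iv X.prob_space by simp
  also have "\<dots> \<le> (\<integral>\<theta>. (cutoff b \<theta>)\<^sup>2 \<partial>gauss J)"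
  proof (intro integral_mono iv2)
    fix \<theta>
    have "0 \<le> (cutoff b \<theta> - 1 / 2)\<^sup>2" by simp
    then show "cutoff b \<theta> - 1 / 4 \<le> (cutoff b \<theta>)\<^sup>2" by (simp add: power2_eq_square algebra_simps)
  qed (use iv in auto)
  finally show ?thesis using Ev by linarith
qed

lemma integral_independent:
  fixes f g :: "('p \<Rightarrow> real) \<Rightarrow> real"
  assumes I: "I \<subseteq> J"
    and f[measurable]: "f \<in> borel_measurable (PiM J (\<lambda>_. borel))" and g[measurable]: "g \<in> borel_measurable (PiM J (\<lambda>_. borel))"
    and fI: "\<And>\<theta> \<theta>'. (\<And>p. p \<in> I \<Longrightarrow> \<theta> p = \<theta>' p) \<Longrightarrow> f \<theta> = f \<theta>'"
    and gI: "\<And>\<theta> \<theta>'. (\<And>p. p \<in> J - I \<Longrightarrow> \<theta> p = \<theta>' p) \<Longrightarrow> g \<theta> = g \<theta>'"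
    and nn: "\<And>\<theta>. 0 \<le> f \<theta>" "\<And>\<theta>. 0 \<le> g \<theta>"
  shows "(\<integral>\<theta>. f \<theta> * g \<theta> \<partial>gauss J) = (\<integral>\<theta>. f \<theta> \<partial>gauss J) * (\<integral>\<theta>. g \<theta> \<partial>gauss J)"
proof -
  have "(\<integral>\<^sup>+\<theta>. ennreal (f \<theta>) * ennreal (g \<theta>) \<partial>gauss J)
     = (\<integral>\<^sup>+\<theta>. ennreal (f \<theta>) \<partial>gauss J) * (\<integral>\<^sup>+\<theta>. ennreal (g \<theta>) \<partial>gauss J)"
  proof (rule gauss_independent[OF finite_J I])
    show "ennreal (f \<theta>) = ennreal (f \<theta>')" if "\<And>p. p \<in> I \<Longrightarrow> \<theta> p = \<theta>' p" for \<theta> \<theta>'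
      using fI[OF that] by simp
    show "ennreal (g \<theta>) = ennreal (g \<theta>')" if "\<And>p. p \<in> J - I \<Longrightarrow> \<theta> p = \<theta>' p" for \<theta> \<theta>'
      using gI[OF that] by simp
  qed measurable
  then show ?thesis
    using nn by (simp add: integral_eq_nn_integral enn2real_mult[symmetric] ennreal_mult)
qed

lemma rest_cong: "(\<And>p. p \<in> J - pos b \<Longrightarrow> \<theta> p = \<theta>' p) \<Longrightarrow> rest b \<theta> = rest b \<theta>'"
  unfolding rest_def by (intro prod.cong refl arg_cong[where f="\<lambda>x. x\<^sup>2"] cutoff_cong) (auto simp: pos_def)

text \<open>The blocks are independent, so a cutoff factor can be restored at the price of its mean.\<close>

lemma rest_mean_le: assumes b: "b \<in> Bs"
  shows "(\<integral>\<theta>. rest b \<theta> \<partial>gauss J) \<le> 4 * (\<integral>\<theta>. weight \<theta> \<partial>gauss J)"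
proof -
  have "(\<integral>\<theta>. weight \<theta> \<partial>gauss J) = (\<integral>\<theta>. (cutoff b \<theta>)\<^sup>2 \<partial>gauss J) * (\<integral>\<theta>. rest b \<theta> \<partial>gauss J)"
    unfolding weight_split[OF b]
  proof (rule integral_independent[OF pos_sub[of b] _ rest_measurable _ rest_cong])
    show "(cutoff b \<theta>)\<^sup>2 = (cutoff b \<theta>')\<^sup>2" if "\<And>p. p \<in> pos b \<Longrightarrow> \<theta> p = \<theta>' p" for \<theta> \<theta>'
      using cutoff_cong[OF that] by simp
  qed (measurable, simp_all add: rest_bounds)
  moreover have "1 / 4 * (\<integral>\<theta>. rest b \<theta> \<partial>gauss J) \<le> (\<integral>\<theta>. (cutoff b \<theta>)\<^sup>2 \<partial>gauss J) * (\<integral>\<theta>. rest b \<theta> \<partial>gauss J)"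
    by (intro mult_right_mono cutoff_sq_mean b Bochner_Integration.integral_nonneg rest_bounds)
  ultimately show ?thesis by linarith
qed

lemma weight_mean_pos: "0 < (\<integral>\<theta>. weight \<theta> \<partial>gauss J)"
proof -
  have "0 < (\<integral>\<theta>. (\<Prod>b\<in>B. (cutoff b \<theta>)\<^sup>2) \<partial>gauss J)" if "B \<subseteq> Bs" for B
    using finite_subset[OF that finite_Bs] that
  proof (induction B)
    case empty
    then show ?case using prob_space.prob_space[OF prob_space_gauss, of J] by simp
  next
    case (insert b B)
    have "(\<integral>\<theta>. (\<Prod>b\<in>insert b B. (cutoff b \<theta>)\<^sup>2) \<partial>gauss J) = (\<integral>\<theta>. (cutoff b \<theta>)\<^sup>2 * (\<Prod>b\<in>B. (cutoff b \<theta>)\<^sup>2) \<partial>gauss J)"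
      using insert by simp
    also have "\<dots> = (\<integral>\<theta>. (cutoff b \<theta>)\<^sup>2 \<partial>gauss J) * (\<integral>\<theta>. (\<Prod>b\<in>B. (cutoff b \<theta>)\<^sup>2) \<partial>gauss J)"
    proof (rule integral_independent[OF pos_sub[of b]])
      fix \<theta> \<theta>' :: "'p \<Rightarrow> real"
      show "(cutoff b \<theta>)\<^sup>2 = (cutoff b \<theta>')\<^sup>2" if "\<And>p. p \<in> pos b \<Longrightarrow> \<theta> p = \<theta>' p"
        using cutoff_cong[OF that] by simp
      show "(\<Prod>b\<in>B. (cutoff b \<theta>)\<^sup>2) = (\<Prod>b\<in>B. (cutoff b \<theta>')\<^sup>2)" if "\<And>p. p \<in> J - pos b \<Longrightarrow> \<theta> p = \<theta>' p"
        using insert(2) that by (intro prod.cong refl arg_cong[where f="\<lambda>x. x\<^sup>2"] cutoff_cong) (auto simp: pos_def)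
    qed (measurable, simp_all add: prod_nonneg)
    also have "\<dots> > 0"
    proof (rule mult_pos_pos)
      show "0 < (\<integral>\<theta>. (cutoff b \<theta>)\<^sup>2 \<partial>gauss J)" using cutoff_sq_mean[of b] insert by force
    qed (use insert in auto)
    finally show ?case .
  qed
  from this[of Bs] show ?thesis by (simp add: weight_def[abs_def])
qed

lemma integrable_weight_q_sq: "p \<in> J \<Longrightarrow> integrable (gauss J) (\<lambda>\<theta>. weight \<theta> * (q p \<theta>)\<^sup>2)"
  by (rule integrable_bounded_gauss[where C="4 * \<kappa>"]) (use weight_q_sq_le weight_bounds in auto)

lemma integrable_rest: "integrable (gauss J) (rest b)"
  by (rule integrable_bounded_gauss[where C=1]) (use rest_bounds in auto)

lemma sum_by_block: "(\<Sum>p\<in>J. f p) = (\<Sum>b\<in>Bs. \<Sum>p\<in>pos b. (f p :: real))"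
  using sum.group[OF finite_J finite_Bs blk, of f] by (simp add: pos_def)

lemma fisher_information_le:
  "(\<Sum>p\<in>J. \<integral>\<theta>. weight \<theta> * (q p \<theta>)\<^sup>2 \<partial>gauss J) \<le> 16 * \<kappa> * card Bs * (\<integral>\<theta>. weight \<theta> \<partial>gauss J)"
proof -
  have "(\<Sum>p\<in>pos b. \<integral>\<theta>. weight \<theta> * (q p \<theta>)\<^sup>2 \<partial>gauss J) \<le> 16 * \<kappa> * (\<integral>\<theta>. weight \<theta> \<partial>gauss J)" if b: "b \<in> Bs" for b
  proof -
    have "(\<Sum>p\<in>pos b. \<integral>\<theta>. weight \<theta> * (q p \<theta>)\<^sup>2 \<partial>gauss J) = (\<integral>\<theta>. (\<Sum>p\<in>pos b. weight \<theta> * (q p \<theta>)\<^sup>2) \<partial>gauss J)"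
      using pos_sub by (intro Bochner_Integration.integral_sum[symmetric] integrable_weight_q_sq) auto
    also have "\<dots> \<le> (\<integral>\<theta>. 4 * \<kappa> * rest b \<theta> \<partial>gauss J)"
      using pos_sub
      by (intro integral_mono Bochner_Integration.integrable_sum integrable_weight_q_sq integrable_mult_right
          integrable_rest weight_q_sq_sum b) auto
    also have "\<dots> = 4 * \<kappa> * (\<integral>\<theta>. rest b \<theta> \<partial>gauss J)" by simp
    also have "\<dots> \<le> 4 * \<kappa> * (4 * (\<integral>\<theta>. weight \<theta> \<partial>gauss J))"
      using \<kappa>0 by (intro mult_left_mono rest_mean_le b) auto
    finally show ?thesis by simp
  qed
  then have "(\<Sum>p\<in>J. \<integral>\<theta>. weight \<theta> * (q p \<theta>)\<^sup>2 \<partial>gauss J) \<le> (\<Sum>b\<in>Bs. 16 * \<kappa> * (\<integral>\<theta>. weight \<theta> \<partial>gauss J))"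
    unfolding sum_by_block by (rule sum_mono)
  then show ?thesis by (simp add: mult_ac)
qed

lemma second_moment_le:
  "(\<Sum>p\<in>J. \<integral>\<theta>. weight \<theta> * (\<theta> p)\<^sup>2 \<partial>gauss J) \<le> 4 * card J * (\<integral>\<theta>. weight \<theta> \<partial>gauss J)"
proof -
  have "(\<integral>\<theta>. weight \<theta> * (\<theta> p)\<^sup>2 \<partial>gauss J) \<le> 4 * (\<integral>\<theta>. weight \<theta> \<partial>gauss J)" if p: "p \<in> J" for p
  proof -
    define b where "b = blk p"
    have b: "b \<in> Bs" using p blk by (auto simp: b_def)
    have i2: "integrable (gauss J) (\<lambda>\<theta>. (\<theta> p)\<^sup>2)" "(\<integral>\<theta>. (\<theta> p)\<^sup>2 \<partial>gauss J) = 1"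
      using gauss_integrable_coord2[OF finite_J p p] gauss_cov[OF finite_J p p] by (auto simp: power2_eq_square)
    have m: "(\<lambda>\<theta>. (\<theta> p)\<^sup>2) \<in> borel_measurable (PiM J (\<lambda>_. borel :: real measure))" using p by measurable
    have ir: "integrable (gauss J) (\<lambda>\<theta>. (\<theta> p)\<^sup>2 * rest b \<theta>)"
      by (rule Bochner_Integration.integrable_bound[OF i2(1)])
         (use m rest_bounds[of b] in \<open>auto simp: abs_mult mult_left_le\<close>)
    have "(\<integral>\<theta>. weight \<theta> * (\<theta> p)\<^sup>2 \<partial>gauss J) \<le> (\<integral>\<theta>. (\<theta> p)\<^sup>2 * rest b \<theta> \<partial>gauss J)"
    proof (rule integral_mono[OF _ ir])
      show "integrable (gauss J) (\<lambda>\<theta>. weight \<theta> * (\<theta> p)\<^sup>2)"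
        by (rule Bochner_Integration.integrable_bound[OF i2(1)])
           (use m weight_bounds in \<open>auto simp: abs_mult mult_left_le_one_le\<close>)
      show "weight \<theta> * (\<theta> p)\<^sup>2 \<le> (\<theta> p)\<^sup>2 * rest b \<theta>" for \<theta>
      proof -
        have "weight \<theta> \<le> 1 * rest b \<theta>" unfolding weight_split[OF b]
          by (intro mult_right_mono cutoff_sq_bounds rest_bounds)
        from mult_right_mono[OF this, of "(\<theta> p)\<^sup>2"] show ?thesis by (simp add: mult.commute)
      qed
    qed
    also have "\<dots> = (\<integral>\<theta>. (\<theta> p)\<^sup>2 \<partial>gauss J) * (\<integral>\<theta>. rest b \<theta> \<partial>gauss J)"
    proof (rule integral_independent[OF pos_sub[of b] m rest_measurable _ rest_cong])
      show "(\<theta> p)\<^sup>2 = (\<theta>' p)\<^sup>2" if "\<And>p. p \<in> pos b \<Longrightarrow> \<theta> p = \<theta>' p" for \<theta> \<theta>' :: "'p \<Rightarrow> real"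
        using that[of p] p by (simp add: pos_def b_def)
    qed (simp_all add: rest_bounds)
    also have "\<dots> \<le> 4 * (\<integral>\<theta>. weight \<theta> \<partial>gauss J)" using rest_mean_le[OF b] by (simp add: i2)
    finally show ?thesis .
  qed
  then have "(\<Sum>p\<in>J. \<integral>\<theta>. weight \<theta> * (\<theta> p)\<^sup>2 \<partial>gauss J) \<le> (\<Sum>p\<in>J. 4 * (\<integral>\<theta>. weight \<theta> \<partial>gauss J))"
    by (rule sum_mono)
  then show ?thesis by simp
qed

end

section \<open>Operator norms controlled by a lattice net\<close>

text \<open>The box makes the set finite by construction; for integer vectors it is implied by the bound on the sum of squares.\<close>

definition lattice_net :: "nat \<Rightarrow> (nat \<Rightarrow> int) set" where
  "lattice_net k = {x \<in> {..<k} \<rightarrow>\<^sub>E {- 3 * int k..3 * int k}. (\<Sum>a<k. (x a)\<^sup>2) \<le> 9 * int k}"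

lemma finite_lattice_net: "finite (lattice_net k)"
  unfolding lattice_net_def by (intro finite_subset[OF _ finite_PiE[of "{..<k}" "\<lambda>_. {- 3 * int k..3 * int k}"]]) auto

lemma sum_half_power_sq_le: "(\<Sum>x\<in>{- int m..int m}. (1 / 2 :: real) ^ nat (x\<^sup>2)) \<le> 3"
proof -
  have "(\<Sum>x\<in>{- int m..int m}. (1 / 2 :: real) ^ nat (x\<^sup>2)) \<le> 3 - 2 * (1 / 2) ^ m"
  proof (induction m)
    case (Suc m)
    have eq: "{- int (Suc m)..int (Suc m)} = insert (int (Suc m)) (insert (- int (Suc m)) {- int m..int m})" by auto
    have "Suc m \<le> (Suc m)\<^sup>2" by (simp add: power2_eq_square)
    then have le: "(1 / 2 :: real) ^ ((Suc m)\<^sup>2) \<le> (1 / 2) ^ Suc m" by (intro power_decreasing) auto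
    have sq: "nat ((int (Suc m))\<^sup>2) = (Suc m)\<^sup>2" "nat ((- int (Suc m))\<^sup>2) = (Suc m)\<^sup>2"
      unfolding power2_minus of_nat_power[symmetric] by (rule nat_int)+
    have "(\<Sum>x\<in>{- int (Suc m)..int (Suc m)}. (1 / 2 :: real) ^ nat (x\<^sup>2))
       = (1 / 2) ^ ((Suc m)\<^sup>2) + ((1 / 2) ^ ((Suc m)\<^sup>2) + (\<Sum>x\<in>{- int m..int m}. (1 / 2 :: real) ^ nat (x\<^sup>2)))"
      unfolding eq by (subst sum.insert, simp, force, subst sum.insert, simp, force, simp only: sq)
    also have "\<dots> \<le> (1 / 2) ^ Suc m + ((1 / 2) ^ Suc m + (3 - 2 * (1 / 2) ^ m))"
      by (intro add_mono le Suc.IH)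
    also have "\<dots> = 3 - 2 * (1 / 2) ^ Suc m" by simp
    finally show ?case .
  qed simp
  also have "\<dots> \<le> 3" by simp
  finally show ?thesis .
qed

text \<open>Weight each integer vector by \<open>2\<close> to the power of minus its squared length: every element of the net has weight at least \<open>2 ^ (-9k)\<close>,
while the total weight of a box factorises into \<open>k\<close> sums, each at most 3. Note \<open>1536 = 3 * 2 ^ 9\<close>.\<close>

lemma card_lattice_net: "real (card (lattice_net k)) \<le> 1536 ^ k"
proof -
  define I where "I = {- int (3 * k)..int (3 * k)}"
  define w :: "int \<Rightarrow> real" where "w t = (1 / 2) ^ nat (t\<^sup>2)" for t
  have w0: "0 \<le> w t" for t by (simp add: w_def)
  have "real (card (lattice_net k)) * (1 / 2) ^ (9 * k) = (\<Sum>x\<in>lattice_net k. (1 / 2) ^ (9 * k))" by simp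
  also have "\<dots> \<le> (\<Sum>x\<in>lattice_net k. \<Prod>a<k. w (x a))"
  proof (rule sum_mono)
    fix x assume x: "x \<in> lattice_net k"
    have "int (\<Sum>a<k. nat ((x a)\<^sup>2)) = (\<Sum>a<k. (x a)\<^sup>2)" by simp
    also have "\<dots> \<le> int (9 * k)" using x by (simp add: lattice_net_def)
    finally have "(\<Sum>a<k. nat ((x a)\<^sup>2)) \<le> 9 * k" by linarith
    then have "(1 / 2 :: real) ^ (9 * k) \<le> (1 / 2) ^ (\<Sum>a<k. nat ((x a)\<^sup>2))" by (intro power_decreasing) auto
    then show "(1 / 2 :: real) ^ (9 * k) \<le> (\<Prod>a<k. w (x a))" by (simp only: w_def power_sum)
  qed
  also have "\<dots> \<le> (\<Sum>x\<in>{..<k} \<rightarrow>\<^sub>E I. \<Prod>a<k. w (x a))"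
  proof (rule sum_mono2)
    show "finite ({..<k} \<rightarrow>\<^sub>E I)" by (intro finite_PiE) (auto simp: I_def)
    show "lattice_net k \<subseteq> {..<k} \<rightarrow>\<^sub>E I" by (auto simp: lattice_net_def I_def)
  qed (rule prod_nonneg, rule w0)
  also have "\<dots> = (\<Prod>a<k. \<Sum>t\<in>I. w t)"
    using prod_sum_PiE[of "{..<k}" "\<lambda>_. I" "\<lambda>_ t. w t"] by (simp add: I_def)
  also have "\<dots> = (\<Sum>t\<in>I. w t) ^ k" by (simp only: prod_constant card_lessThan)
  also have "\<dots> \<le> 3 ^ k"
    unfolding I_def w_def by (intro power_mono sum_half_power_sq_le sum_nonneg) simp
  finally have "real (card (lattice_net k)) * (1 / 2) ^ (9 * k) \<le> 3 ^ k" .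
  then have "real (card (lattice_net k)) \<le> 3 ^ k * 2 ^ (9 * k)"
  proof -
    assume le: "real (card (lattice_net k)) * (1 / 2) ^ (9 * k) \<le> 3 ^ k"
    have "(1 / 2 :: real) ^ (9 * k) * 2 ^ (9 * k) = 1" unfolding power_mult_distrib[symmetric] by simp
    moreover have "real (card (lattice_net k)) * (1 / 2) ^ (9 * k) * 2 ^ (9 * k) \<le> 3 ^ k * 2 ^ (9 * k)"
      using le by (rule mult_right_mono) simp
    ultimately show ?thesis by (simp only: mult.assoc mult_1_right)
  qed
  also have "\<dots> = (3 * 2 ^ 9) ^ k" unfolding power_mult power_mult_distrib ..
  also have "\<dots> = 1536 ^ k" by simp
  finally show ?thesis .
qed

definition bilin :: "nat \<Rightarrow> (nat \<Rightarrow> nat \<Rightarrow> real) \<Rightarrow> (nat \<Rightarrow> real) \<Rightarrow> (nat \<Rightarrow> real) \<Rightarrow> real" where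
  "bilin k A u w = (\<Sum>a<k. \<Sum>c<k. A a c * u a * w c)"

lemma bilin_add_left: "bilin k A (\<lambda>a. u a + u' a) w = bilin k A u w + bilin k A u' w"
  by (simp add: bilin_def algebra_simps sum.distrib)
lemma bilin_add_right: "bilin k A u (\<lambda>a. w a + w' a) = bilin k A u w + bilin k A u w'"
  by (simp add: bilin_def algebra_simps sum.distrib)
lemma bilin_scale: "bilin k A (\<lambda>a. s * u a) (\<lambda>a. t * w a) = s * t * bilin k A u w"
  by (simp add: bilin_def sum_distrib_left mult_ac)

text \<open>Rounding \<open>2 \<surd>k u\<close> coordinatewise moves each of the \<open>k\<close> coordinates by at most 1/2.\<close>

lemma round_to_lattice_net:
  fixes u :: "nat \<Rightarrow> real"
  assumes u: "(\<Sum>a<k. (u a)\<^sup>2) \<le> 1"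
  obtains x where "x \<in> lattice_net k" "(\<Sum>a<k. (real_of_int (x a))\<^sup>2) \<le> 25 / 4 * k"
    "(\<Sum>a<k. (2 * sqrt k * u a - real_of_int (x a))\<^sup>2) \<le> k / 4"
proof
  \<comment> \<open>The restriction makes \<open>x\<close> extensional, as membership in the net requires.\<close>
  define x where "x = (\<lambda>a\<in>{..<k}. round (2 * sqrt k * u a))"
  define e where "e a = 2 * sqrt k * u a - real_of_int (x a)" for a
  have e: "\<bar>e a\<bar> \<le> 1 / 2" if "a < k" for a
    using of_int_round_abs_le[of "2 * sqrt k * u a"] that by (simp add: e_def x_def abs_minus_commute)
  have e2: "(e a)\<^sup>2 \<le> 1 / 4" if "a < k" for a
    using abs_le_square_iff[of "e a" "1/2"] e[OF that] by (simp add: power2_eq_square)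
  have "(\<Sum>a<k. (e a)\<^sup>2) \<le> (\<Sum>a<k. 1 / 4)" using e2 by (intro sum_mono) auto
  then have se: "(\<Sum>a<k. (e a)\<^sup>2) \<le> k / 4" by simp
  then show "(\<Sum>a<k. (2 * sqrt k * u a - real_of_int (x a))\<^sup>2) \<le> k / 4" by (simp add: e_def)
  have "(\<Sum>a<k. (real_of_int (x a))\<^sup>2) \<le> (\<Sum>a<k. 5 * k * (u a)\<^sup>2 + 5 * (e a)\<^sup>2)"
  proof (rule sum_mono)
    fix a
    have *: "real_of_int (x a) = 2 * sqrt k * u a - e a" by (simp add: e_def)
    have "0 \<le> (sqrt k * u a + 2 * e a)\<^sup>2" by simp
    moreover have "(2 * sqrt k * u a - e a)\<^sup>2 + (sqrt k * u a + 2 * e a)\<^sup>2 = 5 * (sqrt k)\<^sup>2 * (u a)\<^sup>2 + 5 * (e a)\<^sup>2"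
      by (simp only: power2_eq_square) (simp add: algebra_simps)
    moreover have "(sqrt k)\<^sup>2 = real k" by simp
    ultimately show "(real_of_int (x a))\<^sup>2 \<le> 5 * k * (u a)\<^sup>2 + 5 * (e a)\<^sup>2"
      unfolding * by (simp only:)
  qed
  also have "\<dots> = 5 * k * (\<Sum>a<k. (u a)\<^sup>2) + 5 * (\<Sum>a<k. (e a)\<^sup>2)" by (simp add: sum.distrib sum_distrib_left)
  also have "\<dots> \<le> 5 * k * 1 + 5 * (k / 4)"
    using mult_left_mono[OF u, of "5 * real k"] se by simp
  finally show x2: "(\<Sum>a<k. (real_of_int (x a))\<^sup>2) \<le> 25 / 4 * k" by simp
  have "real_of_int (\<Sum>a<k. (x a)\<^sup>2) \<le> real_of_int (9 * int k)" using x2 by simp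
  then have x9: "(\<Sum>a<k. (x a)\<^sup>2) \<le> 9 * int k" by (simp only: of_int_le_iff)
  have "\<bar>x a\<bar> \<le> 3 * int k" if a: "a < k" for a
  proof -
    have "(x a)\<^sup>2 \<le> (\<Sum>a<k. (x a)\<^sup>2)" using a by (intro member_le_sum) auto
    also have "\<dots> \<le> 9 * int k" by (rule x9)
    also have "\<dots> \<le> (3 * int k)\<^sup>2" using a by (simp add: power2_eq_square)
    finally have "\<bar>x a\<bar> \<le> \<bar>3 * int k\<bar>" by (simp only: abs_le_square_iff)
    then show ?thesis by simp
  qed
  then have "x a \<in> {- 3 * int k..3 * int k}" if "a < k" for a
    using that unfolding atLeastAtMost_iff by (smt (verit))
  moreover have "x \<in> extensional {..<k}" by (simp add: x_def)
  ultimately show "x \<in> lattice_net k" unfolding lattice_net_def using x9 by (auto simp: PiE_def)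
qed

text \<open>Let \<open>\<sigma>\<close> be the operator norm of \<open>A\<close>. Rounding unit vectors scaled by \<open>2 \<surd>k\<close> to net vectors gives
\<open>4 k \<sigma> \<le> B + (9/4) k \<sigma>\<close>, since \<open>5/2 * 1/2 + 1/2 * 2 = 9/4\<close>, and the last term can be absorbed.\<close>

lemma bilin_le_of_lattice_net:
  assumes k: "k \<ge> 1" and B: "\<And>x y. x \<in> lattice_net k \<Longrightarrow> y \<in> lattice_net k \<Longrightarrow> bilin k A (\<lambda>a. of_int (x a)) (\<lambda>a. of_int (y a)) \<le> B"
  shows "bilin k A u w \<le> B / (7 / 4 * k) * (L2_set u {..<k} * L2_set w {..<k})"
proof -
  define S where "S = {bilin k A u w | u w. (\<Sum>a<k. (u a)\<^sup>2) \<le> 1 \<and> (\<Sum>a<k. (w a)\<^sup>2) \<le> 1}"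
  have bdd: "bdd_above S"
  proof (rule bdd_aboveI)
    fix s assume "s \<in> S"
    then obtain u w where s: "s = bilin k A u w" and u: "(\<Sum>a<k. (u a)\<^sup>2) \<le> 1" and w: "(\<Sum>a<k. (w a)\<^sup>2) \<le> 1"
      by (auto simp: S_def)
    have one: "\<bar>f a\<bar> \<le> 1" if "(\<Sum>a<k. (f a)\<^sup>2) \<le> 1" "a < k" for f :: "nat \<Rightarrow> real" and a
    proof -
      have "(f a)\<^sup>2 \<le> (\<Sum>a<k. (f a)\<^sup>2)" using that by (intro member_le_sum) auto
      then have "(f a)\<^sup>2 \<le> 1\<^sup>2" using that by simp
      then show ?thesis using abs_le_square_iff[of "f a" 1] by simp
    qed
    have "bilin k A u w \<le> (\<Sum>a<k. \<Sum>c<k. \<bar>A a c\<bar>)"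
      unfolding bilin_def
    proof (intro sum_mono)
      fix a c assume "a \<in> {..<k}" "c \<in> {..<k}"
      then have "\<bar>A a c\<bar> * (\<bar>u a\<bar> * \<bar>w c\<bar>) \<le> \<bar>A a c\<bar> * (1 * 1)"
        using one[OF u] one[OF w] by (intro mult_left_mono mult_mono) auto
      moreover have "A a c * u a * w c \<le> \<bar>A a c * u a * w c\<bar>" by (rule abs_ge_self)
      ultimately show "A a c * u a * w c \<le> \<bar>A a c\<bar>" by (simp add: abs_mult mult_ac)
    qed
    then show "s \<le> (\<Sum>a<k. \<Sum>c<k. \<bar>A a c\<bar>)" by (simp add: s)
  qed
  define \<sigma> where "\<sigma> = Sup S"
  have 0: "0 \<in> S" unfolding S_def by (auto intro!: exI[of _ "\<lambda>_. 0"] simp: bilin_def)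
  have \<sigma>0: "0 \<le> \<sigma>" unfolding \<sigma>_def by (rule cSup_upper[OF 0 bdd])
  have gen: "bilin k A u w \<le> \<sigma> * (L2_set u {..<k} * L2_set w {..<k})" for u w
  proof (cases "L2_set u {..<k} = 0 \<or> L2_set w {..<k} = 0")
    case True
    then have "(\<forall>a<k. u a = 0) \<or> (\<forall>a<k. w a = 0)" by (auto simp: L2_set_eq_0_iff)
    then have "bilin k A u w = 0" unfolding bilin_def by (auto intro!: sum.neutral)
    then show ?thesis using True by auto
  next
    case False
    define s t where "s = L2_set u {..<k}" and "t = L2_set w {..<k}"
    have st: "s > 0" "t > 0" using False by (auto simp: s_def t_def less_le)
    have n: "(\<Sum>a<k. (1 / L2_set f {..<k} * f a)\<^sup>2) \<le> 1" if "L2_set f {..<k} \<noteq> 0" for f :: "nat \<Rightarrow> real"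
    proof -
      have "(\<Sum>a<k. (1 / L2_set f {..<k} * f a)\<^sup>2) = (\<Sum>a<k. (f a)\<^sup>2) / (L2_set f {..<k})\<^sup>2"
        by (simp add: power_divide sum_divide_distrib)
      also have "(L2_set f {..<k})\<^sup>2 = (\<Sum>a<k. (f a)\<^sup>2)"
        unfolding L2_set_def by (intro real_sqrt_pow2 sum_nonneg) auto
      finally show ?thesis by simp
    qed
    have "bilin k A (\<lambda>a. 1 / s * u a) (\<lambda>a. 1 / t * w a) \<in> S"
      unfolding S_def s_def t_def using n[of u] n[of w] False by blast
    then have "bilin k A (\<lambda>a. 1 / s * u a) (\<lambda>a. 1 / t * w a) \<le> \<sigma>"
      unfolding \<sigma>_def by (rule cSup_upper[OF _ bdd])
    then show ?thesis unfolding bilin_scale s_def[symmetric] t_def[symmetric] using st by (simp add: field_simps)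
  qed
  have "\<sigma> \<le> (B + 9 / 4 * k * \<sigma>) / (4 * k)"
    unfolding \<sigma>_def
  proof (rule cSup_least)
    show "S \<noteq> {}" using 0 by auto
    fix s assume "s \<in> S"
    then obtain u w where s: "s = bilin k A u w" and u: "(\<Sum>a<k. (u a)\<^sup>2) \<le> 1" and w: "(\<Sum>a<k. (w a)\<^sup>2) \<le> 1"
      by (auto simp: S_def)
    from round_to_lattice_net[OF u] obtain x where x: "x \<in> lattice_net k"
      "(\<Sum>a<k. (real_of_int (x a))\<^sup>2) \<le> 25 / 4 * k" "(\<Sum>a<k. (2 * sqrt k * u a - real_of_int (x a))\<^sup>2) \<le> k / 4" by blast
    from round_to_lattice_net[OF w] obtain y where y: "y \<in> lattice_net k"
      "(\<Sum>a<k. (real_of_int (y a))\<^sup>2) \<le> 25 / 4 * k" "(\<Sum>a<k. (2 * sqrt k * w a - real_of_int (y a))\<^sup>2) \<le> k / 4" by blast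
    have L: "L2_set f {..<k} \<le> r * sqrt k" if "(\<Sum>a<k. (f a)\<^sup>2) \<le> r\<^sup>2 * k" "r \<ge> 0" for f :: "nat \<Rightarrow> real" and r :: real
    proof -
      have "L2_set f {..<k} \<le> sqrt (r\<^sup>2 * k)" unfolding L2_set_def using that by simp
      then show ?thesis using that by (simp add: real_sqrt_mult)
    qed
    define xr yr ex fy where "xr a = real_of_int (x a)" and "yr a = real_of_int (y a)"
      and "ex a = 2 * sqrt k * u a - real_of_int (x a)" and "fy a = 2 * sqrt k * w a - real_of_int (y a)" for a
    have Lx: "L2_set xr {..<k} \<le> 5 / 2 * sqrt k"
      by (rule L) (use x in \<open>simp_all add: xr_def power_divide\<close>)
    have Le: "L2_set ex {..<k} \<le> 1 / 2 * sqrt k"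
      by (rule L) (use x in \<open>simp_all add: ex_def power_divide\<close>)
    have Lf: "L2_set fy {..<k} \<le> 1 / 2 * sqrt k"
      by (rule L) (use y in \<open>simp_all add: fy_def power_divide\<close>)
    have Lw: "L2_set (\<lambda>a. 2 * sqrt k * w a) {..<k} \<le> 2 * sqrt k"
      using w by (intro L) (auto simp: power_mult_distrib sum_distrib_left[symmetric] mult_left_le)
    have kk: "sqrt k * sqrt k = k" by simp
    have "4 * k * bilin k A u w = bilin k A (\<lambda>a. 2 * sqrt k * u a) (\<lambda>a. 2 * sqrt k * w a)"
      unfolding bilin_scale by simp
    also have "\<dots> = bilin k A (\<lambda>a. xr a + ex a) (\<lambda>a. 2 * sqrt k * w a)"
      by (simp add: xr_def ex_def)
    also have "\<dots> = bilin k A xr (\<lambda>a. yr a + fy a) + bilin k A ex (\<lambda>a. 2 * sqrt k * w a)"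
      unfolding bilin_add_left by (simp add: yr_def fy_def)
    also have "\<dots> = bilin k A xr yr + bilin k A xr fy + bilin k A ex (\<lambda>a. 2 * sqrt k * w a)"
      unfolding bilin_add_right ..
    also have "\<dots> \<le> B + \<sigma> * (5 / 2 * sqrt k * (1 / 2 * sqrt k)) + \<sigma> * (1 / 2 * sqrt k * (2 * sqrt k))"
    proof (intro add_mono)
      show "bilin k A xr yr \<le> B" unfolding xr_def yr_def by (rule B[OF x(1) y(1)])
      show "bilin k A xr fy \<le> \<sigma> * (5 / 2 * sqrt k * (1 / 2 * sqrt k))"
        by (rule order_trans[OF gen]) (intro mult_left_mono mult_mono Lx Lf \<sigma>0 L2_set_nonneg, simp)
      show "bilin k A ex (\<lambda>a. 2 * sqrt k * w a) \<le> \<sigma> * (1 / 2 * sqrt k * (2 * sqrt k))"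
        by (rule order_trans[OF gen]) (intro mult_left_mono mult_mono Le Lw \<sigma>0 L2_set_nonneg, simp)
    qed
    also have "\<dots> = B + 9 / 4 * k * \<sigma>" using kk by (simp add: algebra_simps)
    finally show "s \<le> (B + 9 / 4 * k * Sup S) / (4 * k)" using k by (simp add: s \<sigma>_def field_simps)
  qed
  then have "7 / 4 * k * \<sigma> \<le> B" using k by (simp add: field_simps)
  then have "\<sigma> \<le> B / (7 / 4 * k)" using k by (simp add: field_simps)
  then have "\<sigma> * (L2_set u {..<k} * L2_set w {..<k}) \<le> B / (7 / 4 * k) * (L2_set u {..<k} * L2_set w {..<k})"
    by (intro mult_right_mono mult_nonneg_nonneg L2_set_nonneg)
  then show ?thesis using gen[of u w] by linarith
qed

text \<open>Entry \<open>(a, c)\<close> of block \<open>b\<close> links the coordinate \<open>a\<close> of the second half to the coordinate \<open>c\<close> of the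
first half of the \<open>b\<close>-th interval of length \<open>2k\<close>.\<close>

definition half_blocks :: "nat \<Rightarrow> nat \<Rightarrow> (nat \<times> nat) set" where
  "half_blocks d k = (\<lambda>(b, a, c). (2 * k * b + k + a, 2 * k * b + c)) ` ({..<d div (2 * k)} \<times> {..<k} \<times> {..<k})"

lemma half_blocks_index:
  fixes a b c k :: nat
  assumes "a < k" "c < k"
  shows "(2 * k * b + k + a) div (2 * k) = b" "(2 * k * b + k + a) mod (2 * k) = k + a"
    "(2 * k * b + c) div (2 * k) = b" "(2 * k * b + c) mod (2 * k) = c"
proof -
  have "(2 * k * b + r) div (2 * k) = b" "(2 * k * b + r) mod (2 * k) = r" if "r < 2 * k" for r
    using that by (auto simp: div_mult_self2)
  from this[of "k + a"] this[of c] assms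
  show "(2 * k * b + k + a) div (2 * k) = b" "(2 * k * b + k + a) mod (2 * k) = k + a"
    "(2 * k * b + c) div (2 * k) = b" "(2 * k * b + c) mod (2 * k) = c" by (simp_all add: add.assoc)
qed

lemma half_blocks_lt:
  fixes a b k d :: nat
  assumes "b < d div (2 * k)" "r < 2 * k"
  shows "2 * k * b + r < d"
proof -
  have "2 * k * b + r < 2 * k * (b + 1)" using assms by simp
  also have "\<dots> \<le> 2 * k * (d div (2 * k))" using assms by (intro mult_le_mono2) simp
  also have "\<dots> \<le> d" by simp
  finally show ?thesis .
qed

lemma half_blocks_inj: "inj_on (\<lambda>(b, a, c). (2 * k * b + k + a, 2 * k * b + c)) ({..<m} \<times> {..<k} \<times> {..<k :: nat})"
proof (rule inj_onI)
  fix p p' :: "nat \<times> nat \<times> nat"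
  assume p: "p \<in> {..<m} \<times> {..<k} \<times> {..<k}" and p': "p' \<in> {..<m} \<times> {..<k} \<times> {..<k}"
    and eq: "(\<lambda>(b, a, c). (2 * k * b + k + a, 2 * k * b + c)) p = (\<lambda>(b, a, c). (2 * k * b + k + a, 2 * k * b + c)) p'"
  obtain b a c b' a' c' where pp: "p = (b, a, c)" "p' = (b', a', c')" by (cases p, cases p')
  have *: "a < k" "c < k" "a' < k" "c' < k" using p p' by (auto simp: pp)
  have e: "2 * k * b + k + a = 2 * k * b' + k + a'" "2 * k * b + c = 2 * k * b' + c'" using eq by (auto simp: pp)
  have "b = b'" using half_blocks_index(3)[OF *(1,2), of b] half_blocks_index(3)[OF *(3,4), of b'] e by simp
  then show "p = p'" using e by (simp add: pp)
qed

lemma card_half_blocks: "card (half_blocks d k) = d div (2 * k) * k\<^sup>2"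
  unfolding half_blocks_def by (subst card_image[OF half_blocks_inj]) (simp add: power2_eq_square)

lemma half_blocks_model: "shear_model d (half_blocks d k)"
proof
  show "half_blocks d k \<subseteq> {..<d} \<times> {..<d}"
  proof
    fix p assume "p \<in> half_blocks d k"
    then obtain b a c where p: "p = (2 * k * b + k + a, 2 * k * b + c)" "b < d div (2 * k)" "a < k" "c < k"
      by (auto simp: half_blocks_def)
    then show "p \<in> {..<d} \<times> {..<d}"
      using half_blocks_lt[OF p(2), of "k + a"] half_blocks_lt[OF p(2), of c] by (simp add: add.assoc)
  qed
  show "fst ` half_blocks d k \<inter> snd ` half_blocks d k = {}"
  proof (rule equals0I)
    fix i assume "i \<in> fst ` half_blocks d k \<inter> snd ` half_blocks d k"
    then obtain p p' where p: "p \<in> half_blocks d k" "i = fst p" and p': "p' \<in> half_blocks d k" "i = snd p'" by auto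
    from p obtain b a c where 1: "i = 2 * k * b + k + a" "a < k" "c < k" by (auto simp: half_blocks_def)
    from p' obtain b' a' c' where 2: "i = 2 * k * b' + c'" "a' < k" "c' < k" by (auto simp: half_blocks_def)
    from 1 2 have "k + a = c'" using half_blocks_index(2)[of a k c b] half_blocks_index(4)[of a' k c' b'] by simp
    then show False using 2 by simp
  qed
qed

text \<open>For a pair of net vectors this is the coefficient of an entry in \<open>x\<^sup>T \<Theta> y / \<surd>k\<close>; the scaling keeps the variance of the form, at most
\<open>81 k\<close>, comparable to the logarithm of the number of forms.\<close>

definition net_form :: "nat \<Rightarrow> (nat \<Rightarrow> int) \<times> (nat \<Rightarrow> int) \<Rightarrow> nat \<times> nat \<Rightarrow> real" where
  "net_form k = (\<lambda>(x, y) (i, j). 1 / sqrt k * (of_int (x (i mod (2 * k) - k)) * of_int (y (j mod (2 * k)))))"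

lemma pos_half_blocks:
  assumes "b < d div (2 * k)"
  shows "{p \<in> half_blocks d k. fst p div (2 * k) = b} = (\<lambda>(a, c). (2 * k * b + k + a, 2 * k * b + c)) ` ({..<k} \<times> {..<k})"
  using assms half_blocks_index by (auto simp: half_blocks_def image_iff)

lemma sum_pos_half_blocks:
  assumes "b < d div (2 * k)"
  shows "(\<Sum>p | p \<in> half_blocks d k \<and> fst p div (2 * k) = b. f p) = (\<Sum>a<k. \<Sum>c<k. f (2 * k * b + k + a, 2 * k * b + c) :: real)"
proof -
  have "inj_on (\<lambda>(a, c). (2 * k * b + k + a, 2 * k * b + c)) ({..<k} \<times> {..<k})"
    by (auto simp: inj_on_def)
  then have "(\<Sum>p | p \<in> half_blocks d k \<and> fst p div (2 * k) = b. f p)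
      = (\<Sum>(a, c)\<in>{..<k} \<times> {..<k}. f (2 * k * b + k + a, 2 * k * b + c))"
    unfolding pos_half_blocks[OF assms] by (subst sum.reindex) (auto simp: split_def)
  then show ?thesis by (simp add: sum.cartesian_product)
qed

text \<open>There are at most \<open>(1536\<^sup>2) ^ k\<close> forms and each exponential has mean at most \<open>exp (81 k / 2)\<close>; the factor \<open>exp (23 k)\<close>
that remains of \<open>exp (64 k)\<close> beats \<open>2 * (1536\<^sup>2) ^ k\<close>.\<close>

lemma block_prior:
  assumes k: "k \<ge> 1"
  shows "soft_prior (half_blocks d k) (\<lambda>p. fst p div (2 * k)) {..<d div (2 * k)} (lattice_net k \<times> lattice_net k)
     (net_form k) (real (81 * k)) (exp (real (64 * k)))"
proof
  interpret shear_model d "half_blocks d k" by (rule half_blocks_model)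
  show "finite (half_blocks d k)" by simp
  show "finite (lattice_net k \<times> lattice_net k)" by (simp add: finite_lattice_net)
  show "(\<lambda>p. fst p div (2 * k)) ` half_blocks d k \<subseteq> {..<d div (2 * k)}"
    using half_blocks_index by (auto simp: half_blocks_def)
  fix b u assume b: "b \<in> {..<d div (2 * k)}" and u: "u \<in> lattice_net k \<times> lattice_net k"
  obtain x y where xy: "u = (x, y)" "x \<in> lattice_net k" "y \<in> lattice_net k" using u by auto
  have n: "(\<Sum>a<k. (real_of_int (x a))\<^sup>2) \<le> 9 * real k" if "x \<in> lattice_net k" for x
  proof -
    have "real_of_int (\<Sum>a<k. (x a)\<^sup>2) \<le> real_of_int (9 * int k)"
      using that unfolding of_int_le_iff by (simp add: lattice_net_def)
    then show ?thesis by simp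
  qed
  have "(\<Sum>p | p \<in> half_blocks d k \<and> fst p div (2 * k) = b. (net_form k u p)\<^sup>2)
     = (\<Sum>a<k. \<Sum>c<k. 1 / k * ((real_of_int (x a))\<^sup>2 * (real_of_int (y c))\<^sup>2))"
    using b half_blocks_index
    by (subst sum_pos_half_blocks) (auto simp: xy net_form_def power_mult_distrib power_divide intro!: sum.cong)
  also have "\<dots> = 1 / k * ((\<Sum>a<k. (real_of_int (x a))\<^sup>2) * (\<Sum>c<k. (real_of_int (y c))\<^sup>2))"
    unfolding sum_product unfolding sum_distrib_left ..
  also have "\<dots> \<le> 1 / k * ((9 * real k) * (9 * real k))"
    by (rule mult_left_mono[OF mult_mono[OF n[OF xy(2)] n[OF xy(3)]]]) (auto intro!: sum_nonneg)
  also have "\<dots> = 81 * k" using k by simp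
  finally show "(\<Sum>p | p \<in> half_blocks d k \<and> fst p div (2 * k) = b. (net_form k u p)\<^sup>2) \<le> real (81 * k)" by simp
next
  have "2 * (real (card (lattice_net k \<times> lattice_net k)) * exp (real (81 * k) / 2))
     \<le> 2 * ((1536 ^ k * 1536 ^ k) * exp (real (81 * k) / 2))"
    unfolding card_cartesian_product of_nat_mult
    by (intro mult_left_mono mult_right_mono mult_mono card_lattice_net) auto
  also have "\<dots> = (2 * 2359296 ^ k) * exp (real (81 * k) / 2)" by (simp add: power_mult_distrib[symmetric])
  also have "\<dots> \<le> (2 ^ k * 2359296 ^ k) * exp (real (81 * k) / 2)"
    using power_increasing[of 1 k "2::real"] k by (intro mult_right_mono) auto
  also have "\<dots> = 4718592 ^ k * exp (real (81 * k) / 2)" by (simp add: power_mult_distrib[symmetric])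
  also have "\<dots> \<le> exp (23 * k) * exp (real (81 * k) / 2)"
  proof (intro mult_right_mono)
    have "(2::real) ^ 23 \<le> exp 1 ^ 23" using exp_ge_add_one_self[of 1] by (intro power_mono) auto
    then have "(4718592::real) \<le> exp 23" by (simp add: exp_of_nat_mult[symmetric])
    then have "(4718592::real) ^ k \<le> exp 23 ^ k" by (intro power_mono) auto
    then show "(4718592::real) ^ k \<le> exp (23 * k)" by (simp add: exp_of_nat2_mult)
  qed auto
  also have "\<dots> \<le> exp (64 * k)" by (simp add: exp_add[symmetric])
  finally show "real (card (lattice_net k \<times> lattice_net k)) * exp (real (81 * k) / 2) \<le> exp (real (64 * k)) / 2"
    by simp
qed auto

text \<open>Inside the cutoff each exponential is below \<open>exp (64 k)\<close>, so every form in net vectors is at most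
\<open>64 k \<surd>k\<close>.\<close>

lemma block_prior_bilin_le:
  assumes k: "k \<ge> 1" and b: "b < d div (2 * k)"
    and F: "soft_prior.F (half_blocks d k) (\<lambda>p. fst p div (2 * k)) (lattice_net k \<times> lattice_net k) (net_form k) b \<theta> < exp (real (64 * k))"
  shows "bilin k (\<lambda>a c. \<theta> (2 * k * b + k + a, 2 * k * b + c)) u w \<le> 40 * sqrt k * (L2_set u {..<k} * L2_set w {..<k})"
proof -
  interpret soft_prior "half_blocks d k" "\<lambda>p. fst p div (2 * k)" "{..<d div (2 * k)}" "lattice_net k \<times> lattice_net k"
     "net_form k" "real (81 * k)" "exp (real (64 * k))" by (rule block_prior[OF k])
  define A where "A a c = \<theta> (2 * k * b + k + a, 2 * k * b + c)" for a c
  have "bilin k A (\<lambda>a. of_int (x a)) (\<lambda>a. of_int (y a)) \<le> sqrt k * (64 * k)"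
    if x: "x \<in> lattice_net k" and y: "y \<in> lattice_net k" for x y
  proof -
    have "ex (x, y) b \<theta> \<le> F b \<theta>"
      unfolding F_def using x y ex_pos by (intro member_le_sum) (auto simp: less_imp_le)
    also have "\<dots> < exp (real (64 * k))" by fact
    finally have "(\<Sum>p\<in>pos b. net_form k (x, y) p * \<theta> p) < real (64 * k)" unfolding ex_def by simp
    also have "(\<Sum>p\<in>pos b. net_form k (x, y) p * \<theta> p) = (\<Sum>a<k. \<Sum>c<k. 1 / sqrt k * (A a c * of_int (x a) * of_int (y c)))"
      unfolding pos_def using b half_blocks_index
      by (subst sum_pos_half_blocks) (auto simp: net_form_def A_def intro!: sum.cong)
    also have "\<dots> = 1 / sqrt k * bilin k A (\<lambda>a. of_int (x a)) (\<lambda>a. of_int (y a))"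
      by (simp add: bilin_def sum_distrib_left)
    finally show ?thesis using k by (simp add: field_simps)
  qed
  from bilin_le_of_lattice_net[OF k this]
  have "bilin k A u w \<le> sqrt k * (64 * k) / (7 / 4 * k) * (L2_set u {..<k} * L2_set w {..<k})" .
  also have "\<dots> \<le> 40 * sqrt k * (L2_set u {..<k} * L2_set w {..<k})"
    using k by (intro mult_right_mono mult_nonneg_nonneg L2_set_nonneg) (simp add: field_simps)
  finally show ?thesis unfolding A_def .
qed

section \<open>Covariance and tails of the sheared Gaussian\<close>

lemma scalar_prod_sum: "w \<in> carrier_vec d \<Longrightarrow> v \<bullet> w = (\<Sum>i<d. v $ i * w $ i)"
  by (simp add: scalar_prod_def atLeast0LessThan)

text \<open>Test the bilinear form with \<open>u = A v\<close>.\<close>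

lemma spectral_norm_leI:
  fixes A :: "real mat"
  assumes A: "A \<in> carrier_mat m n" and c: "0 \<le> c"
    and bil: "\<And>u v. u \<in> carrier_vec m \<Longrightarrow> v \<in> carrier_vec n \<Longrightarrow> u \<bullet> (A *\<^sub>v v) \<le> c * (sqrt (u \<bullet> u) * sqrt (v \<bullet> v))"
  shows "spectral_norm A \<le> c"
  unfolding spectral_norm_def
proof (rule cSUP_least)
  show "{v :: real vec. v \<in> carrier_vec (dim_col A) \<and> v \<bullet> v \<le> 1} \<noteq> {}"
    by (auto intro!: exI[of _ "0\<^sub>v (dim_col A)"])
  fix v :: "real vec" assume "v \<in> {v \<in> carrier_vec (dim_col A). v \<bullet> v \<le> 1}"
  then have v: "v \<in> carrier_vec n" "v \<bullet> v \<le> 1" using A by auto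
  define y where "y = A *\<^sub>v v"
  have y: "y \<in> carrier_vec m" using A v(1) by (auto simp: y_def)
  have yy: "0 \<le> y \<bullet> y" unfolding scalar_prod_sum[OF y] by (intro sum_nonneg) auto
  have "y \<bullet> y \<le> c * (sqrt (y \<bullet> y) * sqrt (v \<bullet> v))" using bil[OF y v(1)] by (simp add: y_def)
  also have "\<dots> \<le> c * (sqrt (y \<bullet> y) * 1)" using c v yy by (intro mult_left_mono) auto
  finally have le: "sqrt (y \<bullet> y) * sqrt (y \<bullet> y) \<le> c * sqrt (y \<bullet> y)" using yy by simp
  have "sqrt (y \<bullet> y) \<le> c"
  proof (cases "y \<bullet> y = 0")
    case False
    then have "0 < sqrt (y \<bullet> y)" using yy by simp
    with le show ?thesis by (rule mult_right_le_imp_le)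
  qed (simp add: c)
  then show "sqrt ((A *\<^sub>v v) \<bullet> (A *\<^sub>v v)) \<le> c"
    unfolding y_def[symmetric] .
qed

context shear_model
begin

definition shift_transpose :: "(nat \<times> nat \<Rightarrow> real) \<Rightarrow> (nat \<Rightarrow> real) \<Rightarrow> nat \<Rightarrow> real" where
  "shift_transpose B v l = (\<Sum>i | (i, l) \<in> J. B (i, l) * v i)"

definition bform :: "(nat \<times> nat \<Rightarrow> real) \<Rightarrow> (nat \<Rightarrow> real) \<Rightarrow> (nat \<Rightarrow> real) \<Rightarrow> real" where
  "bform B u w = (\<Sum>(i, l)\<in>J. B (i, l) * u i * w l)"

lemma finite_J_col [simp]: "finite {i. (i, l) \<in> J}"
  using J_sub by (auto intro!: finite_subset[of _ "{..<d}"])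

lemma bform_shift_transpose: "bform B u w = (\<Sum>l<d. shift_transpose B u l * w l)"
proof -
  have "bform B u w = (\<Sum>(l, i)\<in>prod.swap ` J. B (i, l) * u i * w l)"
    unfolding bform_def by (subst sum.reindex) (auto simp: split_def)
  also have "prod.swap ` J = (SIGMA l:{..<d}. {i. (i, l) \<in> J})" using J_sub by (force simp: image_iff)
  also have "(\<Sum>(l, i)\<in>(SIGMA l:{..<d}. {i. (i, l) \<in> J}). B (i, l) * u i * w l) = (\<Sum>l<d. shift_transpose B u l * w l)"
    by (subst sum.Sigma[symmetric]) (auto simp: shift_transpose_def sum_distrib_right)
  finally show ?thesis .
qed

lemma bform_shift: "bform B u w = (\<Sum>i<d. u i * shift B w i)"
proof -
  have "J = (SIGMA i:{..<d}. {l. (i, l) \<in> J})" using J_sub by auto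
  then have "bform B u w = (\<Sum>(i, l)\<in>(SIGMA i:{..<d}. {l. (i, l) \<in> J}). B (i, l) * u i * w l)"
    unfolding bform_def by simp
  also have "\<dots> = (\<Sum>i<d. u i * shift B w i)"
    by (subst sum.Sigma[symmetric]) (auto simp: shift_def sum_distrib_left mult_ac)
  finally show ?thesis .
qed

lemma sum_sheared: "(\<Sum>i<d. v i * shear B g i) = (\<Sum>l<d. (v l + shift_transpose B v l) * g l)"
proof -
  have "(\<Sum>i<d. v i * shear B g i) = (\<Sum>i<d. v i * g i) + bform B v g"
    by (simp add: bform_shift shear_def algebra_simps sum.distrib)
  then show ?thesis by (simp add: bform_shift_transpose algebra_simps sum.distrib)
qed

definition bounded_shear :: "real \<Rightarrow> (nat \<times> nat \<Rightarrow> real) \<Rightarrow> bool" where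
  "bounded_shear \<eta> B \<longleftrightarrow> (\<forall>u w. bform B u w \<le> \<eta> * (L2_set u {..<d} * L2_set w {..<d}))"

lemma L2_set_sq: "(L2_set u A)\<^sup>2 = (\<Sum>i\<in>A. (u i)\<^sup>2)"
  unfolding L2_set_def by (intro real_sqrt_pow2 sum_nonneg) auto

lemma L2_set_shift_transpose_le:
  assumes "bounded_shear \<eta> B" "0 \<le> \<eta>"
  shows "L2_set (shift_transpose B u) {..<d} \<le> \<eta> * L2_set u {..<d}"
proof -
  define n where "n = L2_set (shift_transpose B u) {..<d}"
  have "n\<^sup>2 = bform B u (shift_transpose B u)" unfolding n_def L2_set_sq bform_shift_transpose by (simp add: power2_eq_square)
  also have "\<dots> \<le> \<eta> * (L2_set u {..<d} * n)" using assms by (simp add: bounded_shear_def n_def)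
  finally have "n * n \<le> (\<eta> * L2_set u {..<d}) * n" by (simp add: power2_eq_square mult_ac)
  moreover have "0 \<le> n" by (simp add: n_def)
  ultimately show ?thesis unfolding n_def[symmetric] using assms(2)
    by (cases "n = 0") (auto simp: mult_le_cancel_right)
qed

lemma L2_set_row_le:
  assumes "bounded_shear \<eta> B" "0 \<le> \<eta>" "\<eta> \<le> 1"
  shows "L2_set (\<lambda>l. v l + shift_transpose B v l) {..<d} \<le> 2 * L2_set v {..<d}"
proof -
  have "L2_set (\<lambda>l. v l + shift_transpose B v l) {..<d} \<le> L2_set v {..<d} + L2_set (shift_transpose B v) {..<d}"
    by (rule L2_set_triangle_ineq)
  also have "\<dots> \<le> L2_set v {..<d} + 1 * L2_set v {..<d}"
    by (intro add_left_mono order_trans[OF L2_set_shift_transpose_le[OF assms(1,2)]] mult_right_mono assms) auto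
  finally show ?thesis by simp
qed

definition sample_law :: "real \<Rightarrow> (nat \<times> nat \<Rightarrow> real) \<Rightarrow> (nat \<Rightarrow> real) measure" where
  "sample_law s B = distr (gauss {..<d}) (point_space d) (\<lambda>g. \<lambda>i\<in>{..<d}. s * shear B g i)"

lemma shear_coord_measurable: "i < d \<Longrightarrow> (\<lambda>g. shear B g i) \<in> borel_measurable (PiM {..<d} (\<lambda>_. borel))"
  by (rule measurable_compose[OF shear_measurable measurable_component_singleton]) simp

lemma scaled_shear_measurable [measurable]:
  "(\<lambda>g. \<lambda>i\<in>{..<d}. s * shear B g i) \<in> gauss {..<d} \<rightarrow>\<^sub>M point_space d"
proof -
  have "(\<lambda>g. \<lambda>i\<in>{..<d}. s * shear B g i) \<in> PiM {..<d} (\<lambda>_. borel) \<rightarrow>\<^sub>M PiM {..<d} (\<lambda>_. borel)"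
    by (intro measurable_restrict borel_measurable_times borel_measurable_const shear_coord_measurable) auto
  then show ?thesis unfolding point_space_def by (simp cong: measurable_cong_sets)
qed

lemma sample_law_prob: "sample_law s B \<in> space (prob_algebra (point_space d))"
  unfolding sample_law_def space_prob_algebra
  by (auto intro!: prob_space.prob_space_distr prob_space_gauss)

definition shear_coeff :: "(nat \<times> nat \<Rightarrow> real) \<Rightarrow> nat \<Rightarrow> nat \<Rightarrow> real" where
  "shear_coeff B i l = (if l = i then 1 else 0) + (if (i, l) \<in> J then B (i, l) else 0)"

lemma shear_eq_sum_coeff: "i < d \<Longrightarrow> shear B g i = (\<Sum>l<d. shear_coeff B i l * g l)"
proof -
  assume i: "i < d"
  have "(\<Sum>l<d. (if (i, l) \<in> J then B (i, l) else 0) * g l) = (\<Sum>l\<in>{l \<in> {..<d}. (i, l) \<in> J}. B (i, l) * g l)"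
    by (subst sum.inter_filter) (auto intro!: sum.cong)
  also have "{l \<in> {..<d}. (i, l) \<in> J} = {l. (i, l) \<in> J}" using J_sub by auto
  finally have "(\<Sum>l<d. (if (i, l) \<in> J then B (i, l) else 0) * g l) = shift B g i" by (simp add: shift_def)
  moreover have "(\<Sum>l<d. (if l = i then 1 else 0) * g l) = g i"
    using i by (simp add: if_distrib[of "\<lambda>x. x * _"] cong: if_cong)
  ultimately show ?thesis using i by (simp add: shear_def shear_coeff_def distrib_right sum.distrib)
qed

lemma sample_law_mean: "mean_vec d (sample_law s B) = 0\<^sub>v d"
proof (rule eq_vecI)
  fix i assume "i < dim_vec (0\<^sub>v d)"
  then have i: "i < d" by simp
  have "(\<integral>x. x i \<partial>sample_law s B) = (\<integral>g. s * shear B g i \<partial>gauss {..<d})"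
  proof -
    have "(\<lambda>x. x i) \<in> borel_measurable (point_space d)"
      unfolding point_space_def using i by (intro measurable_component_singleton) simp
    from integral_distr[OF scaled_shear_measurable this] show ?thesis
      using i by (simp add: sample_law_def)
  qed
  also have "\<dots> = s * (\<integral>g. (\<Sum>l<d. shear_coeff B i l * g l) \<partial>gauss {..<d})" by (simp add: shear_eq_sum_coeff[OF i])
  also have "(\<integral>g. (\<Sum>l<d. shear_coeff B i l * g l) \<partial>gauss {..<d}) = (\<Sum>l<d. \<integral>g. shear_coeff B i l * g l \<partial>gauss {..<d})"
    by (intro Bochner_Integration.integral_sum integrable_mult_right gauss_integrable_coord) auto
  also have "\<dots> = 0" by (simp add: gauss_mean)
  finally show "mean_vec d (sample_law s B) $ i = 0\<^sub>v d $ i" using i by (simp add: mean_vec_def)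
qed (simp add: mean_vec_def)

lemma sample_law_cov:
  assumes i: "i < d" and j: "j < d"
  shows "cov_mat d (sample_law s B) $$ (i, j) = s\<^sup>2 * (\<Sum>l<d. shear_coeff B i l * shear_coeff B j l)"
proof -
  have m: "(\<lambda>x. x i * x j) \<in> borel_measurable (point_space d)"
    using i j unfolding point_space_def by (intro borel_measurable_times measurable_component_singleton) auto
  have "cov_mat d (sample_law s B) $$ (i, j) = (\<integral>x. x i * x j \<partial>sample_law s B)"
    using i j by (simp add: cov_mat_def sample_law_mean)
  also have "\<dots> = (\<integral>g. s\<^sup>2 * (shear B g i * shear B g j) \<partial>gauss {..<d})"
    using integral_distr[OF scaled_shear_measurable m, of s B] i j
    by (simp add: sample_law_def power2_eq_square mult_ac)
  also have "\<dots> = s\<^sup>2 * (\<integral>g. (\<Sum>l<d. \<Sum>l'<d. shear_coeff B i l * shear_coeff B j l' * (g l * g l')) \<partial>gauss {..<d})"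
    using i j by (simp add: shear_eq_sum_coeff sum_product mult_ac)
  also have "(\<integral>g. (\<Sum>l<d. \<Sum>l'<d. shear_coeff B i l * shear_coeff B j l' * (g l * g l')) \<partial>gauss {..<d})
     = (\<Sum>l<d. \<integral>g. (\<Sum>l'<d. shear_coeff B i l * shear_coeff B j l' * (g l * g l')) \<partial>gauss {..<d})"
    by (intro Bochner_Integration.integral_sum Bochner_Integration.integrable_sum integrable_mult_right gauss_integrable_coord2) auto
  also have "\<dots> = (\<Sum>l<d. \<Sum>l'<d. \<integral>g. shear_coeff B i l * shear_coeff B j l' * (g l * g l') \<partial>gauss {..<d})"
    by (intro sum.cong refl Bochner_Integration.integral_sum integrable_mult_right gauss_integrable_coord2) auto
  also have "\<dots> = (\<Sum>l<d. \<Sum>l'<d. if l = l' then shear_coeff B i l * shear_coeff B j l' else 0)"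
    by (intro sum.cong refl) (auto simp: gauss_cov)
  also have "\<dots> = (\<Sum>l<d. shear_coeff B i l * shear_coeff B j l)" by simp
  finally show ?thesis .
qed

lemma sum_shear_coeff: "l < d \<Longrightarrow> (\<Sum>i<d. v i * shear_coeff B i l) = v l + shift_transpose B v l"
proof -
  assume l: "l < d"
  have "(\<Sum>i<d. v i * (if (i, l) \<in> J then B (i, l) else 0)) = (\<Sum>i\<in>{i \<in> {..<d}. (i, l) \<in> J}. B (i, l) * v i)"
    by (subst sum.inter_filter) (auto intro!: sum.cong)
  also have "{i \<in> {..<d}. (i, l) \<in> J} = {i. (i, l) \<in> J}" using J_sub by auto
  finally have "(\<Sum>i<d. v i * (if (i, l) \<in> J then B (i, l) else 0)) = shift_transpose B v l" by (simp add: shift_transpose_def)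
  moreover have "(\<Sum>i<d. v i * (if l = i then 1 else 0)) = v l"
    using l by (simp add: if_distrib[of "\<lambda>x. _ * x"] cong: if_cong)
  ultimately show ?thesis by (simp add: shear_coeff_def distrib_left sum.distrib)
qed

lemma cov_bilinear:
  "(\<Sum>i<d. \<Sum>j<d. u i * cov_mat d (sample_law s B) $$ (i, j) * w j)
     = s\<^sup>2 * (\<Sum>l<d. (u l + shift_transpose B u l) * (w l + shift_transpose B w l))"
proof -
  have "(\<Sum>i<d. \<Sum>j<d. u i * cov_mat d (sample_law s B) $$ (i, j) * w j)
    = (\<Sum>i<d. \<Sum>j<d. \<Sum>l<d. s\<^sup>2 * ((u i * shear_coeff B i l) * (w j * shear_coeff B j l)))"
    by (intro sum.cong refl) (simp add: sample_law_cov sum_distrib_left sum_distrib_right mult_ac)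
  also have "\<dots> = (\<Sum>i<d. \<Sum>l<d. \<Sum>j<d. s\<^sup>2 * ((u i * shear_coeff B i l) * (w j * shear_coeff B j l)))"
    by (intro sum.cong refl sum.swap)
  also have "\<dots> = (\<Sum>l<d. \<Sum>i<d. \<Sum>j<d. s\<^sup>2 * ((u i * shear_coeff B i l) * (w j * shear_coeff B j l)))"
    by (rule sum.swap)
  also have "\<dots> = (\<Sum>l<d. s\<^sup>2 * ((\<Sum>i<d. u i * shear_coeff B i l) * (\<Sum>j<d. w j * shear_coeff B j l)))"
    unfolding sum_product unfolding sum_distrib_left ..
  also have "\<dots> = s\<^sup>2 * (\<Sum>l<d. (u l + shift_transpose B u l) * (w l + shift_transpose B w l))"
    by (simp add: sum_shear_coeff sum_distrib_left)
  finally show ?thesis .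
qed

text \<open>A linear form of a sheared Gaussian is a linear form of a standard Gaussian with coefficient vector
\<open>v + B\<^sup>T v\<close>, of length at most 2 for a unit vector \<open>v\<close>.\<close>

lemma sample_law_psi2:
  assumes B: "bounded_shear \<eta> B" "0 \<le> \<eta>" "\<eta> \<le> 1" and K: "K > 0" and s: "32 * s\<^sup>2 \<le> 3 * K\<^sup>2"
  shows "psi2_norm_vec d (sample_law s B) (\<lambda>x. vec d x - mean_vec d (sample_law s B)) \<le> ennreal K"
  unfolding psi2_norm_vec_def
proof (rule SUP_least)
  fix v :: "real vec" assume "v \<in> {v \<in> carrier_vec d. v \<bullet> v = 1}"
  then have v: "v \<in> carrier_vec d" "v \<bullet> v = 1" by auto
  define t where "t l = v $ l + shift_transpose B (\<lambda>i. v $ i) l" for l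
  have v1: "L2_set (\<lambda>i. v $ i) {..<d} = 1"
    using v by (simp add: L2_set_def scalar_prod_sum power2_eq_square)
  have t2: "(\<Sum>l<d. (t l)\<^sup>2) \<le> 4"
  proof -
    have "L2_set t {..<d} \<le> 2 * 1" unfolding t_def using L2_set_row_le[OF B, of "\<lambda>i. v $ i"] v1 by simp
    then have "(L2_set t {..<d})\<^sup>2 \<le> 2\<^sup>2" by (intro power_mono) auto
    then show ?thesis unfolding L2_set_sq by simp
  qed
  have eq: "(vec d x - mean_vec d (sample_law s B)) \<bullet> v = (\<Sum>i<d. v $ i * x i)" for x
    using v by (simp add: sample_law_mean scalar_prod_sum mult.commute)
  have m: "(\<lambda>x. ennreal (exp ((\<Sum>i<d. v $ i * x i)\<^sup>2 / K\<^sup>2))) \<in> borel_measurable (point_space d)"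
    unfolding point_space_def by measurable
  have "(\<integral>\<^sup>+x. ennreal (exp (((vec d x - mean_vec d (sample_law s B)) \<bullet> v)\<^sup>2 / K\<^sup>2)) \<partial>sample_law s B)
     = (\<integral>\<^sup>+g. ennreal (exp ((\<Sum>i<d. v $ i * (s * shear B g i))\<^sup>2 / K\<^sup>2)) \<partial>gauss {..<d})"
    unfolding eq unfolding sample_law_def by (subst nn_integral_distr) (use m in auto)
  also have "\<dots> = (\<integral>\<^sup>+g. ennreal (exp ((s\<^sup>2 / K\<^sup>2) * (\<Sum>l<d. t l * g l)\<^sup>2)) \<partial>gauss {..<d})"
  proof (intro nn_integral_cong arg_cong[where f=ennreal] arg_cong[where f=exp])
    fix g
    have "(\<Sum>i<d. v $ i * (s * shear B g i)) = s * (\<Sum>i<d. v $ i * shear B g i)"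
      by (simp add: sum_distrib_left mult_ac)
    also have "\<dots> = s * (\<Sum>l<d. t l * g l)" using sum_sheared[of "\<lambda>i. v $ i" B g] by (simp add: t_def)
    finally show "(\<Sum>i<d. v $ i * (s * shear B g i))\<^sup>2 / K\<^sup>2 = (s\<^sup>2 / K\<^sup>2) * (\<Sum>l<d. t l * g l)\<^sup>2"
      by (simp add: power_mult_distrib)
  qed
  also have "\<dots> \<le> 2"
  proof (rule gauss_exp_square)
    have "2 * (s\<^sup>2 / K\<^sup>2) * (\<Sum>l<d. (t l)\<^sup>2) \<le> 2 * (s\<^sup>2 / K\<^sup>2) * 4"
      using t2 by (intro mult_left_mono) auto
    also have "\<dots> \<le> 3 / 4" using s K by (simp add: field_simps)
    finally show "2 * (s\<^sup>2 / K\<^sup>2) * (\<Sum>l<d. (t l)\<^sup>2) \<le> 3 / 4" .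
  qed auto
  finally show "psi2_norm (sample_law s B) (\<lambda>x. (vec d x - mean_vec d (sample_law s B)) \<bullet> v) \<le> ennreal K"
    unfolding psi2_norm_def using K by (intro INF_lower) auto
qed

lemma L2_set_inner_le: "(\<Sum>l\<in>A. f l * g l) \<le> L2_set f A * L2_set g A"
  using L2_set_mult_ineq[of f g A] sum_mono[of A "\<lambda>l. f l * g l" "\<lambda>l. \<bar>f l\<bar> * \<bar>g l\<bar>"]
  by (force simp: abs_mult[symmetric])

lemma L2_set_vec: "v \<in> carrier_vec d \<Longrightarrow> L2_set (\<lambda>i. v $ i) {..<d} = sqrt (v \<bullet> v)"
  by (simp add: L2_set_def scalar_prod_sum power2_eq_square)

lemma mat_form: "u \<in> carrier_vec d \<Longrightarrow> w \<in> carrier_vec d \<Longrightarrow> A \<in> carrier_mat d d \<Longrightarrow>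
   u \<bullet> (A *\<^sub>v w) = (\<Sum>i<d. \<Sum>j<d. u $ i * A $$ (i, j) * w $ j)"
  by (subst scalar_prod_sum[of _ d])
     (auto simp: mult_mat_vec_def scalar_prod_sum sum_distrib_left mult.assoc intro!: sum.cong)

text \<open>An off-diagonal block avoids the diagonal, so only \<open>B\<close>, \<open>B\<^sup>T\<close> and \<open>B B\<^sup>T\<close> contribute to it, each with norm at
most \<open>\<eta>\<close>. Beyond the band width \<open>w\<close> the covariance vanishes.\<close>

lemma sample_law_separated:
  assumes B: "bounded_shear \<eta> B" "0 \<le> \<eta>" "\<eta> \<le> 1" and M0: "4 * s\<^sup>2 \<le> M\<^sub>0"
    and band: "\<And>i l. (i, l) \<in> J \<Longrightarrow> i div w = l div w" and w: "w \<ge> 1"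
    and M: "M > 0" "3 * s\<^sup>2 * \<eta> \<le> M * real w powr (- \<alpha>)" and \<alpha>: "\<alpha> > 0"
  shows "cov_mat d (sample_law s B) \<in> separated_block_class d \<alpha> M\<^sub>0 M"
proof -
  define \<Sigma> where "\<Sigma> = cov_mat d (sample_law s B)"
  have \<Sigma>: "\<Sigma> \<in> carrier_mat d d" by (simp add: \<Sigma>_def cov_mat_def)
  have sym: "\<Sigma> $$ (i, j) = \<Sigma> $$ (j, i)" if "i < d" "j < d" for i j
    using that by (simp add: \<Sigma>_def sample_law_cov mult.commute)
  have "transpose_mat \<Sigma> = \<Sigma>" using \<Sigma> sym by (intro eq_matI) auto
  moreover have "0 \<le> v \<bullet> (\<Sigma> *\<^sub>v v) \<and> v \<bullet> (\<Sigma> *\<^sub>v v) \<le> M\<^sub>0 * (v \<bullet> v)" if v: "v \<in> carrier_vec d" for v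
  proof
    define t where "t l = v $ l + shift_transpose B (\<lambda>i. v $ i) l" for l
    have eq: "v \<bullet> (\<Sigma> *\<^sub>v v) = s\<^sup>2 * (L2_set t {..<d})\<^sup>2"
      using cov_bilinear[of "\<lambda>i. v $ i" s B "\<lambda>i. v $ i"]
      unfolding mat_form[OF v v \<Sigma>] unfolding \<Sigma>_def L2_set_sq by (simp add: t_def power2_eq_square)
    show "0 \<le> v \<bullet> (\<Sigma> *\<^sub>v v)" unfolding eq by simp
    have "L2_set t {..<d} \<le> 2 * sqrt (v \<bullet> v)"
      unfolding t_def L2_set_vec[OF v, symmetric] by (rule L2_set_row_le[OF B])
    then have "(L2_set t {..<d})\<^sup>2 \<le> (2 * sqrt (v \<bullet> v))\<^sup>2" by (intro power_mono) auto
    also have vv: "0 \<le> v \<bullet> v" unfolding scalar_prod_sum[OF v] by (intro sum_nonneg) auto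
    then have "(2 * sqrt (v \<bullet> v))\<^sup>2 = 4 * (v \<bullet> v)" by (simp add: power_mult_distrib)
    finally have "s\<^sup>2 * (L2_set t {..<d})\<^sup>2 \<le> s\<^sup>2 * (4 * (v \<bullet> v))" by (intro mult_left_mono) auto
    also have "\<dots> \<le> M\<^sub>0 * (v \<bullet> v)" using mult_right_mono[OF M0 vv] by (simp add: mult_ac)
    finally show "v \<bullet> (\<Sigma> *\<^sub>v v) \<le> M\<^sub>0 * (v \<bullet> v)" unfolding eq .
  qed
  moreover have "spectral_norm (restrict_entries \<Sigma> R) \<le> M * real k powr (- \<alpha>)"
    if k: "k \<ge> 1" and R: "is_block d R" "off_diagonal k R" for k R
  proof -
    obtain I I' where I: "I \<subseteq> {..<d}" "I' \<subseteq> {..<d}" "R = I \<times> I'" using R(1) by (auto simp: is_block_def)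
    have disj: "i \<notin> I'" if "i \<in> I" for i
      using R(2) that k I(3) by (force simp: off_diagonal_def)
    have D: "restrict_entries \<Sigma> R \<in> carrier_mat d d" using \<Sigma> by (auto simp: restrict_entries_def)
    have Dij: "restrict_entries \<Sigma> R $$ (i, j) = (if (i, j) \<in> R then \<Sigma> $$ (i, j) else 0)" if "i < d" "j < d" for i j
      using that \<Sigma> by (simp add: restrict_entries_def)
    show ?thesis
    proof (cases "k < w")
      case True
      have "spectral_norm (restrict_entries \<Sigma> R) \<le> 3 * s\<^sup>2 * \<eta>"
      proof (rule spectral_norm_leI[OF D])
        show "0 \<le> 3 * s\<^sup>2 * \<eta>" using B by simp
        fix u v :: "real vec" assume u: "u \<in> carrier_vec d" and v: "v \<in> carrier_vec d"
        define u' where "u' i = (if i \<in> I then u $ i else 0)" for i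
        define v' where "v' i = (if i \<in> I' then v $ i else 0)" for i
        have u': "L2_set u' {..<d} \<le> sqrt (u \<bullet> u)" and v': "L2_set v' {..<d} \<le> sqrt (v \<bullet> v)"
          unfolding L2_set_vec[OF u, symmetric] L2_set_vec[OF v, symmetric] L2_set_def
          by (auto intro!: real_sqrt_le_mono sum_mono simp: u'_def v'_def)
        have "(\<Sum>l<d. (u' l + shift_transpose B u' l) * (v' l + shift_transpose B v' l))
            = (\<Sum>l<d. u' l * v' l) + (\<Sum>l<d. u' l * shift_transpose B v' l) + (\<Sum>l<d. shift_transpose B u' l * v' l) + (\<Sum>l<d. shift_transpose B u' l * shift_transpose B v' l)"
          by (simp add: algebra_simps sum.distrib)
        also have "\<dots> \<le> 0 + \<eta> * (sqrt (u \<bullet> u) * sqrt (v \<bullet> v)) + \<eta> * (sqrt (u \<bullet> u) * sqrt (v \<bullet> v)) + \<eta> * (sqrt (u \<bullet> u) * sqrt (v \<bullet> v))"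
        proof (intro add_mono)
          show "(\<Sum>l<d. u' l * v' l) \<le> 0" using disj by (intro sum_nonpos) (auto simp: u'_def v'_def)
          note au = order_trans[OF L2_set_shift_transpose_le[OF B(1,2)] mult_left_mono[OF u' B(2)]]
          note av = order_trans[OF L2_set_shift_transpose_le[OF B(1,2)] mult_left_mono[OF v' B(2)]]
          have "(\<Sum>l<d. u' l * shift_transpose B v' l) \<le> sqrt (u \<bullet> u) * (\<eta> * sqrt (v \<bullet> v))"
            by (rule order_trans[OF L2_set_inner_le]) (intro mult_mono u' av L2_set_nonneg order_trans[OF L2_set_nonneg u'])
          then show "(\<Sum>l<d. u' l * shift_transpose B v' l) \<le> \<eta> * (sqrt (u \<bullet> u) * sqrt (v \<bullet> v))" by (simp add: mult_ac)
          have "(\<Sum>l<d. shift_transpose B u' l * v' l) \<le> (\<eta> * sqrt (u \<bullet> u)) * sqrt (v \<bullet> v)"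
            by (rule order_trans[OF L2_set_inner_le]) (intro mult_mono v' au L2_set_nonneg order_trans[OF L2_set_nonneg au])
          then show "(\<Sum>l<d. shift_transpose B u' l * v' l) \<le> \<eta> * (sqrt (u \<bullet> u) * sqrt (v \<bullet> v))" by (simp add: mult_ac)
          have "(\<Sum>l<d. shift_transpose B u' l * shift_transpose B v' l) \<le> (\<eta> * sqrt (u \<bullet> u)) * (\<eta> * sqrt (v \<bullet> v))"
            by (rule order_trans[OF L2_set_inner_le]) (intro mult_mono av au L2_set_nonneg order_trans[OF L2_set_nonneg au])
          also have "\<dots> = \<eta> * (\<eta> * (sqrt (u \<bullet> u) * sqrt (v \<bullet> v)))" by (simp add: mult_ac)
          also have "\<dots> \<le> \<eta> * (1 * (sqrt (u \<bullet> u) * sqrt (v \<bullet> v)))"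
            using order_trans[OF L2_set_nonneg u'] order_trans[OF L2_set_nonneg v']
            by (intro mult_left_mono mult_right_mono B mult_nonneg_nonneg)
          finally show "(\<Sum>l<d. shift_transpose B u' l * shift_transpose B v' l) \<le> \<eta> * (sqrt (u \<bullet> u) * sqrt (v \<bullet> v))" by simp
        qed
        finally have le: "(\<Sum>l<d. (u' l + shift_transpose B u' l) * (v' l + shift_transpose B v' l)) \<le> 3 * \<eta> * (sqrt (u \<bullet> u) * sqrt (v \<bullet> v))"
          by simp
        have "u \<bullet> (restrict_entries \<Sigma> R *\<^sub>v v) = (\<Sum>i<d. \<Sum>j<d. u' i * \<Sigma> $$ (i, j) * v' j)"
          unfolding mat_form[OF u v D] by (intro sum.cong refl) (simp add: Dij u'_def v'_def, simp add: I(3))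
        also have "\<dots> = s\<^sup>2 * (\<Sum>l<d. (u' l + shift_transpose B u' l) * (v' l + shift_transpose B v' l))"
          unfolding \<Sigma>_def by (rule cov_bilinear)
        also have "\<dots> \<le> s\<^sup>2 * (3 * \<eta> * (sqrt (u \<bullet> u) * sqrt (v \<bullet> v)))" by (rule mult_left_mono[OF le]) simp
        also have "\<dots> = 3 * s\<^sup>2 * \<eta> * (sqrt (u \<bullet> u) * sqrt (v \<bullet> v))" by simp
        finally show "u \<bullet> (restrict_entries \<Sigma> R *\<^sub>v v) \<le> 3 * s\<^sup>2 * \<eta> * (sqrt (u \<bullet> u) * sqrt (v \<bullet> v))" .
      qed
      also have "\<dots> \<le> M * real w powr (- \<alpha>)" by (rule M(2))
      also have "\<dots> \<le> M * real k powr (- \<alpha>)"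
        using True k \<alpha> M(1) by (intro mult_left_mono powr_mono2') auto
      finally show ?thesis .
    next
      case False
      have zero: "restrict_entries \<Sigma> R $$ (i, j) = 0" if ij: "i < d" "j < d" for i j
      proof (cases "(i, j) \<in> R")
        case True
        \<comment> \<open>Two indices at distance at least \<open>w\<close> lie in different blocks.\<close>
        have far: "i + w \<le> j \<or> j + w \<le> i" using R(2) True False by (auto simp: off_diagonal_def)
        have "i div w \<noteq> j div w"
        proof
          assume eq: "i div w = j div w"
          have "i = w * (i div w) + i mod w" "j = w * (j div w) + j mod w" by simp_all
          moreover have "i mod w < w" "j mod w < w" using w by auto
          ultimately show False using far eq by (smt (verit) add_less_cancel_left not_less nat_add_left_cancel_less add.assoc add.commute le_add1 le_trans linorder_not_le)
        qed
        then have "shear_coeff B i l * shear_coeff B j l = 0" for l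
          using band[of i l] band[of j l] by (auto simp: shear_coeff_def)
        then have "(\<Sum>l<d. shear_coeff B i l * shear_coeff B j l) = 0" by (intro sum.neutral) blast
        then show ?thesis using ij by (simp add: Dij) (simp add: \<Sigma>_def sample_law_cov)
      qed (simp add: Dij ij)
      have "spectral_norm (restrict_entries \<Sigma> R) \<le> 0"
      proof (rule spectral_norm_leI[OF D])
        fix u v :: "real vec" assume u: "u \<in> carrier_vec d" and v: "v \<in> carrier_vec d"
        have "u \<bullet> (restrict_entries \<Sigma> R *\<^sub>v v) = 0"
          unfolding mat_form[OF u v D] by (intro sum.neutral ballI) (simp add: zero)
        then show "u \<bullet> (restrict_entries \<Sigma> R *\<^sub>v v) \<le> 0 * (sqrt (u \<bullet> u) * sqrt (v \<bullet> v))" by simp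
      qed simp
      also have "0 \<le> M * real k powr (- \<alpha>)" using M(1) by simp
      finally show ?thesis .
    qed
  qed
  ultimately show ?thesis unfolding separated_block_class_def \<Sigma>_def[symmetric] using \<Sigma> by blast
qed

lemma cov_entry_in_J:
  assumes p: "(i, l) \<in> J"
  shows "cov_mat d (sample_law s B) $$ (i, l) = s\<^sup>2 * B (i, l)"
proof -
  have d: "i < d" "l < d" and l: "l \<in> snd ` J" "l \<notin> fst ` J" and i: "i \<notin> snd ` J"
    using p J_sub J_disj by force+
  have "shear_coeff B i r * shear_coeff B l r = (if r = l then B (i, l) else 0)" for r
    using p l i by (auto simp: shear_coeff_def rev_image_eqI)
  then show ?thesis using d by (simp add: sample_law_cov)
qed

end

section \<open>Frobenius versus Schatten norms\<close>

definition frobenius_sq :: "real mat \<Rightarrow> real" where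
  "frobenius_sq A = (\<Sum>i<dim_row A. \<Sum>j<dim_col A. (A $$ (i, j))\<^sup>2)"

lemma frobenius_sq_nonneg: "0 \<le> frobenius_sq A"
  by (auto simp: frobenius_sq_def intro!: sum_nonneg)

lemma mult_mat_vec_sq_le:
  assumes A: "A \<in> carrier_mat m n" and v: "v \<in> carrier_vec n" "v \<bullet> v \<le> 1"
  shows "(A *\<^sub>v v) \<bullet> (A *\<^sub>v v) \<le> frobenius_sq A"
proof -
  have y: "A *\<^sub>v v \<in> carrier_vec m" using A v by auto
  have v2: "(\<Sum>j<n. (v $ j)\<^sup>2) \<le> 1" using v by (simp add: scalar_prod_sum power2_eq_square)
  have "(A *\<^sub>v v) \<bullet> (A *\<^sub>v v) = (\<Sum>i<m. (\<Sum>j<n. A $$ (i, j) * v $ j)\<^sup>2)"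
    unfolding scalar_prod_sum[OF y] using A v
    by (intro sum.cong refl) (simp add: mult_mat_vec_def scalar_prod_sum[of v n] power2_eq_square)
  also have "\<dots> \<le> (\<Sum>i<m. (\<Sum>j<n. (A $$ (i, j))\<^sup>2) * 1)"
  proof (rule sum_mono)
    fix i
    have "(\<Sum>j<n. A $$ (i, j) * v $ j)\<^sup>2 \<le> (\<Sum>j<n. (A $$ (i, j))\<^sup>2) * (\<Sum>j<n. (v $ j)\<^sup>2)"
      by (rule Cauchy_Schwarz_ineq_sum)
    also have "\<dots> \<le> (\<Sum>j<n. (A $$ (i, j))\<^sup>2) * 1" using v2 by (intro mult_left_mono sum_nonneg) auto
    finally show "(\<Sum>j<n. A $$ (i, j) * v $ j)\<^sup>2 \<le> (\<Sum>j<n. (A $$ (i, j))\<^sup>2) * 1" .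
  qed
  finally show ?thesis using A by (simp add: frobenius_sq_def)
qed

lemma frobenius_sq_le_spectral:
  assumes A: "A \<in> carrier_mat m n"
  shows "frobenius_sq A \<le> n * (spectral_norm A)\<^sup>2"
proof -
  have "(\<Sum>i<m. (A $$ (i, j))\<^sup>2) \<le> (spectral_norm A)\<^sup>2" if j: "j < n" for j
  proof -
    have u: "(unit_vec n j :: real vec) \<in> carrier_vec n" "unit_vec n j \<bullet> (unit_vec n j :: real vec) \<le> 1" using j by auto
    have col: "A *\<^sub>v unit_vec n j = vec m (\<lambda>i. A $$ (i, j))"
      using A j by (intro eq_vecI) (auto simp: mult_mat_vec_def)
    have "sqrt ((A *\<^sub>v unit_vec n j) \<bullet> (A *\<^sub>v unit_vec n j)) \<le> spectral_norm A"
      unfolding spectral_norm_def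
    proof (rule cSUP_upper)
      show "(unit_vec n j :: real vec) \<in> {v \<in> carrier_vec (dim_col A). v \<bullet> v \<le> 1}" using A u by auto
      show "bdd_above ((\<lambda>v. sqrt ((A *\<^sub>v v) \<bullet> (A *\<^sub>v v))) ` {v \<in> carrier_vec (dim_col A). v \<bullet> v \<le> 1})"
        using A mult_mat_vec_sq_le[OF A] by (intro bdd_aboveI[of _ "sqrt (frobenius_sq A)"]) auto
    qed
    moreover have nn: "0 \<le> (\<Sum>i<m. (A $$ (i, j))\<^sup>2)" by (intro sum_nonneg) auto
    moreover have "(A *\<^sub>v unit_vec n j) \<bullet> (A *\<^sub>v unit_vec n j) = (\<Sum>i<m. (A $$ (i, j))\<^sup>2)"
      unfolding col by (subst scalar_prod_sum[of _ m]) (auto simp: power2_eq_square)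
    ultimately have "sqrt (\<Sum>i<m. (A $$ (i, j))\<^sup>2) \<le> spectral_norm A" by simp
    then have "(sqrt (\<Sum>i<m. (A $$ (i, j))\<^sup>2))\<^sup>2 \<le> (spectral_norm A)\<^sup>2"
      using nn by (intro power_mono) auto
    then show ?thesis using nn by simp
  qed
  then have "(\<Sum>j<n. \<Sum>i<m. (A $$ (i, j))\<^sup>2) \<le> (\<Sum>j<n. (spectral_norm A)\<^sup>2)" by (intro sum_mono) auto
  then show ?thesis using A sum.swap[of "\<lambda>i j. (A $$ (i, j))\<^sup>2" "{..<n}" "{..<m}"] by (simp add: frobenius_sq_def)
qed

lemma trace_similar:
  assumes X: "X \<in> carrier_mat n n" and s: "similar_mat_wit X Y P Q"
  shows "(\<Sum>i<n. X $$ (i, i)) = (\<Sum>i<n. Y $$ (i, i) :: 'a :: comm_ring_1)"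
proof -
  note w = similar_mat_witD2[OF X s]
  have tr: "(\<Sum>i<n. (U * V) $$ (i, i)) = (\<Sum>i<n. (V * U) $$ (i, i))"
    if "U \<in> carrier_mat n n" "V \<in> carrier_mat n n" for U V :: "'a mat"
  proof -
    have "(\<Sum>i<n. (U * V) $$ (i, i)) = (\<Sum>i<n. \<Sum>j<n. U $$ (i, j) * V $$ (j, i))"
      using that by (intro sum.cong refl) (simp add: scalar_prod_def atLeast0LessThan)
    also have "\<dots> = (\<Sum>j<n. \<Sum>i<n. V $$ (j, i) * U $$ (i, j))"
      by (subst sum.swap) (simp add: mult.commute)
    also have "\<dots> = (\<Sum>i<n. (V * U) $$ (i, i))"
      using that by (intro sum.cong refl) (simp add: scalar_prod_def atLeast0LessThan)
    finally show ?thesis .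
  qed
  have "(\<Sum>i<n. X $$ (i, i)) = (\<Sum>i<n. (Q * (P * Y)) $$ (i, i))"
    unfolding w(3) using w by (intro tr) auto
  also have "Q * (P * Y) = (Q * P) * Y" using w by (intro assoc_mult_mat[symmetric]) auto
  also have "\<dots> = Y" using w by simp
  finally show ?thesis .
qed

text \<open>Over the complex numbers the characteristic polynomial splits, and an eigenvalue \<open>e\<close> of \<open>A\<^sup>T A\<close> with
eigenvector \<open>v\<close> satisfies \<open>e |v|\<^sup>2 = |A v|\<^sup>2\<close>, so it is real and nonnegative.\<close>

lemma gram_char_poly:
  fixes A :: "real mat"
  assumes A: "A \<in> carrier_mat m n"
  obtains rs where "char_poly (transpose_mat A * A) = (\<Prod>r\<leftarrow>rs. [:- r, 1:])" "length rs = n" "\<And>r. r \<in> set rs \<Longrightarrow> 0 \<le> r"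
proof -
  define G where "G = transpose_mat A * A"
  have G: "G \<in> carrier_mat n n" using A by (simp add: G_def)
  define Gc where "Gc = map_mat complex_of_real G"
  have Gc: "Gc \<in> carrier_mat n n" using G by (simp add: Gc_def)
  obtain es where es: "char_poly Gc = (\<Prod>e\<leftarrow>es. [:- e, 1:])" "length es = n"
    using char_poly_factorized[OF Gc] by auto
  have ev: "e = of_real (Re e) \<and> 0 \<le> Re e" if e: "e \<in> set es" for e
  proof -
    have "poly (char_poly Gc) e = 0" unfolding es using e by (auto simp: poly_prod_list prod_list_zero_iff)
    then obtain v where v: "eigenvector Gc v e"
      using eigenvalue_root_char_poly[OF Gc] by (auto simp: eigenvalue_def)
    then have vc: "v \<in> carrier_vec n" and v0: "v \<noteq> 0\<^sub>v n" and Gv: "Gc *\<^sub>v v = e \<cdot>\<^sub>v v"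
      using Gc by (auto simp: eigenvector_def)
    define z where "z k = (\<Sum>j<n. of_real (A $$ (k, j)) * v $ j)" for k
    have Gij: "G $$ (i, j) = (\<Sum>k<m. A $$ (k, i) * A $$ (k, j))" if "i < n" "j < n" for i j
      using that A unfolding G_def by (simp add: scalar_prod_def atLeast0LessThan)
    have row: "e * v $ i = (\<Sum>k<m. of_real (A $$ (k, i)) * z k)" if i: "i < n" for i
    proof -
      have "e * v $ i = (Gc *\<^sub>v v) $ i" unfolding Gv using vc i by simp
      also have "\<dots> = (\<Sum>j<n. of_real (G $$ (i, j)) * v $ j)"
        using i vc G by (simp add: mult_mat_vec_def scalar_prod_def atLeast0LessThan Gc_def)
      also have "\<dots> = (\<Sum>j<n. \<Sum>k<m. of_real (A $$ (k, i)) * (of_real (A $$ (k, j)) * v $ j))"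
        using i by (intro sum.cong refl) (simp add: Gij sum_distrib_right mult.assoc)
      also have "\<dots> = (\<Sum>k<m. of_real (A $$ (k, i)) * z k)"
        by (subst sum.swap) (simp add: z_def sum_distrib_left)
      finally show ?thesis .
    qed
    have "e * (\<Sum>i<n. v $ i * cnj (v $ i)) = (\<Sum>i<n. (\<Sum>k<m. of_real (A $$ (k, i)) * z k) * cnj (v $ i))"
      unfolding sum_distrib_left by (intro sum.cong refl) (simp add: row[symmetric] mult.assoc)
    also have "\<dots> = (\<Sum>i<n. \<Sum>k<m. z k * (of_real (A $$ (k, i)) * cnj (v $ i)))"
      unfolding sum_distrib_right by (intro sum.cong refl) (simp add: mult_ac)
    also have "\<dots> = (\<Sum>k<m. z k * cnj (z k))"
      by (subst sum.swap) (simp add: z_def sum_distrib_left)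
    finally have eq: "e * of_real (\<Sum>i<n. (cmod (v $ i))\<^sup>2) = of_real (\<Sum>k<m. (cmod (z k))\<^sup>2)"
      by (simp add: complex_norm_square[symmetric] del: of_real_power)
    have pos: "0 < (\<Sum>i<n. (cmod (v $ i))\<^sup>2)"
    proof -
      obtain i where i: "i < n" "v $ i \<noteq> 0" using v0 vc by (metis carrier_vecD eq_vecI index_zero_vec)
      have "0 < (cmod (v $ i))\<^sup>2" using i by simp
      also have "\<dots> \<le> (\<Sum>i<n. (cmod (v $ i))\<^sup>2)" using i by (intro member_le_sum) auto
      finally show ?thesis .
    qed
    define N where "N = (\<Sum>i<n. (cmod (v $ i))\<^sup>2)"
    define Z where "Z = (\<Sum>k<m. (cmod (z k))\<^sup>2)"
    have "e = of_real (Z / N)" using eq pos unfolding N_def[symmetric] Z_def[symmetric] by (simp add: field_simps)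
    moreover have "0 \<le> Z / N" using pos by (simp add: N_def Z_def sum_nonneg)
    ultimately show ?thesis by simp
  qed
  define rs where "rs = map Re es"
  have es_rs: "es = map of_real rs" unfolding rs_def using ev by (simp add: map_idI)
  have "map_poly complex_of_real (char_poly G) = char_poly Gc"
    unfolding Gc_def by (rule of_real_hom.char_poly_hom[OF G, symmetric])
  also have "\<dots> = map_poly complex_of_real (\<Prod>r\<leftarrow>rs. [:- r, 1:])"
  proof -
    interpret mp: map_poly_comm_ring_hom complex_of_real ..
    show ?thesis unfolding es(1) es_rs
      by (induction rs) (simp_all add: mp.hom_mult del: mult_pCons_left)
  qed
  finally have eq: "map_poly complex_of_real (char_poly G) = map_poly complex_of_real (\<Prod>r\<leftarrow>rs. [:- r, 1:])" .
  have "char_poly G = (\<Prod>r\<leftarrow>rs. [:- r, 1:])"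
    using arg_cong[OF eq, of "\<lambda>p. coeff p i" for i] by (intro poly_eqI) (simp add: coeff_map_poly)
  moreover have "length rs = n" using es by (simp add: rs_def)
  moreover have "0 \<le> r" if "r \<in> set rs" for r using that ev by (auto simp: rs_def)
  ultimately show ?thesis using that by (simp add: G_def)
qed

text \<open>Both sides are the trace of \<open>A\<^sup>T A\<close>, since a Schur form carries the eigenvalues on its diagonal.\<close>

lemma sum_list_gram_eigenvalues:
  assumes A: "(A :: real mat) \<in> carrier_mat m n" and rs: "char_poly (transpose_mat A * A) = (\<Prod>r\<leftarrow>rs. [:- r, 1:])"
  shows "sum_list rs = frobenius_sq A"
proof -
  define G where "G = transpose_mat A * A"
  have G: "G \<in> carrier_mat n n" using A by (simp add: G_def)
  obtain B P Q where schur: "schur_decomposition G rs = (B, P, Q)" by (cases "schur_decomposition G rs") auto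
  from schur_decomposition[OF G rs[folded G_def] schur]
  have sim: "similar_mat_wit G B P Q" and diag: "diag_mat B = rs" by auto
  have B: "B \<in> carrier_mat n n" using similar_mat_witD2[OF G sim] by auto
  have "sum_list rs = (\<Sum>i<n. B $$ (i, i))"
    unfolding diag[symmetric] diag_mat_def using B by (simp add: sum_list_sum_nth atLeast0LessThan)
  also have "\<dots> = (\<Sum>i<n. G $$ (i, i))" by (rule trace_similar[OF G sim, symmetric])
  also have "\<dots> = (\<Sum>i<n. \<Sum>k<m. (A $$ (k, i))\<^sup>2)"
    using A unfolding G_def by (intro sum.cong refl) (simp add: scalar_prod_def atLeast0LessThan power2_eq_square)
  also have "\<dots> = frobenius_sq A" using A by (subst sum.swap) (simp add: frobenius_sq_def)
  finally show ?thesis .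
qed

lemma proots_linear_factors: "proots (\<Prod>r\<leftarrow>rs. [:- r, 1:]) = mset (rs :: real list)"
proof (induction rs)
  case (Cons r rs)
  have "(\<Prod>r\<leftarrow>rs. [:- r, 1:]) \<noteq> 0" by (auto simp: prod_list_zero_iff)
  moreover have "proots [:- r, 1:] = {#r#}" using proots_linear_factor[of r] by simp
  ultimately show ?case using Cons by (simp add: proots_mult del: mult_pCons_left)
qed simp

text \<open>Bernoulli's inequality for real exponents, from Young's inequality with second factor 1.\<close>

lemma tangent_powr: "1 + r * (y - 1) \<le> y powr r" if "r \<ge> 1" "y \<ge> 0" for r y :: real
proof (cases "y = 0")
  case False
  have "(y powr r) powr (1 / r) * 1 powr (1 - 1 / r) \<le> 1 / r * y powr r + (1 - 1 / r) * 1"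
    using that False by (intro Youngs_inequality_0) auto
  then have "y \<le> 1 / r * y powr r + (1 - 1 / r)" using that False by (simp add: powr_powr)
  from mult_left_mono[OF this, of r] have "r * y \<le> r * (1 / r * y powr r + (1 - 1 / r))" using that by simp
  also have "\<dots> = y powr r + r - 1" using that by (simp add: algebra_simps)
  finally show ?thesis by (simp add: algebra_simps)
qed (use that in auto)

lemma power_mean_list:
  assumes r: "r \<ge> 1" and rs: "\<And>x. x \<in> set rs \<Longrightarrow> 0 \<le> x" and l: "length rs = n" "n > 0"
  shows "n * (sum_list rs / n) powr r \<le> (\<Sum>x\<leftarrow>rs. x powr r)"
proof -
  define m where "m = sum_list rs / n"
  have m0: "0 \<le> m" unfolding m_def using rs by (intro divide_nonneg_nonneg sum_list_nonneg) auto
  show ?thesis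
  proof (cases "m = 0")
    case True
    then show ?thesis unfolding m_def[symmetric] using rs by (simp, intro sum_list_nonneg) auto
  next
    case False
    then have m: "m > 0" using m0 by simp
    have "(\<Sum>x\<leftarrow>rs. 1 + r * (x / m - 1)) = n + r * (sum_list rs / m - n)"
      using l(1) by (induction rs arbitrary: n) (auto simp: algebra_simps add_divide_distrib)
    also have "sum_list rs / m = n" using m l by (simp add: m_def field_simps)
    finally have "real n = (\<Sum>x\<leftarrow>rs. 1 + r * (x / m - 1))" by simp
    also have "\<dots> \<le> (\<Sum>x\<leftarrow>rs. (x / m) powr r)"
      using rs m r by (intro sum_list_mono tangent_powr) auto
    also have "\<dots> = (\<Sum>x\<leftarrow>rs. x powr r * (1 / m powr r))"
      using rs m by (intro arg_cong[where f=sum_list] map_cong refl) (simp add: powr_divide)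
    also have "\<dots> = (\<Sum>x\<leftarrow>rs. x powr r) * (1 / m powr r)" by (rule sum_list_mult_const)
    finally have "real n \<le> (\<Sum>x\<leftarrow>rs. x powr r) / m powr r" by simp
    moreover have "0 < m powr r" using m by simp
    ultimately show ?thesis unfolding m_def[symmetric] by (simp only: pos_le_divide_eq)
  qed
qed

text \<open>For finite \<open>q\<close> this is the power mean inequality for the \<open>n\<close> eigenvalues of \<open>A\<^sup>T A\<close> with exponent \<open>q / 2 \<ge> 1\<close>; for \<open>q = \<infinity>\<close>
each of the \<open>n\<close> columns has length at most the spectral norm.\<close>

theorem frobenius_le_schatten:
  assumes A: "A \<in> carrier_mat n n" and n: "n > 0" and q: "q \<ge> 2"
  shows "frobenius_sq A / n \<le> real n powr (- real_of_ereal (2 / q)) * (schatten_norm q A)\<^sup>2"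
proof (cases q)
  case PInf
  then show ?thesis using frobenius_sq_le_spectral[OF A] n by (simp add: schatten_norm_def field_simps)
next
  case MInf
  then show ?thesis using q by simp
next
  case (real p)
  then have p: "p \<ge> 2" using q by simp
  obtain rs where rs: "char_poly (transpose_mat A * A) = (\<Prod>r\<leftarrow>rs. [:- r, 1:])" "length rs = n" "\<And>r. r \<in> set rs \<Longrightarrow> 0 \<le> r"
    using gram_char_poly[OF A] by blast
  have sum: "sum_list rs = frobenius_sq A" by (rule sum_list_gram_eigenvalues[OF A rs(1)])
  define S where "S = (\<Sum>x\<leftarrow>rs. x powr (p / 2))"
  have "schatten_norm q A = S powr (1 / p)"
  proof -
    have "(\<Sum>s\<in>#singular_values A. s powr p) = (\<Sum>s\<in>#image_mset sqrt (mset rs). s powr p)"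
      unfolding singular_values_def rs(1) proots_linear_factors ..
    also have "\<dots> = (\<Sum>x\<leftarrow>rs. sqrt x powr p)" by (induction rs) auto
    also have "\<dots> = S" unfolding S_def
    proof (intro arg_cong[where f=sum_list] map_cong refl)
      fix x assume "x \<in> set rs"
      then have "sqrt x = x powr (1 / 2)" using rs(3) by (simp add: powr_half_sqrt)
      then have "sqrt x powr p = x powr (1 / 2 * p)" by (simp only: powr_powr)
      then show "sqrt x powr p = x powr (p / 2)" by simp
    qed
    finally show ?thesis using real by (simp add: schatten_norm_def)
  qed
  moreover have "S powr (1 / p) * S powr (1 / p) = S powr (2 / p)"
    unfolding powr_add[symmetric] by simp
  ultimately have sq: "(schatten_norm q A)\<^sup>2 = S powr (2 / p)" by (simp only: power2_eq_square)
  define m where "m = frobenius_sq A / n"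
  have m: "0 \<le> m" using frobenius_sq_nonneg by (simp add: m_def)
  have "n * m powr (p / 2) \<le> S"
    using power_mean_list[of "p / 2" rs n] p rs n unfolding S_def m_def sum by simp
  then have "(n * m powr (p / 2)) powr (2 / p) \<le> S powr (2 / p)"
    using p by (intro powr_mono2) auto
  also have "(n * m powr (p / 2)) powr (2 / p) = n powr (2 / p) * m"
    using p m by (simp add: powr_mult powr_powr)
  finally have "n powr (- (2 / p)) * (n powr (2 / p) * m) \<le> n powr (- (2 / p)) * S powr (2 / p)"
    by (intro mult_left_mono) auto
  moreover have "n powr (- (2 / p)) * (n powr (2 / p) * m) = m"
    using n by (simp add: mult.assoc[symmetric] powr_add[symmetric])
  moreover have "real_of_ereal (2 / q) = 2 / p" using real p by simp
  moreover have "frobenius_sq A / n = m" by (simp add: m_def)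
  ultimately show ?thesis by (simp only: sq)
qed

section \<open>The minimax bound for a fixed block size\<close>

lemma clip_dist_le: "\<bar>y\<bar> \<le> L \<Longrightarrow> \<bar>max (- L) (min L x) - y\<bar> \<le> \<bar>x - y\<bar>" for x y L :: real
  by (auto simp: max_def min_def)

definition scale_data :: "nat \<Rightarrow> nat \<Rightarrow> real \<Rightarrow> (nat \<Rightarrow> nat \<Rightarrow> real) \<Rightarrow> nat \<Rightarrow> nat \<Rightarrow> real" where
  "scale_data n d s S = (\<lambda>i\<in>{..<n}. \<lambda>j\<in>{..<d}. s * S i j)"

lemma scale_data_measurable [measurable]: "scale_data n d s \<in> data_space n d \<rightarrow>\<^sub>M data_space n d"
  unfolding scale_data_def data_space_def point_space_def
proof (intro measurable_restrict borel_measurable_times borel_measurable_const)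
  fix i j assume "i \<in> {..<n}" "j \<in> {..<d}"
  then have 1: "(\<lambda>S. S i) \<in> PiM {..<n} (\<lambda>_. PiM {..<d} (\<lambda>_. borel :: real measure)) \<rightarrow>\<^sub>M PiM {..<d} (\<lambda>_. borel)"
    and 2: "(\<lambda>x. x j) \<in> PiM {..<d} (\<lambda>_. borel :: real measure) \<rightarrow>\<^sub>M borel"
    by (auto intro: measurable_component_singleton)
  show "(\<lambda>S. S i j) \<in> borel_measurable (PiM {..<n} (\<lambda>_. PiM {..<d} (\<lambda>_. borel :: real measure)))"
    by (rule measurable_compose[OF 1 2])
qed

lemma adjacent_scale_data:
  assumes S: "S \<in> space (data_space n d)" "S' \<in> space (data_space n d)" and s: "s \<noteq> 0" and adj: "adjacent n S S'"
  shows "adjacent n (scale_data n d s S) (scale_data n d s S')"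
proof -
  from adj obtain i where i: "i < n" "S i \<noteq> S' i" "\<And>j. j < n \<Longrightarrow> j \<noteq> i \<Longrightarrow> S j = S' j"
    by (auto simp: adjacent_def)
  have ext: "S i \<in> extensional {..<d}" "S' i \<in> extensional {..<d}"
    using S i(1) by (auto simp: data_space_def point_space_def space_PiM PiE_def Pi_def)
  then obtain j where "j < d" "S i j \<noteq> S' i j"
    using i(2) by (metis extensionalityI lessThan_iff)
  then have "scale_data n d s S i \<noteq> scale_data n d s S' i"
    using i(1) s by (auto simp: scale_data_def fun_eq_iff)
  moreover have "scale_data n d s S j = scale_data n d s S' j" if "j < n" "j \<noteq> i" for j
    using i(3)[OF that] that by (simp add: scale_data_def)
  ultimately show ?thesis using i(1) unfolding adjacent_def by blast
qed

text \<open>The blocks occupy disjoint coordinates, so the operator norm of the whole shear is the largest one among the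
blocks.\<close>

lemma bounded_shear_half_blocks:
  assumes k: "k \<ge> 1" and \<delta>: "\<delta> \<ge> 0"
    and F: "\<And>b. b < d div (2 * k) \<Longrightarrow>
      soft_prior.F (half_blocks d k) (\<lambda>p. fst p div (2 * k)) (lattice_net k \<times> lattice_net k) (net_form k) b \<theta> < exp (real (64 * k))"
  shows "shear_model.bounded_shear d (half_blocks d k) (\<delta> * (40 * sqrt k)) (\<lambda>r. \<delta> * \<theta> r)"
proof -
  interpret shear_model d "half_blocks d k" by (rule half_blocks_model)
  define m where "m = d div (2 * k)"
  have "bform (\<lambda>r. \<delta> * \<theta> r) u w \<le> \<delta> * (40 * sqrt k) * (L2_set u {..<d} * L2_set w {..<d})" for u w
  proof -
    define uu where "uu b a = u (2 * k * b + k + a)" for b a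
    define ww where "ww b c = w (2 * k * b + c)" for b c
    define A where "A b a c = \<theta> (2 * k * b + k + a, 2 * k * b + c)" for b a c
    define f where "f b = L2_set (uu b) {..<k}" for b
    define g where "g b = L2_set (ww b) {..<k}" for b
    \<comment> \<open>Used with \<open>r = k\<close> for the second halves and \<open>r = 0\<close> for the first halves of the blocks.\<close>
    have part: "(\<Sum>b<m. \<Sum>a<k. h (2 * k * b + r + a)) \<le> (\<Sum>i<d. h i)"
      if h: "\<And>i. 0 \<le> h i" and r: "r + k \<le> 2 * k" for h :: "nat \<Rightarrow> real" and r
    proof -
      have inj: "inj_on (\<lambda>(b, a). 2 * k * b + r + a) ({..<m} \<times> {..<k})"
      proof (rule inj_onI)
        fix p p' :: "nat \<times> nat"
        assume p: "p \<in> {..<m} \<times> {..<k}" "p' \<in> {..<m} \<times> {..<k}"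
          and eq: "(\<lambda>(b, a). 2 * k * b + r + a) p = (\<lambda>(b, a). 2 * k * b + r + a) p'"
        obtain b a b' a' where pp: "p = (b, a)" "p' = (b', a')" by (cases p, cases p')
        have lt: "r + a < 2 * k" "r + a' < 2 * k" using p r by (auto simp: pp)
        have e: "2 * k * b + (r + a) = 2 * k * b' + (r + a')" using eq by (simp add: pp)
        have "(2 * k * b + (r + a)) div (2 * k) = b" "(2 * k * b' + (r + a')) div (2 * k) = b'"
          using lt by (auto simp: div_mult_self2)
        then have "b = b'" using e by simp
        then show "p = p'" using e by (simp add: pp)
      qed
      have "(\<Sum>b<m. \<Sum>a<k. h (2 * k * b + r + a)) = (\<Sum>i\<in>(\<lambda>(b, a). 2 * k * b + r + a) ` ({..<m} \<times> {..<k}). h i)"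
        by (subst sum.reindex[OF inj]) (simp add: sum.cartesian_product split_def)
      also have "\<dots> \<le> (\<Sum>i<d. h i)"
      proof (rule sum_mono2)
        show "(\<lambda>(b, a). 2 * k * b + r + a) ` ({..<m} \<times> {..<k}) \<subseteq> {..<d}"
        proof
          fix i assume "i \<in> (\<lambda>(b, a). 2 * k * b + r + a) ` ({..<m} \<times> {..<k})"
          then obtain b a where i: "i = 2 * k * b + r + a" "b < m" "a < k" by auto
          then show "i \<in> {..<d}" using half_blocks_lt[of b d k "r + a"] r by (simp add: m_def add.assoc)
        qed
      qed (auto simp: h)
      finally show ?thesis .
    qed
    have nf: "L2_set f {..<m} \<le> L2_set u {..<d}"
      unfolding L2_set_def[of f] L2_set_def[of u] f_def L2_set_sq uu_def
      by (intro real_sqrt_le_mono part) auto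
    have ng: "L2_set g {..<m} \<le> L2_set w {..<d}"
      using part[of "\<lambda>i. (w i)\<^sup>2" 0] unfolding L2_set_def[of g] L2_set_def[of w] g_def L2_set_sq ww_def
      by (intro real_sqrt_le_mono) auto
    have bf: "bform (\<lambda>r. \<delta> * \<theta> r) u w = (\<Sum>p\<in>half_blocks d k. \<delta> * \<theta> p * u (fst p) * w (snd p))"
      by (simp add: bform_def split_def)
    have "bform (\<lambda>r. \<delta> * \<theta> r) u w
        = (\<Sum>(b, a, c)\<in>{..<m} \<times> {..<k} \<times> {..<k}. \<delta> * (A b a c * uu b a * ww b c))"
      unfolding bf unfolding half_blocks_def m_def[symmetric]
      by (subst sum.reindex[OF half_blocks_inj]) (auto intro!: sum.cong simp: A_def uu_def ww_def)
    also have "\<dots> = (\<Sum>b<m. \<Sum>a<k. \<Sum>c<k. \<delta> * (A b a c * uu b a * ww b c))"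
      by (simp only: sum.cartesian_product)
    also have "\<dots> = \<delta> * (\<Sum>b<m. bilin k (A b) (uu b) (ww b))"
      by (simp add: bilin_def sum_distrib_left)
    also have "(\<Sum>b<m. bilin k (A b) (uu b) (ww b)) \<le> (\<Sum>b<m. 40 * sqrt k * (f b * g b))"
    proof (rule sum_mono)
      fix b assume "b \<in> {..<m}"
      then have b: "b < d div (2 * k)" by (simp add: m_def)
      show "bilin k (A b) (uu b) (ww b) \<le> 40 * sqrt k * (f b * g b)"
        unfolding A_def[abs_def] f_def g_def by (rule block_prior_bilin_le[OF k b F[OF b]])
    qed
    also have "\<dots> = 40 * sqrt k * (\<Sum>b<m. f b * g b)" by (simp add: sum_distrib_left)
    also have "\<dots> \<le> 40 * sqrt k * (L2_set f {..<m} * L2_set g {..<m})"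
      by (intro mult_left_mono L2_set_inner_le) auto
    also have "\<dots> \<le> 40 * sqrt k * (L2_set u {..<d} * L2_set w {..<d})"
      by (intro mult_left_mono mult_mono nf ng L2_set_nonneg) auto
    finally show ?thesis using \<delta> by (simp add: mult_left_mono mult.assoc)
  qed
  then show ?thesis unfolding bounded_shear_def by blast
qed

lemma half_blocks_entry_bound:
  assumes k: "k \<ge> 1" and p: "p \<in> half_blocks d k"
    and F: "\<And>b. b < d div (2 * k) \<Longrightarrow>
      soft_prior.F (half_blocks d k) (\<lambda>p. fst p div (2 * k)) (lattice_net k \<times> lattice_net k) (net_form k) b \<theta> < exp (real (64 * k))"
  shows "\<bar>\<theta> p\<bar> \<le> 40 * sqrt k"
proof -
  obtain b a c where p: "p = (2 * k * b + k + a, 2 * k * b + c)" "b < d div (2 * k)" "a < k" "c < k"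
    using p by (auto simp: half_blocks_def)
  have e: "L2_set (\<lambda>i. if i = r then t else 0) {..<k} = \<bar>t\<bar>" if "r < k" for r and t :: real
    using that by (simp add: L2_set_def if_distrib[of "\<lambda>x. x\<^sup>2"] cong: if_cong)
  have "t * \<theta> p = bilin k (\<lambda>a c. \<theta> (2 * k * b + k + a, 2 * k * b + c)) (\<lambda>i. if i = a then t else 0) (\<lambda>i. if i = c then 1 else 0)" for t
    unfolding bilin_def using p by (simp add: if_distrib[of "\<lambda>x. _ * x"] if_distrib[of "\<lambda>x. x * _"] cong: if_cong)
  then have "t * \<theta> p \<le> 40 * sqrt k * (\<bar>t\<bar> * 1)" for t
    using block_prior_bilin_le[OF k p(2) F[OF p(2)], of "\<lambda>i. if i = a then t else 0" "\<lambda>i. if i = c then 1 else 0"]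
    by (simp add: e p)
  from this[of 1] this[of "-1"] show ?thesis by (simp add: abs_le_iff)
qed

text \<open>If the supremum of the risk were smaller, the risk in the entries would be at most \<open>N / 4000\<close> on the support of the prior, and
\<open>weighted_van_trees\<close> would give \<open>N \<le> (3903 / 8000 + 1 / 2) N\<close>. The scale \<open>s\<close> is removed by
running the estimator on rescaled data, which preserves adjacency and hence privacy.\<close>

theorem block_minimax_bound:
  fixes \<rho> s \<delta> \<alpha> K M\<^sub>0 M :: real
  assumes k: "k \<ge> 1" "2 * k \<le> d" and s: "s > 0" and \<delta>: "\<delta> > 0" and \<rho>: "\<rho> \<ge> 0"
    and \<alpha>: "\<alpha> > 0" and K: "K > 0" and M: "M > 0" and q: "q \<ge> (2::ereal)"
    and sK: "32 * s\<^sup>2 \<le> 3 * K\<^sup>2" and sM: "4 * s\<^sup>2 \<le> M\<^sub>0"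
    and \<eta>: "\<delta> * (40 * sqrt k) \<le> 1" "3 * s\<^sup>2 * (\<delta> * (40 * sqrt k)) \<le> M * real (2 * k) powr (- \<alpha>)"
    and info: "n * \<delta>\<^sup>2 \<le> 1 \<or> (real n)\<^sup>2 * \<delta>\<^sup>2 * (exp (2 * \<rho>) - 1) \<le> card (half_blocks d k)"
    and A: "A \<in> zCDP_estimators n d \<rho>"
  shows "ennreal ((s\<^sup>2 * \<delta>)\<^sup>2 / d * (card (half_blocks d k) / 4000))
    \<le> (SUP P\<in>distribution_class d \<alpha> K M\<^sub>0 M. ennreal (real d powr (- real_of_ereal (2 / q))) * schatten_risk n d q A P)"
proof -
  define J where "J = half_blocks d k"
  define L where "L = 40 * sqrt k"
  have L0: "0 \<le> L" by (simp add: L_def)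
  have d0: "d > 0" using k by simp
  interpret shear_model d J unfolding J_def by (rule half_blocks_model)
  interpret W: soft_prior J "\<lambda>p. fst p div (2 * k)" "{..<d div (2 * k)}" "lattice_net k \<times> lattice_net k"
     "net_form k" "real (81 * k)" "exp (real (64 * k))" unfolding J_def by (rule block_prior[OF k(1)])
  have AK: "A \<in> data_space n d \<rightarrow>\<^sub>M prob_algebra (matrix_space d)" using A by (simp add: zCDP_estimators_def)
  define A' where "A' S = A (scale_data n d s S)" for S
  define b where "b p x = (if p \<in> J then max (- L) (min L (x p / (s\<^sup>2 * \<delta>))) else 0)" for p and x :: "nat \<times> nat \<Rightarrow> real"
  interpret bounded_estimator d J n "matrix_space d" A' b L \<delta>
  proof
    show "A' \<in> data_space n d \<rightarrow>\<^sub>M prob_algebra (matrix_space d)"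
      unfolding A'_def by (rule measurable_compose[OF scale_data_measurable AK])
    show "b p \<in> borel_measurable (matrix_space d)" for p
    proof (cases "p \<in> J")
      case True
      then have "(\<lambda>x. x p) \<in> borel_measurable (matrix_space d)"
        unfolding matrix_space_def using J_sub by (intro measurable_component_singleton) auto
      then show ?thesis using True by (simp add: b_def[abs_def])
    qed (simp add: b_def[abs_def])
    show "\<bar>b p x\<bar> \<le> L" for p x using L0 by (auto simp: b_def)
  qed
  have st: "stable \<rho>"
    unfolding stable_def
  proof (intro ballI impI)
    fix S S' assume S: "S \<in> space (data_space n d)" "S' \<in> space (data_space n d)" and adj: "adjacent n S S'"
    have "scale_data n d s S \<in> space (data_space n d)" "scale_data n d s S' \<in> space (data_space n d)"
      using S by (auto intro: measurable_space[OF scale_data_measurable])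
    moreover have "adjacent n (scale_data n d s S) (scale_data n d s S')"
      using s by (intro adjacent_scale_data S adj) simp
    ultimately show "renyi_divergence 2 (A' S) (A' S') \<le> ereal (\<rho> * 2)"
      using A unfolding zCDP_estimators_def A'_def by auto
  qed
  define c0 where "c0 = (s\<^sup>2 * \<delta>)\<^sup>2 / d"
  have c0: "c0 > 0" using s \<delta> d0 by (simp add: c0_def)
  define w where "w = real d powr (- real_of_ereal (2 / q))"
  have w: "w > 0" using d0 by (simp add: w_def)
  have risk_le: "ennreal (c0 * risk \<theta>) \<le> (SUP P\<in>distribution_class d \<alpha> K M\<^sub>0 M. ennreal w * schatten_risk n d q A P)"
    if \<theta>: "W.weight \<theta> \<noteq> 0" for \<theta>
  proof -
    have F: "W.F b \<theta> < exp (real (64 * k))" if "b < d div (2 * k)" for b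
      using \<theta> that unfolding W.weight_pos_iff by blast
    have bnd: "\<bar>\<theta> p\<bar> \<le> L" if "p \<in> J" for p
      unfolding L_def using half_blocks_entry_bound[OF k(1), of p d \<theta>] F that unfolding J_def by blast
    define B where "B = (\<lambda>r. \<delta> * \<theta> r)"
    have bs: "bounded_shear (\<delta> * (40 * sqrt k)) B"
      unfolding B_def using bounded_shear_half_blocks[OF k(1), of \<delta> d \<theta>] F \<delta> unfolding J_def by simp
    define P where "P = sample_law s B"
    have P: "P \<in> distribution_class d \<alpha> K M\<^sub>0 M"
      unfolding distribution_class_def P_def
    proof (intro CollectI conjI sample_law_prob)
      show "psi2_norm_vec d (sample_law s B) (\<lambda>x. vec d x - mean_vec d (sample_law s B)) \<le> ennreal K"
        using \<delta> by (intro sample_law_psi2[OF bs _ \<eta>(1) K sK]) simp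
      have band: "i div (2 * k) = l div (2 * k)" if "(i, l) \<in> J" for i l
        using that half_blocks_index(1,3) by (auto simp: J_def half_blocks_def)
      show "cov_mat d (sample_law s B) \<in> separated_block_class d \<alpha> M\<^sub>0 M"
        using \<delta> k \<alpha> M by (intro sample_law_separated[OF bs _ \<eta>(1) sM band _ _ \<eta>(2)]) auto
    qed
    define loss where "loss x = (\<Sum>p\<in>J. (b p x - \<theta> p)\<^sup>2)" for x
    have loss_m [measurable]: "loss \<in> borel_measurable (matrix_space d)" unfolding loss_def by measurable
    have pt: "c0 / w * loss x \<le> (schatten_norm q (mat d d x - cov_mat d P))\<^sup>2" for x
    proof -
      define D where "D = mat d d x - cov_mat d P"
      have D: "D \<in> carrier_mat d d" unfolding D_def by (intro minus_carrier_mat) (simp add: cov_mat_def)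
      have "(s\<^sup>2 * \<delta>)\<^sup>2 * loss x \<le> (\<Sum>p\<in>J. (D $$ p)\<^sup>2)"
        unfolding loss_def sum_distrib_left
      proof (rule sum_mono)
        fix p assume p: "p \<in> J"
        obtain i l where il: "p = (i, l)" "(i, l) \<in> J" using p by (cases p) auto
        have "D $$ p = x p - s\<^sup>2 * B p"
          using il J_sub cov_entry_in_J[OF il(2), of s B] by (auto simp: D_def P_def cov_mat_def)
        also have "\<dots> = s\<^sup>2 * \<delta> * (x p / (s\<^sup>2 * \<delta>) - \<theta> p)" using s \<delta> by (simp add: B_def field_simps)
        finally have Dp: "D $$ p = s\<^sup>2 * \<delta> * (x p / (s\<^sup>2 * \<delta>) - \<theta> p)" .
        have "\<bar>b p x - \<theta> p\<bar> \<le> \<bar>x p / (s\<^sup>2 * \<delta>) - \<theta> p\<bar>"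
          using clip_dist_le[OF bnd[OF p]] p by (simp add: b_def)
        then have "(b p x - \<theta> p)\<^sup>2 \<le> (x p / (s\<^sup>2 * \<delta>) - \<theta> p)\<^sup>2" by (simp add: abs_le_square_iff)
        then show "(s\<^sup>2 * \<delta>)\<^sup>2 * (b p x - \<theta> p)\<^sup>2 \<le> (D $$ p)\<^sup>2"
          unfolding Dp power_mult_distrib by (intro mult_left_mono) auto
      qed
      also have "\<dots> \<le> (\<Sum>p\<in>{..<d} \<times> {..<d}. (D $$ p)\<^sup>2)" using J_sub by (intro sum_mono2) auto
      also have "\<dots> = frobenius_sq D" using D by (simp add: frobenius_sq_def sum.cartesian_product split_def)
      finally have "c0 * loss x \<le> frobenius_sq D / d" using d0 by (simp add: c0_def field_simps)
      also have "\<dots> \<le> w * (schatten_norm q D)\<^sup>2" unfolding w_def by (rule frobenius_le_schatten[OF D d0 q])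
      finally show ?thesis using w by (simp add: D_def field_simps)
    qed
    have law: "PiM {..<n} (\<lambda>_. P) = distr (gdata n) (data_space n d) (\<lambda>S. scale_data n d s (obs \<theta> S))"
    proof -
      have P': "P = distr (gauss {..<d}) (gauss {..<d}) (\<lambda>g. \<lambda>i\<in>{..<d}. s * shear B g i)"
        unfolding P_def sample_law_def by (rule distr_cong) (auto simp: point_space_def)
      have m: "(\<lambda>g. \<lambda>i\<in>{..<d}. s * shear B g i) \<in> gauss {..<d} \<rightarrow>\<^sub>M gauss {..<d}"
        using scaled_shear_measurable[of s B] by (simp add: point_space_def cong: measurable_cong_sets)
      have "PiM {..<n} (\<lambda>_. P) = distr (gdata n) (gdata n) (compose {..<n} (\<lambda>g. \<lambda>i\<in>{..<d}. s * shear B g i))"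
        unfolding gdata_def P' by (rule distr_PiM_finite_prob_space'[symmetric]) (auto intro: prob_space_gauss m)
      also have "compose {..<n} (\<lambda>g. \<lambda>i\<in>{..<d}. s * shear B g i) = (\<lambda>S. scale_data n d s (obs \<theta> S))"
        by (auto simp: fun_eq_iff compose_def scale_data_def shear_data_def B_def)
      also have "distr (gdata n) (gdata n) (\<lambda>S. scale_data n d s (obs \<theta> S)) = distr (gdata n) (data_space n d) (\<lambda>S. scale_data n d s (obs \<theta> S))"
        by (rule distr_cong) auto
      finally show ?thesis .
    qed
    have "ennreal (c0 / w * risk \<theta>) = (\<integral>\<^sup>+S. ennreal (c0 / w * sq_loss \<theta> (obs \<theta> S)) \<partial>gdata n)"
      unfolding risk_def using c0 w sq_loss_nonneg
      by (subst nn_integral_eq_integral) (auto intro!: integrable_mult_right integrable_sq_loss mult_nonneg_nonneg)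
    also have "\<dots> = (\<integral>\<^sup>+S. (\<integral>\<^sup>+x. ennreal (c0 / w * loss x) \<partial>A (scale_data n d s (obs \<theta> S))) \<partial>gdata n)"
    proof (rule nn_integral_cong)
      fix S assume "S \<in> space (gdata n)"
      then have S: "obs \<theta> S \<in> space (data_space n d)" by (intro obs_space) (simp add: space_gdata)
      have loss0: "0 \<le> loss x" for x by (simp add: loss_def sum_nonneg)
      have sq: "sq_loss \<theta> (obs \<theta> S) = (\<integral>x. loss x \<partial>A' (obs \<theta> S))" by (simp add: sq_loss_def loss_def)
      have "integrable (A' (obs \<theta> S)) loss"
        unfolding loss_def using integrable_dev2[OF S, of _ \<theta>]
        by (intro Bochner_Integration.integrable_sum) (simp add: power2_eq_square)
      then show "ennreal (c0 / w * sq_loss \<theta> (obs \<theta> S)) = (\<integral>\<^sup>+x. ennreal (c0 / w * loss x) \<partial>A (scale_data n d s (obs \<theta> S)))"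
        unfolding A'_def[symmetric] using c0 w
        by (subst nn_integral_eq_integral) (auto simp: sq loss0)
    qed
    also have "\<dots> = (\<integral>\<^sup>+S. (\<integral>\<^sup>+x. ennreal (c0 / w * loss x) \<partial>A S) \<partial>PiM {..<n} (\<lambda>_. P))"
    proof -
      have "(\<lambda>x. ennreal (c0 / w * loss x)) \<in> borel_measurable (matrix_space d)" by measurable
      then have "(\<lambda>S. \<integral>\<^sup>+x. ennreal (c0 / w * loss x) \<partial>A S) \<in> borel_measurable (data_space n d)"
        by (rule measurable_compose[OF measurable_prob_algebraD[OF AK] nn_integral_measurable_subprob_algebra])
      moreover have "(\<lambda>S. scale_data n d s (obs \<theta> S)) \<in> gdata n \<rightarrow>\<^sub>M data_space n d" by measurable
      ultimately show ?thesis unfolding law by (subst nn_integral_distr) auto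
    qed
    also have "\<dots> \<le> schatten_risk n d q A P"
      unfolding schatten_risk_def by (intro nn_integral_mono ennreal_leI pt)
    finally have "ennreal w * ennreal (c0 / w * risk \<theta>) \<le> ennreal w * schatten_risk n d q A P"
      by (rule mult_left_mono) simp
    also have "ennreal w * ennreal (c0 / w * risk \<theta>) = ennreal (c0 * risk \<theta>)"
      using w by (simp add: ennreal_mult'[symmetric])
    also have "ennreal w * schatten_risk n d q A P \<le> (SUP P\<in>distribution_class d \<alpha> K M\<^sub>0 M. ennreal w * schatten_risk n d q A P)"
      by (rule SUP_upper[OF P])
    finally show ?thesis .
  qed
  define N where "N = real (card J)"
  have cJ: "card J = d div (2 * k) * k\<^sup>2" unfolding J_def by (rule card_half_blocks)
  have m1: "1 \<le> d div (2 * k)" using k by (simp add: Suc_le_eq div_greater_zero_iff)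
  have N0: "N > 0" using cJ m1 k by (simp add: N_def)
  show ?thesis
  proof (rule ccontr)
    assume "\<not> ennreal ((s\<^sup>2 * \<delta>)\<^sup>2 / d * (card (half_blocks d k) / 4000))
      \<le> (SUP P\<in>distribution_class d \<alpha> K M\<^sub>0 M. ennreal (real d powr (- real_of_ereal (2 / q))) * schatten_risk n d q A P)"
    then have less: "(SUP P\<in>distribution_class d \<alpha> K M\<^sub>0 M. ennreal w * schatten_risk n d q A P) < ennreal (c0 * (N / 4000))"
      unfolding w_def c0_def N_def J_def by (simp add: not_le)
    have R: "risk \<theta> \<le> N / 4000" if "W.weight \<theta> \<noteq> 0" for \<theta>
    proof -
      have "ennreal (c0 * risk \<theta>) \<le> ennreal (c0 * (N / 4000))"
        using risk_le[OF that] less by (rule order.trans[OF _ less_imp_le])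
      then have "c0 * risk \<theta> \<le> c0 * (N / 4000)" using c0 N0 by (subst (asm) ennreal_le_iff) auto
      then show ?thesis using c0 by (simp only: mult_le_cancel_left_pos)
    qed
    define Z where "Z = (\<integral>\<theta>. W.weight \<theta> \<partial>gauss J)"
    have Z: "Z > 0" unfolding Z_def by (rule W.weight_mean_pos)
    \<comment> \<open>The sum of the information terms: 1 from the data, 1296 = 16 * 81 from the cutoff and 4 from the Gaussian.\<close>
    define \<beta> :: real where "\<beta> = 1301"
    have \<beta>: "\<beta> > 0" by (simp add: \<beta>_def)
    have cross: "(\<Sum>p\<in>J. \<integral>S. (post_mean p (obs \<theta> S) - \<theta> p) * (\<Sum>i<n. \<delta> * cross p (S i)) \<partial>gdata n)
         \<le> \<beta> / 2 * risk \<theta> + 1 / (2 * \<beta>) * N" for \<theta>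
      using info
    proof
      assume 1: "n * \<delta>\<^sup>2 \<le> 1"
      have "(\<Sum>p\<in>J. \<integral>S. (post_mean p (obs \<theta> S) - \<theta> p) * (\<Sum>i<n. \<delta> * cross p (S i)) \<partial>gdata n)
         \<le> \<beta> / 2 * risk \<theta> + 1 / (2 * \<beta>) * (card J * (n * \<delta>\<^sup>2))" by (rule independent_cross_bound[OF \<beta>])
      also have "\<dots> \<le> \<beta> / 2 * risk \<theta> + 1 / (2 * \<beta>) * (card J * 1)"
        using mult_left_mono[OF 1, of "real (card J)"] \<beta> by (intro add_left_mono mult_left_mono) simp_all
      finally show ?thesis by (simp add: N_def)
    next
      assume 1: "(real n)\<^sup>2 * \<delta>\<^sup>2 * (exp (2 * \<rho>) - 1) \<le> card (half_blocks d k)"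
      have "(\<Sum>p\<in>J. \<integral>S. (post_mean p (obs \<theta> S) - \<theta> p) * (\<Sum>i<n. \<delta> * cross p (S i)) \<partial>gdata n)
         \<le> \<beta> / 2 * risk \<theta> + 1 / (2 * \<beta>) * ((real n)\<^sup>2 * \<delta>\<^sup>2 * (exp (2 * \<rho>) - 1))"
        by (rule private_cross_bound_total[OF st \<rho> \<beta> \<delta>])
      also have "\<dots> \<le> \<beta> / 2 * risk \<theta> + 1 / (2 * \<beta>) * N"
        unfolding N_def J_def using 1 \<beta> by (intro add_left_mono mult_left_mono) auto
      finally show ?thesis .
    qed
    have supp: "\<bar>\<theta> p\<bar> \<le> L" if "p \<in> J" "W.weight \<theta> \<noteq> 0" for p \<theta>
    proof -
      have "W.F b \<theta> < exp (real (64 * k))" if "b < d div (2 * k)" for b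
        using \<open>W.weight \<theta> \<noteq> 0\<close> that unfolding W.weight_pos_iff by blast
      then show ?thesis
        unfolding L_def using half_blocks_entry_bound[OF k(1), of p d \<theta>] \<open>p \<in> J\<close> unfolding J_def by blast
    qed
    have "N * Z \<le> (3 * \<beta> / 2 * (N / 4000) + 1 / (2 * \<beta>) * N) * Z
       + 1 / (2 * \<beta>) * (\<Sum>p\<in>J. (\<integral>\<theta>. W.weight \<theta> * (W.q p \<theta>)\<^sup>2 \<partial>gauss J) + (\<integral>\<theta>. W.weight \<theta> * (\<theta> p)\<^sup>2 \<partial>gauss J))"
      unfolding N_def Z_def
      by (rule weighted_van_trees[where \<omega>=W.weight and q=W.q and Q="sqrt (4 * real (81 * k))"])
         (rule W.weight_measurable W.weight_bounds W.q_measurable \<beta> cross[unfolded N_def]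
           | erule W.weight_has_derivative W.weight_q_continuous W.weight_q_le W.integrable_weight_q_sq R[unfolded N_def]
           | erule (1) supp)+
    also have "(\<Sum>p\<in>J. (\<integral>\<theta>. W.weight \<theta> * (W.q p \<theta>)\<^sup>2 \<partial>gauss J) + (\<integral>\<theta>. W.weight \<theta> * (\<theta> p)\<^sup>2 \<partial>gauss J))
       \<le> 1300 * N * Z"
    proof -
      have "real k * real (d div (2 * k)) \<le> N"
      proof -
        have "k * (d div (2 * k)) * 1 \<le> k * (d div (2 * k)) * k" using k by (intro mult_le_mono2) simp
        then have "k * (d div (2 * k)) \<le> card J" unfolding cJ by (simp add: power2_eq_square mult_ac)
        then show ?thesis unfolding N_def of_nat_mult[symmetric] of_nat_le_iff .
      qed
      then have "16 * real (81 * k) * real (card {..<d div (2 * k)}) * Z \<le> 1296 * N * Z"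
        using Z by (intro mult_right_mono) auto
      moreover have "real (4 * card J) * Z = 4 * N * Z" by (simp add: N_def)
      ultimately show ?thesis
        using W.fisher_information_le W.second_moment_le
        unfolding sum.distrib Z_def[symmetric] by linarith
    qed
    finally have "N * Z \<le> (3 * \<beta> / 2 * (N / 4000) + 1 / (2 * \<beta>) * N) * Z + 1 / (2 * \<beta>) * (1300 * N * Z)"
      using \<beta> by (simp add: divide_right_mono)
    also have "\<dots> = (3903 / 8000 + 1 / 2) * (N * Z)" by (simp add: \<beta>_def field_simps)
    also have "\<dots> < 1 * (N * Z)" using N0 Z by (intro mult_strict_right_mono) auto
    finally show False by simp
  qed
qed

section \<open>Choice of the block size\<close>

lemma card_half_blocks_ge:
  assumes k: "k \<ge> 1" "2 * k \<le> d"
  shows "real d * k / 4 \<le> card (half_blocks d k)"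
proof -
  define m where "m = d div (2 * k)"
  have m: "1 \<le> m" using k by (simp add: m_def Suc_le_eq div_greater_zero_iff)
  have "d = 2 * k * m + d mod (2 * k)" by (simp add: m_def)
  moreover have "d mod (2 * k) < 2 * k" using k by (intro mod_less_divisor) simp
  ultimately have "d \<le> 2 * k * m + 2 * k * 1" by linarith
  also have "\<dots> \<le> 2 * k * m + 2 * k * m" using m by (intro add_left_mono mult_le_mono2)
  finally have "real d \<le> real (2 * k * m + 2 * k * m)" by (simp only: of_nat_le_iff)
  then have "real d \<le> 4 * real k * real m" by simp
  then have "real d * k \<le> 4 * real k * real m * k" by (rule mult_right_mono) simp
  then show ?thesis unfolding card_half_blocks m_def[symmetric] by (simp add: power2_eq_square mult_ac)
qed

text \<open>Halving makes room for blocks of length \<open>2k\<close>; the assumption \<open>X \<ge> 2\<close> keeps the block size positive.\<close>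

lemma half_floor:
  fixes X :: real
  assumes "X \<ge> 2"
  defines "k \<equiv> nat \<lfloor>X / 2\<rfloor>"
  shows "1 \<le> k" "2 * real k \<le> X" "X / 4 \<le> k"
proof -
  have f: "1 \<le> \<lfloor>X / 2\<rfloor>" using assms by simp
  then show "1 \<le> k" by (simp add: k_def nat_le_iff le_nat_iff)
  have rk: "real k = \<lfloor>X / 2\<rfloor>" using f by (simp add: k_def)
  show "2 * real k \<le> X" unfolding rk using of_int_floor_le[of "X / 2"] by linarith
  show "X / 4 \<le> k" unfolding rk using f floor_correct[of "X / 2"] assms by linarith
qed

text \<open>The two conclusions are the requirements of \<open>block_minimax_bound\<close> on \<open>\<delta>\<close>; a bound on \<open>\<delta>\<close> of order
\<open>k powr (-\<alpha> - 1/2)\<close> makes the operator norm \<open>\<delta> * O(\<surd>k)\<close> decay like \<open>k powr (-\<alpha>)\<close>.\<close>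

lemma block_size_admissible:
  fixes k :: nat and \<alpha> M s \<delta> :: real
  assumes k: "k \<ge> 1" and \<alpha>: "\<alpha> > 0" and M: "M > 0" and s: "s > 0"
    and \<delta>: "\<delta> > 0" "\<delta> \<le> min (1 / 40) (M * 2 powr (- \<alpha>) / (120 * s\<^sup>2)) * real k powr (- \<alpha> - 1 / 2)"
  shows "\<delta> * (40 * sqrt k) \<le> 1" "3 * s\<^sup>2 * (\<delta> * (40 * sqrt k)) \<le> M * real (2 * k) powr (- \<alpha>)"
proof -
  define c where "c = min (1 / 40) (M * 2 powr (- \<alpha>) / (120 * s\<^sup>2))"
  have k0: "real k > 0" using k by simp
  have "\<delta> * sqrt k \<le> c * real k powr (- \<alpha> - 1 / 2) * sqrt k"
    using \<delta>(2) unfolding c_def by (rule mult_right_mono) simp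
  also have "\<dots> = c * (real k powr (- \<alpha> - 1 / 2) * real k powr (1 / 2))" using k0 by (simp add: powr_half_sqrt)
  also have "real k powr (- \<alpha> - 1 / 2) * real k powr (1 / 2) = real k powr (- \<alpha>)"
    unfolding powr_add[symmetric] by simp
  finally have le: "\<delta> * sqrt k \<le> c * real k powr (- \<alpha>)" .
  have "real k powr (- \<alpha>) \<le> real k powr 0" using k \<alpha> by (intro powr_mono) auto
  then have p1: "real k powr (- \<alpha>) \<le> 1" using k by simp
  have "c * real k powr (- \<alpha>) \<le> 1 / 40 * 1" unfolding c_def using p1 by (intro mult_mono) auto
  then show "\<delta> * (40 * sqrt k) \<le> 1" using le by simp
  have "c * real k powr (- \<alpha>) \<le> M * 2 powr (- \<alpha>) / (120 * s\<^sup>2) * real k powr (- \<alpha>)"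
    unfolding c_def by (intro mult_right_mono) auto
  with le have "\<delta> * sqrt k \<le> M * 2 powr (- \<alpha>) / (120 * s\<^sup>2) * real k powr (- \<alpha>)" by linarith
  from mult_left_mono[OF this, of "120 * s\<^sup>2"] s
  have "120 * s\<^sup>2 * (\<delta> * sqrt k) \<le> M * (2 powr (- \<alpha>) * real k powr (- \<alpha>))" by simp
  also have "2 powr (- \<alpha>) * real k powr (- \<alpha>) = real (2 * k) powr (- \<alpha>)"
    by (simp add: powr_mult)
  finally show "3 * s\<^sup>2 * (\<delta> * (40 * sqrt k)) \<le> M * real (2 * k) powr (- \<alpha>)" by simp
qed

lemma exp_minus_one_le: "exp (2 * \<rho>) - 1 \<le> 2 * \<rho> * exp (2 * \<rho>\<^sub>0)" if "0 \<le> \<rho>" "\<rho> \<le> \<rho>\<^sub>0" for \<rho> \<rho>\<^sub>0 :: real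
proof -
  have "1 - 2 * \<rho> \<le> exp (- (2 * \<rho>))" using exp_ge_add_one_self[of "- (2 * \<rho>)"] by simp
  then have "exp (2 * \<rho>) * (1 - exp (- (2 * \<rho>))) \<le> exp (2 * \<rho>) * (2 * \<rho>)" by (intro mult_left_mono) auto
  then have "exp (2 * \<rho>) - 1 \<le> exp (2 * \<rho>) * (2 * \<rho>)" by (simp add: right_diff_distrib exp_minus_inverse)
  also have "\<dots> \<le> exp (2 * \<rho>\<^sub>0) * (2 * \<rho>)" using that by (intro mult_right_mono) auto
  finally show ?thesis by (simp add: mult_ac)
qed

context
  fixes \<alpha> K M\<^sub>0 M \<rho>\<^sub>0 s c1 :: real
  assumes \<alpha>: "\<alpha> > 0" and K: "K > 0" and M: "M > 0" and s: "s > 0"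
    and sK: "32 * s\<^sup>2 \<le> 3 * K\<^sup>2" and sM: "4 * s\<^sup>2 \<le> M\<^sub>0"
  defines "c1 \<equiv> min (1 / 40) (M * 2 powr (- \<alpha>) / (120 * s\<^sup>2))"
begin

lemma c1: "0 < c1" "c1 \<le> 1" using M s by (auto simp: c1_def)

text \<open>With \<open>\<delta>\<close> of order \<open>n powr (-1/2)\<close>, the class admits blocks up to \<open>k = n powr (1 / (2\<alpha> + 1))\<close>, and the bound is of
order \<open>\<delta>\<^sup>2 k = k / n\<close>.\<close>

lemma statistical_minimax_bound:
  assumes A: "A \<in> zCDP_estimators n d \<rho>" and q: "q \<ge> (2 :: ereal)" and \<rho>: "0 \<le> \<rho>"
    and n: "n \<ge> 1" and big: "2 \<le> real n powr (1 / (2 * \<alpha> + 1))" "2 \<le> d"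
  shows "ennreal (s ^ 4 * c1\<^sup>2 / 64000 * min (real n powr (- (2 * \<alpha> / (2 * \<alpha> + 1)))) (real d / n))
    \<le> (SUP P\<in>distribution_class d \<alpha> K M\<^sub>0 M. ennreal (real d powr (- real_of_ereal (2 / q))) * schatten_risk n d q A P)"
proof -
  define X where "X = min (real n powr (1 / (2 * \<alpha> + 1))) (real d)"
  define k where "k = nat \<lfloor>X / 2\<rfloor>"
  have "X \<ge> 2" using big by (simp add: X_def)
  note k = half_floor[OF this, folded k_def]
  have kd: "2 * k \<le> d" using k(2) by (simp add: X_def)
  have kn: "real k \<le> real n powr (1 / (2 * \<alpha> + 1))" using k(1,2) by (simp add: X_def)
  define \<delta> where "\<delta> = c1 * real n powr (- 1 / 2)"
  have n0: "real n > 0" using n by simp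
  have \<delta>0: "\<delta> > 0" using c1 n0 by (simp add: \<delta>_def)
  have nn: "(real n powr (- 1 / 2))\<^sup>2 = 1 / n"
    using n0 by (simp add: power2_eq_square powr_add[symmetric] powr_minus_divide)
  have \<delta>2: "\<delta>\<^sup>2 = c1\<^sup>2 / n" unfolding \<delta>_def power_mult_distrib nn by simp
  have "real n powr (- 1 / 2) \<le> real k powr (- \<alpha> - 1 / 2)"
  proof -
    have "real n powr (- 1 / 2) = (real n powr (1 / (2 * \<alpha> + 1))) powr (- \<alpha> - 1 / 2)"
    proof -
      have "1 / y * (- 1 / 2 * y) = - 1 / 2" if "y \<noteq> 0" for y :: real using that by simp
      moreover have "2 * \<alpha> + 1 \<noteq> 0" using \<alpha> by linarith
      ultimately have "1 / (2 * \<alpha> + 1) * (- 1 / 2 * (2 * \<alpha> + 1)) = - 1 / 2" by blast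
      moreover have "- 1 / 2 * (2 * \<alpha> + 1) = - \<alpha> - 1 / 2" by (simp add: algebra_simps)
      ultimately show ?thesis by (simp only: powr_powr)
    qed
    also have "\<dots> \<le> real k powr (- \<alpha> - 1 / 2)" using kn k(1) \<alpha> by (intro powr_mono2') auto
    finally show ?thesis .
  qed
  then have \<delta>le: "\<delta> \<le> c1 * real k powr (- \<alpha> - 1 / 2)" unfolding \<delta>_def using c1 by simp
  note adm = block_size_admissible[OF k(1) \<alpha> M s \<delta>0 \<delta>le[unfolded c1_def]]
  have "n * \<delta>\<^sup>2 \<le> 1" using n0 c1 by (simp add: \<delta>2 power_le_one)
  then have bound: "ennreal ((s\<^sup>2 * \<delta>)\<^sup>2 / d * (card (half_blocks d k) / 4000))
    \<le> (SUP P\<in>distribution_class d \<alpha> K M\<^sub>0 M. ennreal (real d powr (- real_of_ereal (2 / q))) * schatten_risk n d q A P)"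
    by (intro block_minimax_bound[OF k(1) kd s \<delta>0 \<rho> \<alpha> K M q sK sM adm _ A]) simp
  have "s ^ 4 * c1\<^sup>2 / 64000 * min (real n powr (- (2 * \<alpha> / (2 * \<alpha> + 1)))) (real d / n) = s ^ 4 * c1\<^sup>2 / 16000 * (X / 4) / n"
  proof -
    have "real n powr (- (2 * \<alpha> / (2 * \<alpha> + 1))) = real n powr (1 / (2 * \<alpha> + 1) - 1)"
      using \<alpha> by (intro arg_cong[where f="\<lambda>x. real n powr x"]) (simp add: field_simps)
    also have "\<dots> = real n powr (1 / (2 * \<alpha> + 1)) / n" using n0 by (simp add: powr_diff)
    finally have "min (real n powr (- (2 * \<alpha> / (2 * \<alpha> + 1)))) (real d / n) = X / n"
      using n0 unfolding X_def by (simp add: min_def divide_le_cancel)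
    then show ?thesis by simp
  qed
  also have "\<dots> \<le> s ^ 4 * c1\<^sup>2 / 16000 * k / n"
    using k(3) n0 s by (intro divide_right_mono mult_left_mono) auto
  also have "\<dots> = (s\<^sup>2 * \<delta>)\<^sup>2 / d * (real d * k / 4 / 4000)"
    using big n0 by (simp add: power_mult_distrib \<delta>2 field_simps)
  also have "\<dots> \<le> (s\<^sup>2 * \<delta>)\<^sup>2 / d * (card (half_blocks d k) / 4000)"
    using card_half_blocks_ge[OF k(1) kd] by (intro mult_left_mono divide_right_mono) auto
  finally show ?thesis by (rule order_trans[OF ennreal_leI bound])
qed

text \<open>Put \<open>t = d / (\<rho> n\<^sup>2)\<close>. About \<open>d k\<close> entries are free, so privacy allows \<open>\<delta>\<^sup>2\<close> of order \<open>t k\<close>. The class then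
admits blocks up to \<open>\<kappa> = t powr (- 1 / (2\<alpha> + 2))\<close>, and the bound is of order \<open>\<delta>\<^sup>2 k = t k\<^sup>2\<close>.\<close>

lemma private_minimax_bound:
  assumes A: "A \<in> zCDP_estimators n d \<rho>" and q: "q \<ge> (2 :: ereal)" and \<rho>: "0 < \<rho>" "\<rho> \<le> \<rho>\<^sub>0"
    and n: "n \<ge> 1" and big: "real d / (\<rho> * (real n)\<^sup>2) \<le> 2 powr (- (2 * \<alpha> + 2))" "2 \<le> d"
  shows "ennreal (s ^ 4 * (c1 * exp (- \<rho>\<^sub>0) / 3)\<^sup>2 / 256000 * min ((real d / (\<rho> * (real n)\<^sup>2)) powr (\<alpha> / (\<alpha> + 1))) (real d ^ 3 / (\<rho> * (real n)\<^sup>2)))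
    \<le> (SUP P\<in>distribution_class d \<alpha> K M\<^sub>0 M. ennreal (real d powr (- real_of_ereal (2 / q))) * schatten_risk n d q A P)"
proof -
  define t where "t = real d / (\<rho> * (real n)\<^sup>2)"
  have n0: "real n > 0" and d0: "real d > 0" using n big by auto
  have t0: "t > 0" using n0 d0 \<rho> by (simp add: t_def)
  define \<kappa> where "\<kappa> = t powr (- 1 / (2 * \<alpha> + 2))"
  have \<kappa>0: "\<kappa> > 0" using t0 by (simp add: \<kappa>_def)
  have \<kappa>2: "2 \<le> \<kappa>"
  proof -
    have "- y * (- 1 / y) = 1" if "y \<noteq> 0" for y :: real using that by simp
    moreover have "2 * \<alpha> + 2 \<noteq> 0" using \<alpha> by linarith
    ultimately have "- (2 * \<alpha> + 2) * (- 1 / (2 * \<alpha> + 2)) = 1" by blast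
    then have "2 = (2 powr (- (2 * \<alpha> + 2))) powr (- 1 / (2 * \<alpha> + 2))" by (simp only: powr_powr) simp
    also have "\<dots> \<le> t powr (- 1 / (2 * \<alpha> + 2))"
      using big(1) t0 \<alpha> unfolding t_def[symmetric] by (intro powr_mono2') auto
    finally show ?thesis by (simp add: \<kappa>_def)
  qed
  have t\<kappa>: "t = \<kappa> powr (- (2 * \<alpha> + 2))"
  proof -
    have "- 1 / y * (- y) = 1" if "y \<noteq> 0" for y :: real using that by simp
    moreover have "2 * \<alpha> + 2 \<noteq> 0" using \<alpha> by linarith
    ultimately have "- 1 / (2 * \<alpha> + 2) * (- (2 * \<alpha> + 2)) = 1" by blast
    then show ?thesis unfolding \<kappa>_def powr_powr using t0 by simp
  qed
  define X where "X = min \<kappa> (real d)"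
  define k where "k = nat \<lfloor>X / 2\<rfloor>"
  have X2: "X \<ge> 2" using \<kappa>2 big by (simp add: X_def)
  note k = half_floor[OF this, folded k_def]
  have kd: "2 * k \<le> d" using k(2) by (simp add: X_def)
  have k\<kappa>: "real k \<le> \<kappa>" using k(1,2) by (simp add: X_def)
  have k0: "real k > 0" using k(1) by simp
  \<comment> \<open>The factor \<open>exp (- \<rho>\<^sub>0)\<close> compensates \<open>exp (2 \<rho>) - 1 \<le> 2 \<rho> exp (2 \<rho>\<^sub>0)\<close>, and \<open>2 / 9 \<le> 1 / 4\<close> explains the 3.\<close>
  define c3 where "c3 = c1 * exp (- \<rho>\<^sub>0) / 3"
  have \<rho>00: "0 \<le> \<rho>\<^sub>0" using \<rho> by simp
  have "exp (- \<rho>\<^sub>0) \<le> 1" using \<rho>00 by simp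
  then have "c1 * exp (- \<rho>\<^sub>0) \<le> c1 * 1" using c1 by (intro mult_left_mono) auto
  then have c3: "0 < c3" "c3 \<le> c1" using c1 unfolding c3_def by (simp, linarith)
  define \<delta> where "\<delta> = c3 * sqrt (t * k)"
  have \<delta>0: "\<delta> > 0" using c3 t0 k0 by (simp add: \<delta>_def)
  have \<delta>2: "\<delta>\<^sup>2 = c3\<^sup>2 * (t * k)" using t0 k0 by (simp add: \<delta>_def power_mult_distrib)
  have "sqrt (t * k) \<le> real k powr (- \<alpha> - 1 / 2)"
  proof -
    have "t * k \<le> real k powr (- (2 * \<alpha> + 2)) * real k powr 1"
      unfolding t\<kappa> using k\<kappa> k0 \<alpha> by (intro mult_mono powr_mono2') auto
    also have "\<dots> = (real k powr (- \<alpha> - 1 / 2))\<^sup>2"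
      unfolding power2_eq_square powr_add[symmetric] by (rule arg_cong[where f="\<lambda>x. real k powr x"]) simp
    finally have "sqrt (t * k) \<le> sqrt ((real k powr (- \<alpha> - 1 / 2))\<^sup>2)" by (rule real_sqrt_le_mono)
    then show ?thesis by simp
  qed
  then have "\<delta> \<le> c1 * real k powr (- \<alpha> - 1 / 2)"
    unfolding \<delta>_def using c3 c1 t0 k0 by (intro mult_mono) auto
  note adm = block_size_admissible[OF k(1) \<alpha> M s \<delta>0 this[unfolded c1_def]]
  have info: "(real n)\<^sup>2 * \<delta>\<^sup>2 * (exp (2 * \<rho>) - 1) \<le> card (half_blocks d k)"
  proof -
    have "(real n)\<^sup>2 * \<delta>\<^sup>2 * (exp (2 * \<rho>) - 1) \<le> (real n)\<^sup>2 * \<delta>\<^sup>2 * (2 * \<rho> * exp (2 * \<rho>\<^sub>0))"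
      using \<rho> by (intro mult_left_mono exp_minus_one_le) auto
    also have "\<dots> = 2 * (c3 * exp \<rho>\<^sub>0)\<^sup>2 * ((\<rho> * (real n)\<^sup>2) * t) * k"
      by (simp add: \<delta>2 power_mult_distrib exp_double[symmetric] mult_ac)
    also have "(\<rho> * (real n)\<^sup>2) * t = d" using \<rho> n0 by (simp add: t_def)
    also have "c3 * exp \<rho>\<^sub>0 = c1 / 3" by (simp add: c3_def exp_minus field_simps)
    also have "2 * (c1 / 3)\<^sup>2 * real d * k \<le> 2 * (1 / 3)\<^sup>2 * real d * k"
      using c1 by (intro mult_right_mono mult_left_mono power_mono) auto
    also have "\<dots> \<le> real d * k / 4" using d0 k0 by (simp add: power2_eq_square field_simps)
    also have "\<dots> \<le> card (half_blocks d k)" by (rule card_half_blocks_ge[OF k(1) kd])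
    finally show ?thesis .
  qed
  have bound: "ennreal ((s\<^sup>2 * \<delta>)\<^sup>2 / d * (card (half_blocks d k) / 4000))
    \<le> (SUP P\<in>distribution_class d \<alpha> K M\<^sub>0 M. ennreal (real d powr (- real_of_ereal (2 / q))) * schatten_risk n d q A P)"
    using info \<rho> by (intro block_minimax_bound[OF k(1) kd s \<delta>0 _ \<alpha> K M q sK sM adm _ A]) simp_all
  have "min (t powr (\<alpha> / (\<alpha> + 1))) (real d ^ 3 / (\<rho> * (real n)\<^sup>2)) = t * X\<^sup>2"
  proof -
    have "\<kappa>\<^sup>2 = t powr (- 1 / (\<alpha> + 1))"
      using \<alpha> unfolding \<kappa>_def power2_eq_square powr_add[symmetric] by (intro arg_cong[where f="\<lambda>x. t powr x"]) (simp add: field_simps)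
    then have "t * \<kappa>\<^sup>2 = t powr 1 * t powr (- 1 / (\<alpha> + 1))" using t0 by simp
    also have "\<dots> = t powr (\<alpha> / (\<alpha> + 1))"
      unfolding powr_add[symmetric] using \<alpha> by (intro arg_cong[where f="\<lambda>x. t powr x"]) (simp add: field_simps)
    finally have 1: "t * \<kappa>\<^sup>2 = t powr (\<alpha> / (\<alpha> + 1))" .
    have 2: "t * (real d)\<^sup>2 = real d ^ 3 / (\<rho> * (real n)\<^sup>2)" by (simp add: t_def power2_eq_square power3_eq_cube)
    show ?thesis
    proof (cases "\<kappa> \<le> d")
      case True
      then have "\<kappa>\<^sup>2 \<le> (real d)\<^sup>2" using \<kappa>0 by (intro power_mono) auto
      then have "t * \<kappa>\<^sup>2 \<le> t * (real d)\<^sup>2" using t0 by simp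
      then show ?thesis using True by (simp add: X_def 1[symmetric] 2[symmetric] min_def)
    next
      case False
      then have "(real d)\<^sup>2 \<le> \<kappa>\<^sup>2" by (intro power_mono) auto
      then have "t * (real d)\<^sup>2 \<le> t * \<kappa>\<^sup>2" using t0 by simp
      then show ?thesis using False by (simp add: X_def 1[symmetric] 2[symmetric] min_def)
    qed
  qed
  then have "s ^ 4 * c3\<^sup>2 / 256000 * min (t powr (\<alpha> / (\<alpha> + 1))) (real d ^ 3 / (\<rho> * (real n)\<^sup>2))
      = s ^ 4 * c3\<^sup>2 / 16000 * (t * (X / 4)\<^sup>2)" by (simp add: power_divide)
  also have "\<dots> \<le> s ^ 4 * c3\<^sup>2 / 16000 * (t * (real k)\<^sup>2)"
    using k(3) X2 t0 s by (intro mult_left_mono power_mono) auto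
  also have "\<dots> = (s\<^sup>2 * \<delta>)\<^sup>2 / d * (real d * k / 4 / 4000)"
  proof -
    have "(s\<^sup>2 * \<delta>)\<^sup>2 = s ^ 4 * (c3\<^sup>2 * (t * k))"
      unfolding power_mult_distrib \<delta>2 by (simp add: power_mult[symmetric])
    then show ?thesis using d0 by (simp add: power2_eq_square[of "real k"])
  qed
  also have "\<dots> \<le> (s\<^sup>2 * \<delta>)\<^sup>2 / d * (card (half_blocks d k) / 4000)"
    using card_half_blocks_ge[OF k(1) kd] by (intro mult_left_mono divide_right_mono) auto
  finally show ?thesis unfolding c3_def t_def by (rule order_trans[OF ennreal_leI bound])
qed

end

theorem theorem4p2:
  fixes \<alpha> K M\<^sub>0 M c\<^sub>0 \<rho>\<^sub>0 :: real
  assumes "\<alpha> > 0" "K > 0" "M\<^sub>0 > 0" "M > 0" "c\<^sub>0 > 0" "\<rho>\<^sub>0 > 0"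
  shows "\<exists>c>0. \<forall>q::ereal. q \<ge> 2 \<longrightarrow>
    (\<forall>(d :: nat \<Rightarrow> nat) (\<rho> :: nat \<Rightarrow> real).
      (\<forall>\<^sub>F n in sequentially. real (d n) \<ge> c\<^sub>0 * ln (real n)) \<longrightarrow>
      (\<forall>\<^sub>F n in sequentially. 0 < \<rho> n \<and> \<rho> n \<le> \<rho>\<^sub>0) \<longrightarrow>
      (\<lambda>n. real (d n) / (\<rho> n * (real n)\<^sup>2)) \<longlonglongrightarrow> 0 \<longrightarrow>
      (\<forall>\<^sub>F n in sequentially.
        (INF A\<in>zCDP_estimators n (d n) (\<rho> n).
          SUP P\<in>distribution_class (d n) \<alpha> K M\<^sub>0 M.
            ennreal (real (d n) powr (- real_of_ereal (2 / q))) * schatten_risk n (d n) q A P)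
        \<ge> ennreal (c *
            (min (real n powr (- (2 * \<alpha> / (2 * \<alpha> + 1)))) (real (d n) / real n)
           + min ((real (d n) / (\<rho> n * (real n)\<^sup>2)) powr (\<alpha> / (\<alpha> + 1)))
                 (real (d n) ^ 3 / (\<rho> n * (real n)\<^sup>2))))))"
proof -
  define s where "s = sqrt (min (3 * K\<^sup>2 / 32) (M\<^sub>0 / 4))"
  have s2: "s\<^sup>2 = min (3 * K\<^sup>2 / 32) (M\<^sub>0 / 4)" and s: "s > 0" using assms by (auto simp: s_def)
  have sK: "32 * s\<^sup>2 \<le> 3 * K\<^sup>2" and sM: "4 * s\<^sup>2 \<le> M\<^sub>0" unfolding s2 by auto
  define c1 where "c1 = min (1 / 40) (M * 2 powr (- \<alpha>) / (120 * s\<^sup>2))"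
  have c1: "c1 > 0" using assms s by (simp add: c1_def)
  define a where "a = s ^ 4 * c1\<^sup>2 / 64000"
  define b where "b = s ^ 4 * (c1 * exp (- \<rho>\<^sub>0) / 3)\<^sup>2 / 256000"
  have ab: "a > 0" "b > 0" using s c1 by (auto simp: a_def b_def)
  define c where "c = min a b / 2"
  have c: "c > 0" using ab by (simp add: c_def)
  show ?thesis
  proof (intro exI[of _ c] conjI c allI impI)
    fix q :: ereal and d :: "nat \<Rightarrow> nat" and \<rho> :: "nat \<Rightarrow> real"
    assume q: "q \<ge> 2" and ed: "\<forall>\<^sub>F n in sequentially. real (d n) \<ge> c\<^sub>0 * ln (real n)"
      and e\<rho>: "\<forall>\<^sub>F n in sequentially. 0 < \<rho> n \<and> \<rho> n \<le> \<rho>\<^sub>0"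
      and lim: "(\<lambda>n. real (d n) / (\<rho> n * (real n)\<^sup>2)) \<longlonglongrightarrow> 0"
    have e1: "\<forall>\<^sub>F n in sequentially. c\<^sub>0 * ln (real n) > 1"
    proof -
      have "filterlim (\<lambda>n. c\<^sub>0 * ln (real n)) at_top sequentially"
        using \<open>c\<^sub>0 > 0\<close> by (intro filterlim_tendsto_pos_mult_at_top[OF tendsto_const]
            filterlim_compose[OF ln_at_top filterlim_real_sequentially])
      then show ?thesis by (simp add: filterlim_at_top_dense)
    qed
    have e2: "\<forall>\<^sub>F n in sequentially. 2 \<le> real n powr (1 / (2 * \<alpha> + 1))"
      using eventually_ge_at_top[of "nat \<lceil>2 powr (2 * \<alpha> + 1)\<rceil>"]
    proof eventually_elim
      case (elim n)
      then have "2 powr (2 * \<alpha> + 1) \<le> real n" by (simp add: nat_ceiling_le_eq)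
      then have "(2 powr (2 * \<alpha> + 1)) powr (1 / (2 * \<alpha> + 1)) \<le> real n powr (1 / (2 * \<alpha> + 1))"
        using \<open>\<alpha> > 0\<close> by (intro powr_mono2) auto
      then show ?case using \<open>\<alpha> > 0\<close> by (simp add: powr_powr)
    qed
    have e3: "\<forall>\<^sub>F n in sequentially. real (d n) / (\<rho> n * (real n)\<^sup>2) < 2 powr (- (2 * \<alpha> + 2))"
      using lim by (rule order_tendstoD) simp
    show "\<forall>\<^sub>F n in sequentially. ennreal (c *
            (min (real n powr (- (2 * \<alpha> / (2 * \<alpha> + 1)))) (real (d n) / real n)
           + min ((real (d n) / (\<rho> n * (real n)\<^sup>2)) powr (\<alpha> / (\<alpha> + 1)))
                 (real (d n) ^ 3 / (\<rho> n * (real n)\<^sup>2))))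
        \<le> (INF A\<in>zCDP_estimators n (d n) (\<rho> n).
          SUP P\<in>distribution_class (d n) \<alpha> K M\<^sub>0 M.
            ennreal (real (d n) powr (- real_of_ereal (2 / q))) * schatten_risk n (d n) q A P)"
      using ed e\<rho> e1 e2 e3 eventually_ge_at_top[of 1]
    proof eventually_elim
      case (elim n)
      have d2: "2 \<le> d n" using elim(1,3) by linarith
      define x where "x = min (real n powr (- (2 * \<alpha> / (2 * \<alpha> + 1)))) (real (d n) / real n)"
      define y where "y = min ((real (d n) / (\<rho> n * (real n)\<^sup>2)) powr (\<alpha> / (\<alpha> + 1))) (real (d n) ^ 3 / (\<rho> n * (real n)\<^sup>2))"
      have xy: "0 \<le> x" "0 \<le> y" using elim(2) by (auto simp: x_def y_def)
      have "c * (x + y) \<le> max (a * x) (b * y)"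
      proof -
        have "c * x \<le> a * x / 2" "c * y \<le> b * y / 2"
          using xy by (auto simp: c_def intro!: mult_right_mono)
        then show ?thesis unfolding distrib_left by linarith
      qed
      then have "ennreal (c * (x + y)) \<le> max (ennreal (a * x)) (ennreal (b * y))"
        unfolding le_max_iff_disj using ennreal_leI by blast
      also have "\<dots> \<le> (INF A\<in>zCDP_estimators n (d n) (\<rho> n).
          SUP P\<in>distribution_class (d n) \<alpha> K M\<^sub>0 M.
            ennreal (real (d n) powr (- real_of_ereal (2 / q))) * schatten_risk n (d n) q A P)"
      proof (rule INF_greatest, rule max.boundedI)
        fix A assume A: "A \<in> zCDP_estimators n (d n) (\<rho> n)"
        show "ennreal (a * x) \<le> (SUP P\<in>distribution_class (d n) \<alpha> K M\<^sub>0 M.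
            ennreal (real (d n) powr (- real_of_ereal (2 / q))) * schatten_risk n (d n) q A P)"
          unfolding a_def x_def c1_def using elim d2 assms
          by (intro statistical_minimax_bound[OF _ _ _ s sK sM A q]) auto
        show "ennreal (b * y) \<le> (SUP P\<in>distribution_class (d n) \<alpha> K M\<^sub>0 M.
            ennreal (real (d n) powr (- real_of_ereal (2 / q))) * schatten_risk n (d n) q A P)"
          unfolding b_def y_def c1_def using elim d2 assms
          by (intro private_minimax_bound[OF _ _ _ s sK sM A q]) auto
      qed
      finally show ?case unfolding x_def y_def .
    qed
  qed
qed

end
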